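(* Let $d\ge1$ and let $w(k)=c_{d,s}|k|^{s-d}$ with $0<s<d$, and consider the zero-temperature problem $E^{\rm HF}(\rho)$. (First-order phase transition.) If $0<s<\min(2,d)$, then there is a first-order transition between a ferromagnetic and a paramagnetic phase at density $$\rho_c:=\left(\frac{\lambda(d,s)}{\kappa(d)}\,\frac{1-2^{-s/d}}{1-2^{-2/d}}\right)^{\frac{d}{2-s}}.$$ More precisely: - for all $0<\rho<\rho_c$, the minimisers of $E^{\rm HF}(\rho)$ are all of the form $\gamma_{\rm ferro}(k)=\mathbf 1(k^2\le c_{\rm TF}\rho^{2/d})\,|\nu\rangle\langle\nu|$ with $\nu$ any normalised vector in $\mathbb{C}^2$ (ferromagnetic phase); - for all $\rho>\rho_c$, the minimiser of $E^{\rm HF}(\rho)$ is unique, given by $\gamma_{\rm para}(k)=\mathbf 1(k^2\le c_{\rm TF}(\rho/2)^{2/d})\,\mathbb{I}_2$ (paramagnetic phase); - for $\rho=\rho_c$, the minimisers are of either form. The first derivative of $\rho\mapsto E^{\rm HF}(\rho)$ has a jump at $\rho=\rho_c$. (Second-order phase transition.) In dimension $d\ge3$, if $\min(2,d)<s<d$, then there is a smooth transition between a ferromagnetic and a paramagnetic phase, occurring between the two densities $$\rho_{c,\min}=2\left(\frac{\kappa(d)}{\lambda(d,s)}\,\frac{2(d+2)}{s(d+s)}\right)^{\frac{d}{s-2}},\qquad \rho_{c,\max}=\left(\frac{\kappa(d)}{\lambda(d,s)}\,\frac{d+2}{d+s}\right)^{\frac{d}{s-2}}.$$ More precisely: - for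 $0<\rho\le\rho_{c,\min}$, the minimiser of $E^{\rm HF}(\rho)$ is unique, given by $\gamma_{\rm para}(k)=\mathbf 1(k^2\le c_{\rm TF}(\rho/2)^{2/d})\,\mathbb{I}_2$ (paramagnetic phase); - for $\rho_{c,\min}<\rho<\rho_{c,\max}$, the minimisers of $E^{\rm HF}(\rho)$ are all of the form $$\gamma_{\rm mixed}(k)=U\begin{pmatrix}\mathbf 1\big(k^2\le c_{\rm TF}[t_\rho\rho]^{2/d}\big)&0\\0&\mathbf 1\big(k^2\le c_{\rm TF}[(1-t_\rho)\rho]^{2/d}\big)\end{pmatrix}U^*$$ with $U\in\mathrm{SU}(2)$, for a unique $t_\rho\in(0,1/2)$; - for $\rho\ge\rho_{c,\max}$, the minimisers of $E^{\rm HF}(\rho)$ are all of the form $\gamma_{\rm ferro}(k)=\mathbf 1(k^2\le c_{\rm TF}\rho^{2/d})\,|\nu\rangle\langle\nu|$ with $\nu$ any normalised vector in $\mathbb{C}^2$ (pure ferromagnetic phase). (The case $s=2$.) If $d\ge3$ and $s=2$, then the system is paramagnetic for all $\rho>0$ if $\kappa(d)-\lambda(d,2)>0$, and is pure ferromagnetic for all $\rho>0$ if $\kappa(d)-\lambda(d,2)<0$.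
   Context: The zero-temperature problem is $$E^{\rm HF}(\rho)=\min\Big\{\frac{1}{2(2\pi)^d}\int_{\mathbb{R}^d}|k|^2\,\mathrm{tr}_{\mathbb{C}^2}\gamma(k)\,dk-\frac{1}{2(2\pi)^d}\iint_{\mathbb{R}^d\times\mathbb{R}^d}w(k-k')\,\mathrm{tr}_{\mathbb{C}^2}[\gamma(k)\gamma(k')]\,dk\,dk'\Big\},$$ over measurable $\gamma$ with values in $2\times2$ hermitian matrices, $0\le\gamma(k)\le\mathbb{I}_2$, $(2\pi)^{-d}\int\mathrm{tr}_{\mathbb{C}^2}\gamma=\rho$ (functions equal almost everywhere are identified). Constants: $$c_{d,s}=\frac{1}{(2\pi)^{d/2}}\frac{2^{(d-s)/2}}{2^{s/2}}\frac{\Gamma(\frac{d-s}{2})}{\Gamma(\frac s2)},\qquad c_{\rm TF}=4\pi^2\Big(\frac{d}{|\mathbb{S}^{d-1}|}\Big)^{2/d},\qquad \kappa(d)=\frac{2\pi^2d}{d+2}\Big(\frac{d}{|\mathbb{S}^{d-1}|}\Big)^{2/d},$$ $$\lambda(d,s)=\frac{1}{2\pi^{\frac d2-s}}\Big(\frac{d}{|\mathbb{S}^{d-1}|}\Big)^{\frac{d+s}{d}}\frac{\Gamma(\frac{d-s}{2})}{\Gamma(\frac s2)}\,c_{\rm D}(d,s),\qquad c_{\rm D}(d,s)=\iint_{\mathbb{R}^d\times\mathbb{R}^d}\frac{\mathbf 1(|k|<1)\mathbf 1(|k'|<1)}{|k-k'|^{d-s}}\,dk\,dk'.$$ Here $|\mathbb{S}^{d-1}|$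 is the surface measure of the unit sphere ($|\mathbb{S}^0|=2$). "The system is paramagnetic" means that the minimiser of $E^{\rm HF}(\rho)$ is unique and equal to $\mathbf 1(k^2\le c_{\rm TF}(\rho/2)^{2/d})\,\mathbb{I}_2$; "pure ferromagnetic" means that the minimisers are exactly the $\mathbf 1(k^2\le c_{\rm TF}\rho^{2/d})\,|\nu\rangle\langle\nu|$, with $\nu$ any normalised vector of $\mathbb{C}^2$ and $|\nu\rangle\langle\nu|$ the orthogonal projection onto $\mathbb{C}\nu$. *)

theory Defs
  imports "HOL-Analysis.Analysis"
begin

section \<open>Complex matrices\<close>

definition conj_transpose :: "complex^'n^'m \<Rightarrow> complex^'m^'n" where
  "conj_transpose A = (\<chi> i j. cnj (A $ j $ i))"

definition hermitian :: "complex^'n^'n \<Rightarrow> bool" where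
  "hermitian A \<longleftrightarrow> conj_transpose A = A"

definition pos_semidef :: "complex^'n^'n \<Rightarrow> bool" where
  "pos_semidef A \<longleftrightarrow>
     hermitian A \<and> (\<forall>v. 0 \<le> Re (\<Sum>i\<in>UNIV. \<Sum>j\<in>UNIV. cnj (v $ i) * A $ i $ j * v $ j))"

definition SU2 :: "(complex^2^2) set" where
  "SU2 = {U. U ** conj_transpose U = mat 1 \<and> conj_transpose U ** U = mat 1 \<and> det U = 1}"

text \<open>The rank-one operator \<open>|\<nu>\<rangle>\<langle>\<nu>|\<close>, for a unit vector the orthogonal projection onto its span.\<close>

definition ket_bra :: "complex^'n \<Rightarrow> complex^'n^'n" where
  "ket_bra \<nu> = (\<chi> i j. \<nu> $ i * cnj (\<nu> $ j))"


section \<open>Constants\<close>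

text \<open>
  The surface measure of the unit sphere of \<open>\<real>\<^sup>d\<close>, defined as usual by polar coordinates, that is
  as \<open>d\<close> times the volume of the unit ball.
\<close>

definition sphere_area :: "nat \<Rightarrow> real" where
  "sphere_area d = real d * unit_ball_vol (real d)"

lemma sphere_area_closed_form:
  assumes "d \<ge> 1"
  shows "sphere_area d = 2 * pi powr (real d / 2) / Gamma (real d / 2)"
proof -
  have "Gamma (real d / 2 + 1) = real d / 2 * Gamma (real d / 2)"
    using assms by (intro Gamma_plus1) (auto elim!: nonpos_Ints_cases)
  moreover have "Gamma (real d / 2) > 0"
    using assms by (intro Gamma_real_pos) auto
  ultimately show ?thesis
    using assms unfolding sphere_area_def unit_ball_vol_def by (simp only:) simp
qed

lemma sphere_area_1: "sphere_area 1 = 2"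
  by (simp add: sphere_area_def)

definition c_riesz :: "nat \<Rightarrow> real \<Rightarrow> real" where
  "c_riesz d s =
     1 / (2 * pi) powr (real d / 2) * (2 powr ((real d - s) / 2) / 2 powr (s / 2))
       * (Gamma ((real d - s) / 2) / Gamma (s / 2))"

definition c_TF :: "nat \<Rightarrow> real" where
  "c_TF d = 4 * pi\<^sup>2 * (real d / sphere_area d) powr (2 / real d)"

definition kappa :: "nat \<Rightarrow> real" where
  "kappa d = 2 * pi\<^sup>2 * real d / (real d + 2) * (real d / sphere_area d) powr (2 / real d)"

text \<open>
  The integrand is integrable for \<open>0 < s < d\<close>. Its value on the diagonal (a null set) is \<open>0\<close>, since
  \<^term>\<open>0 powr x = (0::real)\<close> and division by \<open>0\<close> gives \<open>0\<close>.
\<close>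

definition c_D :: "'n::finite itself \<Rightarrow> real \<Rightarrow> real" where
  "c_D _ s =
     (\<integral>p. indicator (ball 0 1) (fst p) * indicator (ball 0 1) (snd p)
              / norm (fst p - snd p) powr (real CARD('n) - s)
        \<partial>(lborel :: ((real^'n) \<times> (real^'n)) measure))"

definition lambda_HF :: "'n::finite itself \<Rightarrow> real \<Rightarrow> real" where
  "lambda_HF T s =
     (let d = real CARD('n) in
        1 / (2 * pi powr (d / 2 - s)) * (d / sphere_area CARD('n)) powr ((d + s) / d)
          * (Gamma ((d - s) / 2) / Gamma (s / 2)) * c_D T s)"

definition rho_c :: "'n::finite itself \<Rightarrow> real \<Rightarrow> real" where
  "rho_c T s =
     (let d = real CARD('n) in
        (lambda_HF T s / kappa CARD('n)
           * ((1 - 2 powr (- s / d)) / (1 - 2 powr (- 2 / d)))) powr (d / (2 - s)))"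

definition rho_c_min :: "'n::finite itself \<Rightarrow> real \<Rightarrow> real" where
  "rho_c_min T s =
     (let d = real CARD('n) in
        2 * (kappa CARD('n) / lambda_HF T s * (2 * (d + 2) / (s * (d + s)))) powr (d / (s - 2)))"

definition rho_c_max :: "'n::finite itself \<Rightarrow> real \<Rightarrow> real" where
  "rho_c_max T s =
     (let d = real CARD('n) in
        (kappa CARD('n) / lambda_HF T s * ((d + 2) / (d + s))) powr (d / (s - 2)))"


section \<open>The Hartree--Fock problem\<close>

definition riesz :: "real \<Rightarrow> real^'n \<Rightarrow> real" where
  "riesz s k = c_riesz CARD('n) s * norm k powr (s - real CARD('n))"

text \<open>
  States are functions modulo equality almost everywhere, so the matrix inequalities
  \<open>0 \<le> \<gamma>(k) \<le> 1\<close> are required almost everywhere.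
\<close>

definition admissible :: "real \<Rightarrow> (real^'n \<Rightarrow> complex^2^2) \<Rightarrow> bool" where
  "admissible \<rho> \<gamma> \<longleftrightarrow>
     \<gamma> \<in> borel_measurable lebesgue \<and>
     (AE k in lebesgue. pos_semidef (\<gamma> k) \<and> pos_semidef (mat 1 - \<gamma> k)) \<and>
     integrable lebesgue (\<lambda>k. Re (trace (\<gamma> k))) \<and>
     1 / (2 * pi) ^ CARD('n) * (\<integral>k. Re (trace (\<gamma> k)) \<partial>lebesgue) = \<rho>"

text \<open>
  Both integrals have nonnegative integrands when \<open>w \<ge> 0\<close> and \<open>\<gamma>\<close> is admissible (both traces are
  then real and nonnegative), so they are taken in \<open>[0,\<infinity>]\<close>. The kinetic energy may be infinite. For
  \<^term>\<open>riesz s\<close> with \<open>0 < s < d\<close> the exchange energy of an admissible state is finite, because \<open>\<gamma>\<close> is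
  bounded and integrable; hence the difference is never of the form \<open>\<infinity> - \<infinity>\<close>.
\<close>

definition HF_energy :: "(real^'n \<Rightarrow> real) \<Rightarrow> (real^'n \<Rightarrow> complex^2^2) \<Rightarrow> ereal" where
  "HF_energy w \<gamma> =
     ereal (1 / (2 * (2 * pi) ^ CARD('n)))
       * enn2ereal (\<integral>\<^sup>+k. ennreal ((norm k)\<^sup>2 * Re (trace (\<gamma> k))) \<partial>lebesgue)
   - ereal (1 / (2 * (2 * pi) ^ CARD('n)))
       * enn2ereal (\<integral>\<^sup>+p. ennreal (w (fst p - snd p) * Re (trace (\<gamma> (fst p) ** \<gamma> (snd p))))
                      \<partial>(lebesgue :: ((real^'n) \<times> (real^'n)) measure))"

definition HF_minimum :: "(real^'n \<Rightarrow> real) \<Rightarrow> real \<Rightarrow> ereal" where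
  "HF_minimum w \<rho> = (INF \<gamma>\<in>{\<gamma>. admissible \<rho> \<gamma>}. HF_energy w \<gamma>)"

definition HF_minimiser :: "(real^'n \<Rightarrow> real) \<Rightarrow> real \<Rightarrow> (real^'n \<Rightarrow> complex^2^2) \<Rightarrow> bool" where
  "HF_minimiser w \<rho> \<gamma> \<longleftrightarrow> admissible \<rho> \<gamma> \<and> HF_energy w \<gamma> = HF_minimum w \<rho>"


section \<open>Phases\<close>

definition gamma_ferro :: "real \<Rightarrow> complex^2 \<Rightarrow> real^'n \<Rightarrow> complex^2^2" where
  "gamma_ferro \<rho> \<nu> k =
     of_bool ((norm k)\<^sup>2 \<le> c_TF CARD('n) * \<rho> powr (2 / real CARD('n))) *\<^sub>R ket_bra \<nu>"

definition gamma_para :: "real \<Rightarrow> real^'n \<Rightarrow> complex^2^2" where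
  "gamma_para \<rho> k =
     of_bool ((norm k)\<^sup>2 \<le> c_TF CARD('n) * (\<rho> / 2) powr (2 / real CARD('n))) *\<^sub>R mat 1"

definition gamma_mixed :: "real \<Rightarrow> real \<Rightarrow> complex^2^2 \<Rightarrow> real^'n \<Rightarrow> complex^2^2" where
  "gamma_mixed t \<rho> U k =
     U ** vector
       [vector [of_bool ((norm k)\<^sup>2 \<le> c_TF CARD('n) * (t * \<rho>) powr (2 / real CARD('n))), 0],
        vector [0, of_bool ((norm k)\<^sup>2 \<le> c_TF CARD('n) * ((1 - t) * \<rho>) powr (2 / real CARD('n)))]]
     ** conj_transpose U"

definition is_ferro :: "real \<Rightarrow> (real^'n \<Rightarrow> complex^2^2) \<Rightarrow> bool" where
  "is_ferro \<rho> \<gamma> \<longleftrightarrow> (\<exists>\<nu>. norm \<nu> = 1 \<and> (AE k in lebesgue. \<gamma> k = gamma_ferro \<rho> \<nu> k))"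

definition is_para :: "real \<Rightarrow> (real^'n \<Rightarrow> complex^2^2) \<Rightarrow> bool" where
  "is_para \<rho> \<gamma> \<longleftrightarrow> (AE k in lebesgue. \<gamma> k = gamma_para \<rho> k)"

definition is_mixed :: "real \<Rightarrow> real \<Rightarrow> (real^'n \<Rightarrow> complex^2^2) \<Rightarrow> bool" where
  "is_mixed t \<rho> \<gamma> \<longleftrightarrow> (\<exists>U\<in>SU2. AE k in lebesgue. \<gamma> k = gamma_mixed t \<rho> U k)"

definition pure_ferromagnetic :: "(real^'n \<Rightarrow> real) \<Rightarrow> real \<Rightarrow> bool" where
  "pure_ferromagnetic w \<rho> \<longleftrightarrow> (\<forall>\<gamma>. HF_minimiser w \<rho> \<gamma> \<longleftrightarrow> is_ferro \<rho> \<gamma>)"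

definition paramagnetic :: "(real^'n \<Rightarrow> real) \<Rightarrow> real \<Rightarrow> bool" where
  "paramagnetic w \<rho> \<longleftrightarrow> (\<forall>\<gamma>. HF_minimiser w \<rho> \<gamma> \<longleftrightarrow> is_para \<rho> \<gamma>)"


section \<open>Regularity of the ground state energy\<close>

definition derivative_jump :: "(real \<Rightarrow> real) \<Rightarrow> real \<Rightarrow> bool" where
  "derivative_jump f x \<longleftrightarrow>
     (\<forall>\<^sub>F y in at x. f differentiable (at y)) \<and>
     (\<exists>l r. l \<noteq> r \<and>
        (f has_real_derivative l) (at_left x) \<and> (deriv f \<longlongrightarrow> l) (at_left x) \<and>
        (f has_real_derivative r) (at_right x) \<and> (deriv f \<longlongrightarrow> r) (at_right x))"

definition continuously_differentiable_on :: "real set \<Rightarrow> (real \<Rightarrow> real) \<Rightarrow> bool" where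
  "continuously_differentiable_on S f \<longleftrightarrow>
     (\<forall>x\<in>S. f differentiable (at x)) \<and> continuous_on S (deriv f)"

end

theory Submission
  imports Defs
begin

text \<open>
  In the Pauli basis \<open>tr (\<gamma>(k) \<gamma>(k'))\<close> is at most \<open>\<lambda>\<^sub>1(k) \<lambda>\<^sub>1(k') + \<lambda>\<^sub>2(k) \<lambda>\<^sub>2(k')\<close>, where
  \<open>\<lambda>\<^sub>1 \<ge> \<lambda>\<^sub>2\<close> are the ordered eigenvalues, so the problem splits into two spinless ones. A spinless
  density with values in \<open>[0, 1]\<close> has kinetic energy at least and exchange energy at most that of the
  ball of the same mass: the first is the bathtub principle, which also yields the equality case, and
  the second is Riesz's rearrangement inequality. The latter is obtained by polarization: averaged
  over the hyperplanes, reflecting a set moves into the ball an amount of mass that is bounded below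
  in terms of the mass outside, so suitable polarizations of a set approach the ball.
  What is left is to minimise \<open>\<kappa> \<rho>\<^sup>p (t\<^sup>p + (1 - t)\<^sup>p) - \<lambda> \<rho>\<^sup>q (t\<^sup>q + (1 - t)\<^sup>q)\<close> over
  \<open>0 \<le> t \<le> 1/2\<close> with \<open>p = 1 + 2/d\<close> and \<open>q = 1 + s/d\<close>. The sign of the derivative is decided by the
  monotonicity of \<open>((1 - t)\<^sup>b - t\<^sup>b) / ((1 - t)\<^sup>a - t\<^sup>a)\<close> for \<open>0 < a < b \<le> 1\<close>.
\<close>

text \<open>Rearrangement is used only as an inequality; its equality cases are never discussed. A
  minimiser must also saturate the kinetic bound, and there the bathtub argument leaves no freedom,
  so both eigenvalue profiles are balls almost everywhere. What remains is the direction of the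
  Pauli vector. The term lost in passing to ordered eigenvalues is a double integral of a positive
  kernel times a Cauchy-Schwarz defect; if it vanishes, all directions agree. The exchange energy is
  quadratic in the density while the bathtub principle is linear, so one factor at a time is
  replaced by a ball, against level sets of the other. The reduced function of \<open>t\<close> is a
  difference of convex functions, so convexity alone decides nothing. What helps is that the
  quotient of the two parts of its derivative is monotone: the derivative changes sign at most once.
  For \<open>s > 2\<close> the values of this quotient at \<open>t = 0\<close> and in the limit
  \<open>t\<close> to \<open>1/2\<close> produce \<open>rho_c_max\<close> and
  \<open>rho_c_min\<close>; for \<open>s < 2\<close> only the endpoints compete, and
  \<open>rho_c\<close> is the density where they tie.\<close>

text \<open>By Vitali, disjoint balls centred in \<open>S\<close> exhaust \<open>S\<close> up to a
  null set, and \<open>f\<close> carries the part of \<open>S\<close> in each of them into a ball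
  \<open>L\<close> times as large. The constant is sharp, so isometries come out measure preserving.
  The Borel set \<open>Y\<close> stands in for the image, which need not be Borel.\<close>

lemma emeasure_Lipschitz_image_le:
  fixes f :: "'a::euclidean_space \<Rightarrow> 'a"
  assumes S: "S \<in> sets borel" and L: "L > 0"
    and lip: "\<And>x y. x \<in> S \<Longrightarrow> y \<in> S \<Longrightarrow> norm (f x - f y) \<le> L * norm (x - y)"
    and Y: "Y \<in> sets borel" "Y \<subseteq> f ` S"
  shows "emeasure lborel Y \<le> ennreal (L ^ DIM('a)) * emeasure lborel S"
proof (cases "emeasure lborel S = \<infinity>")
  case True
  then show ?thesis using L by (simp add: ennreal_mult_top)
next
  case False
  have main: "emeasure lborel Y \<le> ennreal (L ^ DIM('a)) * emeasure lborel U"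
    if U: "open U" "S \<subseteq> U" for U
  proof -
    define K where "K = {(c::'a, r::real). c \<in> S \<and> 0 < r \<and> ball c r \<subseteq> U}"
    have cov: "\<exists>i. i \<in> K \<and> x \<in> ball (fst i) (snd i) \<and> snd i < d" if xd: "x \<in> S" "0 < d" for x d
    proof -
      obtain e where e: "e > 0" "ball x e \<subseteq> U"
        using U xd(1) by (meson openE subsetD)
      then have "(x, min e (d/2)) \<in> K" using xd by (auto simp: K_def)
      moreover have "x \<in> ball x (min e (d/2))" "min e (d/2) < d" using e xd by auto
      ultimately show ?thesis by (intro exI[of _ "(x, min e (d/2))"]) simp
    qed
    obtain C where C: "countable C" "C \<subseteq> K"
        "pairwise (\<lambda>i j. disjnt (ball (fst i) (snd i)) (ball (fst j) (snd j))) C"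
        "negligible (S - (\<Union>i\<in>C. ball (fst i) (snd i)))"
      using Vitali_covering_theorem_balls[OF cov] by blast
    define N where "N = S - (\<Union>i\<in>C. ball (fst i) (snd i))"
    \<comment> \<open>What the balls miss has a null image, again because \<open>f\<close> is
      Lipschitz on \<open>S\<close>.\<close>
    have neg: "negligible (f ` N)"
    proof (rule negligible_locally_Lipschitz_image)
      show "negligible N" using C(4) by (simp add: N_def)
      fix x assume "x \<in> N"
      then show "\<exists>T B. open T \<and> x \<in> T \<and> (\<forall>y\<in>N \<inter> T. norm (f y - f x) \<le> B * norm (y - x))"
        using lip by (intro exI[of _ UNIV] exI[of _ L]) (auto simp: N_def)
    qed simp
    define T where "T = to_nat_on C ` C"
    define D where "D n = (if n \<in> T then ball (fst (from_nat_into C n)) (snd (from_nat_into C n)) else {})" for n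
    define E where "E n = (if n \<in> T then ball (f (fst (from_nat_into C n))) (L * snd (from_nat_into C n)) else {})" for n
    have TC: "from_nat_into C n \<in> C" if "n \<in> T" for n
      using that C(1) by (auto simp: T_def)
    have disj: "disjoint_family D"
      unfolding disjoint_family_on_def
    proof (intro ballI impI)
      fix m n :: nat assume mn: "m \<noteq> n"
      show "D m \<inter> D n = {}"
      proof (cases "m \<in> T \<and> n \<in> T")
        case True
        then have "from_nat_into C m \<noteq> from_nat_into C n"
          using mn C(1) by (auto simp: T_def)
        then show ?thesis using C(3) TC True unfolding pairwise_def disjnt_def by (auto simp: D_def)
      qed (auto simp: D_def)
    qed
    have DE: "emeasure lborel (E n) = ennreal (L ^ DIM('a)) * emeasure lborel (D n)" for n
    proof (cases "n \<in> T")
      case True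
      then have "snd (from_nat_into C n) > 0" using TC[OF True] C(2) by (auto simp: K_def split: prod.splits)
      then show ?thesis using L True
        by (simp add: D_def E_def emeasure_ball ennreal_mult[symmetric] power_mult_distrib mult_ac)
    qed (simp add: D_def E_def)
    have DU: "(\<Union>n. D n) \<subseteq> U"
      using TC C(2) by (force simp: D_def K_def split: if_splits)
    have Ysub: "Y \<subseteq> (\<Union>n. E n) \<union> f ` N"
    proof
      fix y assume "y \<in> Y"
      then obtain x where x: "x \<in> S" "y = f x" using Y by auto
      show "y \<in> (\<Union>n. E n) \<union> f ` N"
      proof (cases "x \<in> N")
        case False
        then obtain i where i: "i \<in> C" "x \<in> ball (fst i) (snd i)" using x by (auto simp: N_def)
        have "fst i \<in> S" using i C(2) by (auto simp: K_def)
        then have "norm (f (fst i) - f x) \<le> L * norm (fst i - x)" using lip x by auto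
        also have "\<dots> < L * snd i" using i L by (simp add: dist_norm)
        finally have "y \<in> E (to_nat_on C i)"
          using i C(1) x by (simp add: E_def T_def dist_norm)
        then show ?thesis by auto
      qed (use x in auto)
    qed
    have "emeasure lborel Y = emeasure lebesgue Y" using Y(1) by simp
    also have "\<dots> \<le> emeasure lebesgue ((\<Union>n. E n) \<union> f ` N)"
    proof (intro emeasure_mono Ysub)
      have "f ` N \<in> sets lebesgue" using neg negligible_imp_sets by blast
      then show "(\<Union>n. E n) \<union> f ` N \<in> sets lebesgue"
        by (intro sets.Un sets.countable_UN) (auto simp: E_def)
    qed
    also have "\<dots> \<le> emeasure lebesgue (\<Union>n. E n)"
      using neg by (subst emeasure_Un_null_set) (auto simp: negligible_iff_null_sets E_def)
    also have "\<dots> = emeasure lborel (\<Union>n. E n)" 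
      by (subst emeasure_completion) (auto simp: E_def intro!: sets.countable_UN)
    also have "\<dots> \<le> (\<Sum>n. emeasure lborel (E n))"
      by (intro emeasure_subadditive_countably) (auto simp: E_def)
    also have "\<dots> = ennreal (L ^ DIM('a)) * (\<Sum>n. emeasure lborel (D n))"
      by (simp add: DE)
    also have "(\<Sum>n. emeasure lborel (D n)) = emeasure lborel (\<Union>n. D n)"
      using suminf_emeasure[OF _ disj, of lborel] by (simp add: D_def image_subset_iff)
    also have "\<dots> \<le> emeasure lborel U"
      using DU U by (intro emeasure_mono) auto
    finally show ?thesis by (simp add: mult_left_mono)
  qed
  show ?thesis
  proof (rule ennreal_le_epsilon)
    fix e :: real assume e: "0 < e"
    have "e / L ^ DIM('a) > 0" using e L by simp
    then obtain U where U0: "open U" "S \<subseteq> U" "emeasure lborel (U - S) \<le> ennreal (e / L ^ DIM('a))"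
      by (rule outer_regular_lborel_le[OF S])
    have "emeasure lborel U = emeasure lborel S + emeasure lborel (U - S)"
      using U0 S by (subst plus_emeasure) (auto simp: Un_absorb1)
    also have "\<dots> \<le> emeasure lborel S + ennreal (e / L ^ DIM('a))"
      using U0(3) by (rule add_left_mono)
    finally have U: "open U" "S \<subseteq> U" "emeasure lborel U \<le> emeasure lborel S + ennreal (e / L ^ DIM('a))"
      using U0 by auto
    have "emeasure lborel Y \<le> ennreal (L ^ DIM('a)) * emeasure lborel U" by (rule main) (use U in auto)
    also have "\<dots> \<le> ennreal (L ^ DIM('a)) * (emeasure lborel S + ennreal (e / L ^ DIM('a)))"
      using U(3) by (rule mult_left_mono) simp
    also have "\<dots> = ennreal (L ^ DIM('a)) * emeasure lborel S + ennreal e"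
      using L e by (simp add: distrib_left ennreal_mult[symmetric])
    finally show "emeasure lborel Y \<le> ennreal (L ^ DIM('a)) * emeasure lborel S + ennreal e" .
  qed
qed

text \<open>For an involution the preimage of a set is its image, so the Lipschitz bound with
  constant 1 applies in both directions.\<close>

lemma distr_lborel_isometric_involution:
  fixes f :: "'a::euclidean_space \<Rightarrow> 'a"
  assumes iso: "\<And>x y. norm (f x - f y) = norm (x - y)" and inv: "\<And>x. f (f x) = x"
  shows "distr lborel borel f = lborel"
proof -
  have "continuous_on UNIV f"
    unfolding continuous_on_iff using iso by (auto simp: dist_norm)
  then have [measurable]: "f \<in> borel_measurable borel" by (rule borel_measurable_continuous_onI)
  show ?thesis
  proof (rule measure_eqI)
    fix A assume "A \<in> sets (distr lborel borel f)"
    then have A: "A \<in> sets borel" by simp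
    have fA: "f -` A \<in> sets borel" using measurable_sets[of f borel borel A] A by simp
    have vim: "f -` A \<subseteq> f ` A" "A \<subseteq> f ` (f -` A)" 
      using inv by (auto simp: image_iff) (metis inv)+
    have "emeasure lborel (f -` A) \<le> ennreal (1 ^ DIM('a)) * emeasure lborel A"
      by (rule emeasure_Lipschitz_image_le[where f=f]) (use A fA iso vim in auto)
    moreover have "emeasure lborel A \<le> ennreal (1 ^ DIM('a)) * emeasure lborel (f -` A)"
      by (rule emeasure_Lipschitz_image_le[where f=f]) (use A fA iso vim in auto)
    ultimately show "emeasure (distr lborel borel f) A = emeasure lborel A"
      using A by (simp add: emeasure_distr)
  qed simp
qed

section \<open>Polarization\<close>

text \<open>Reflection in the hyperplane \<open>x \<bullet> u = u \<bullet> u\<close>, whose point closest to the origin is \<open>u\<close>.\<close>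
definition mirror :: "'a::real_inner \<Rightarrow> 'a \<Rightarrow> 'a" where
  "mirror u x = x - (2 * ((x \<bullet> u) / (u \<bullet> u) - 1)) *\<^sub>R u"

text \<open>The half-space \<open>x \<bullet> u \<le> u \<bullet> u\<close> contains the origin, so polarization moves mass towards the origin.\<close>
definition polarize :: "'a::real_inner \<Rightarrow> 'a set \<Rightarrow> 'a set" where
  "polarize u A = {x. if x \<bullet> u \<le> u \<bullet> u then x \<in> A \<or> mirror u x \<in> A else x \<in> A \<and> mirror u x \<in> A}"

lemma mirror_inner: "u \<noteq> 0 \<Longrightarrow> mirror u x \<bullet> u = 2 * (u \<bullet> u) - x \<bullet> u"
  by (simp add: mirror_def inner_diff_left field_simps)

lemma mirror_mirror [simp]:
  assumes "u \<noteq> 0" shows "mirror u (mirror u x) = x"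
proof -
  define a where "a = (x \<bullet> u) / (u \<bullet> u) - 1"
  have "(mirror u x \<bullet> u) / (u \<bullet> u) - 1 = - a"
    using assms by (simp add: mirror_inner a_def field_simps)
  then have "mirror u (mirror u x) = mirror u x + (2 * a) *\<^sub>R u"
    by (simp add: mirror_def[of u "mirror u x"])
  then show ?thesis by (simp add: mirror_def[of u x] a_def)
qed

lemma norm_mirror_sq:
  assumes "u \<noteq> 0"
  shows "(norm (mirror u x))\<^sup>2 = (norm x)\<^sup>2 - 4 * (x \<bullet> u - u \<bullet> u)"
proof -
  define a where "a = (x \<bullet> u) / (u \<bullet> u) - 1"
  have a: "x \<bullet> u = (a + 1) * (u \<bullet> u)" using assms by (simp add: a_def)
  have "(norm (mirror u x))\<^sup>2 = (x - (2 * a) *\<^sub>R u) \<bullet> (x - (2 * a) *\<^sub>R u)"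
    by (simp add: mirror_def a_def power2_norm_eq_inner)
  also have "\<dots> = x \<bullet> x - 4 * a * (x \<bullet> u) + 4 * a\<^sup>2 * (u \<bullet> u)"
    by (simp add: inner_diff_left inner_diff_right inner_commute power2_eq_square algebra_simps)
  also have "\<dots> = (norm x)\<^sup>2 - 4 * (x \<bullet> u - u \<bullet> u)"
    by (simp add: a power2_norm_eq_inner algebra_simps) (simp add: power2_eq_square algebra_simps)
  finally show ?thesis .
qed

text \<open>The sign of the added term tells whether \<open>x\<close> and \<open>y\<close> lie on
  the same side of the hyperplane. Reflecting one of two points on the same side moves the pair
  apart; reflecting one of two points on opposite sides brings it together.\<close>

lemma norm_diff_mirror_sq:
  assumes "u \<noteq> 0"
  shows "(norm (x - mirror u y))\<^sup>2 =
    (norm (x - y))\<^sup>2 + 4 * (x \<bullet> u - u \<bullet> u) * (y \<bullet> u - u \<bullet> u) / (u \<bullet> u)"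
proof -
  define a b where "a = (x \<bullet> u) / (u \<bullet> u) - 1" and "b = (y \<bullet> u) / (u \<bullet> u) - 1"
  have ab: "x \<bullet> u = (a + 1) * (u \<bullet> u)" "y \<bullet> u = (b + 1) * (u \<bullet> u)" using assms by (simp_all add: a_def b_def)
  have "x - mirror u y = (x - y) + (2 * b) *\<^sub>R u" by (simp add: mirror_def b_def)
  then have "(norm (x - mirror u y))\<^sup>2 = ((x - y) + (2 * b) *\<^sub>R u) \<bullet> ((x - y) + (2 * b) *\<^sub>R u)"
    unfolding power2_norm_eq_inner by (simp only:)
  also have "\<dots> = (x - y) \<bullet> (x - y) + 4 * b * (x \<bullet> u - y \<bullet> u) + 4 * b\<^sup>2 * (u \<bullet> u)"
    by (simp add: inner_diff_left inner_diff_right inner_add_left inner_add_right inner_commute power2_eq_square algebra_simps)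
  also have "\<dots> = (norm (x - y))\<^sup>2 + 4 * (x \<bullet> u - u \<bullet> u) * (y \<bullet> u - u \<bullet> u) / (u \<bullet> u)"
    using assms by (simp add: ab power2_norm_eq_inner) (simp add: power2_eq_square field_simps)
  finally show ?thesis .
qed

lemma norm_mirror_diff: "norm (mirror u x - mirror u y) = norm (x - y)"
proof (cases "u = 0")
  case False
  have "mirror u x - mirror u y = (x - y) - (2 * ((x - y) \<bullet> u / (u \<bullet> u))) *\<^sub>R u"
    by (simp add: mirror_def inner_diff_left diff_divide_distrib algebra_simps)
  then have "(norm (mirror u x - mirror u y))\<^sup>2 = (norm (x - y))\<^sup>2"
    using False unfolding power2_norm_eq_inner
    by (simp add: inner_diff_left[of "x - y"] inner_diff_right[of _ "x - y"] inner_commute[of u "x - y"])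
  then show ?thesis by simp
qed (simp add: mirror_def)

lemma norm_mirror_diff_swap: "u \<noteq> 0 \<Longrightarrow> norm (mirror u x - y) = norm (x - mirror u y)"
  using norm_mirror_diff[of u "mirror u x" y] by simp

lemma norm_mirror_le:
  assumes "u \<noteq> 0" "u \<bullet> u \<le> x \<bullet> u" shows "norm (mirror u x) \<le> norm x"
proof (rule power2_le_imp_le)
  show "(norm (mirror u x))\<^sup>2 \<le> (norm x)\<^sup>2"
    unfolding norm_mirror_sq[OF assms(1)] using assms(2) by simp
qed simp

lemma norm_mirror_ge:
  assumes "u \<noteq> 0" "x \<bullet> u \<le> u \<bullet> u" shows "norm x \<le> norm (mirror u x)"
proof (rule power2_le_imp_le)
  show "(norm x)\<^sup>2 \<le> (norm (mirror u x))\<^sup>2"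
    unfolding norm_mirror_sq[OF assms(1)] using assms(2) by simp
qed simp

lemma norm_diff_mirror_ge:
  assumes "u \<noteq> 0" "0 \<le> (x \<bullet> u - u \<bullet> u) * (y \<bullet> u - u \<bullet> u)"
  shows "norm (x - y) \<le> norm (x - mirror u y)"
proof (rule power2_le_imp_le)
  have "0 \<le> 4 * ((x \<bullet> u - u \<bullet> u) * (y \<bullet> u - u \<bullet> u)) / (u \<bullet> u)"
    using assms(2) by (intro divide_nonneg_nonneg) auto
  then show "(norm (x - y))\<^sup>2 \<le> (norm (x - mirror u y))\<^sup>2"
    unfolding norm_diff_mirror_sq[OF assms(1)] mult.assoc by simp
qed simp

lemma norm_diff_mirror_le:
  assumes "u \<noteq> 0" "(x \<bullet> u - u \<bullet> u) * (y \<bullet> u - u \<bullet> u) \<le> 0"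
  shows "norm (x - mirror u y) \<le> norm (x - y)"
proof (rule power2_le_imp_le)
  have "4 * ((x \<bullet> u - u \<bullet> u) * (y \<bullet> u - u \<bullet> u)) / (u \<bullet> u) \<le> 0"
    using assms(2) by (intro divide_nonpos_nonneg) auto
  then show "(norm (x - mirror u y))\<^sup>2 \<le> (norm (x - y))\<^sup>2"
    unfolding norm_diff_mirror_sq[OF assms(1)] mult.assoc by simp
qed simp

lemma mirror_measurable [measurable]: "mirror u \<in> borel_measurable borel"
  unfolding mirror_def by (intro borel_measurable_continuous_onI) (cases "u = 0"; auto intro!: continuous_intros)

lemma nn_integral_mirror:
  assumes "u \<noteq> 0" and [measurable]: "f \<in> borel_measurable borel"
  shows "(\<integral>\<^sup>+x. f (mirror u x) \<partial>lborel) = (\<integral>\<^sup>+x. f x \<partial>(lborel :: 'a::euclidean_space measure))"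
proof -
  have "distr lborel borel (mirror u) = (lborel :: 'a measure)"
    using assms by (intro distr_lborel_isometric_involution) (auto simp: norm_mirror_diff)
  then have "(\<integral>\<^sup>+x. f x \<partial>(lborel :: 'a measure)) = (\<integral>\<^sup>+x. f x \<partial>distr lborel borel (mirror u))" by simp
  also have "\<dots> = (\<integral>\<^sup>+x. f (mirror u x) \<partial>lborel)" by (rule nn_integral_distr) auto
  finally show ?thesis by simp
qed

lemma sets_polarize [measurable]:
  assumes [measurable]: "A \<in> sets borel" shows "polarize u A \<in> sets (borel :: 'a::euclidean_space measure)"
  unfolding polarize_def by measurable

lemma nn_integral_half:
  assumes "u \<noteq> 0" and [measurable]: "f \<in> borel_measurable borel"
  shows "(\<integral>\<^sup>+x. f x + f (mirror u x) \<partial>(lborel :: 'a::euclidean_space measure)) = 2 * (\<integral>\<^sup>+x. f x \<partial>lborel)"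
proof -
  have "(\<integral>\<^sup>+x. f x + f (mirror u x) \<partial>(lborel :: 'a measure)) = (\<integral>\<^sup>+x. f x \<partial>lborel) + (\<integral>\<^sup>+x. f (mirror u x) \<partial>lborel)"
    by (rule nn_integral_add) auto
  then show ?thesis using assms by (simp add: nn_integral_mirror mult_2)
qed

lemma ennreal_two_mult_cancel_le: "2 * a \<le> 2 * b \<Longrightarrow> a \<le> (b::ennreal)"
  by (simp add: ennreal_mult_le_mult_iff)

text \<open>Polarization inequalities fail pointwise and hold only after adding the values at two
  mirror points; reflection invariance of the measure makes that sufficient.\<close>

lemma nn_integral_mirror_mono:
  assumes "u \<noteq> 0" and [measurable]: "f \<in> borel_measurable borel" "g \<in> borel_measurable borel"
    and "\<And>x. f x + f (mirror u x) \<le> g x + g (mirror u x)"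
  shows "(\<integral>\<^sup>+x. f x \<partial>(lborel :: 'a::euclidean_space measure)) \<le> (\<integral>\<^sup>+x. g x \<partial>lborel)"
proof (rule ennreal_two_mult_cancel_le)
  show "2 * (\<integral>\<^sup>+x. f x \<partial>(lborel :: 'a measure)) \<le> 2 * (\<integral>\<^sup>+x. g x \<partial>lborel)"
    unfolding nn_integral_half[OF assms(1), symmetric, OF assms(2)] nn_integral_half[OF assms(1), symmetric, OF assms(3)]
    using assms by (intro nn_integral_mono) auto
qed

lemma indicator_polarize_add:
  assumes "u \<noteq> 0"
  shows "indicator (polarize u A) x + indicator (polarize u A) (mirror u x) =
    (indicator A x + indicator A (mirror u x) :: ennreal)"
proof -
  \<comment> \<open>Two mirror points that are both in the closed near half-space lie on the
    hyperplane and coincide; otherwise exactly one of them is near.\<close>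
  have "x \<bullet> u \<le> u \<bullet> u \<and> mirror u x \<bullet> u \<le> u \<bullet> u \<Longrightarrow> mirror u x = x"
    using assms mirror_inner[of u x] by (auto simp: mirror_def)
  then show ?thesis
    using assms mirror_inner[of u x] by (auto simp: polarize_def indicator_def add.commute)
qed

lemma emeasure_polarize:
  assumes "u \<noteq> 0" and A: "A \<in> sets (borel :: 'a::euclidean_space measure)"
  shows "emeasure lborel (polarize u A) = emeasure lborel A"
proof -
  note [measurable] = A sets_polarize[OF A, of u]
  have "(\<integral>\<^sup>+x. indicator (polarize u A) x \<partial>lborel) = (\<integral>\<^sup>+x. indicator A x \<partial>(lborel :: 'a measure))"
    by (intro antisym nn_integral_mirror_mono[OF assms(1)]) (auto simp: indicator_polarize_add[OF assms(1)])
  then show ?thesis using A sets_polarize[OF A, of u] by simp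
qed

lemma polarize_subset_cball:
  assumes "u \<noteq> 0" "A \<subseteq> cball 0 R" shows "polarize u A \<subseteq> cball 0 R"
proof
  fix x assume "x \<in> polarize u A"
  then show "x \<in> cball 0 R"
    using norm_mirror_ge[OF assms(1), of x] assms(2)
    by (fastforce simp: polarize_def subset_iff split: if_splits)
qed

definition radial_kernel :: "(real \<Rightarrow> ennreal) \<Rightarrow> bool" where
  "radial_kernel W \<longleftrightarrow> W \<in> borel_measurable borel \<and> (\<forall>x y. 0 \<le> x \<longrightarrow> x \<le> y \<longrightarrow> W y \<le> W x)"

lemma radial_kernelD:
  assumes "radial_kernel W"
  shows "W \<in> borel_measurable borel" "\<And>x y. 0 \<le> x \<Longrightarrow> x \<le> y \<Longrightarrow> W y \<le> W x"
  using assms by (auto simp: radial_kernel_def)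

definition interact :: "(real \<Rightarrow> ennreal) \<Rightarrow> ('a::euclidean_space \<Rightarrow> ennreal) \<Rightarrow> ('a \<Rightarrow> ennreal) \<Rightarrow> ennreal" where
  "interact W f g = (\<integral>\<^sup>+x. (\<integral>\<^sup>+y. f x * g y * W (norm (x - y)) \<partial>lborel) \<partial>lborel)"

text \<open>Summed over \<open>x\<close>, \<open>y\<close> and their mirror images, the integrand
  involves only two kernel values, the larger one belonging to points on the same side. Polarization
  keeps the number of occupied points of each mirror pair and puts single ones on the near side, so
  the inequality becomes a finite check.\<close>

lemma interact_polarize:
  fixes A C :: "'a::euclidean_space set"
  assumes W: "radial_kernel W" and u: "u \<noteq> 0" and [measurable]: "A \<in> sets borel" "C \<in> sets borel"
  shows "interact W (indicator A) (indicator C) \<le> interact W (indicator (polarize u A)) (indicator (polarize u C))"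
proof -
  note [measurable] = radial_kernelD(1)[OF W]
  define F where "F A C x y = (indicator A x * indicator C y * W (norm (x - y)) :: ennreal)" for A C :: "'a set" and x y
  have Fm[measurable]: "(\<lambda>(x,y). F A C x y) \<in> borel_measurable (borel \<Otimes>\<^sub>M borel)" if [measurable]: "A \<in> sets borel" "C \<in> sets borel" for A C
    unfolding F_def by measurable
  have Fm1[measurable]: "F A C x \<in> borel_measurable borel" if [measurable]: "A \<in> sets borel" "C \<in> sets borel" for A C x
    unfolding F_def by measurable
  define G where "G A C x y = F A C x y + F A C (mirror u x) y + (F A C x (mirror u y) + F A C (mirror u x) (mirror u y))" for A C x y
  \<comment> \<open>Reflection invariance contributes a factor 2 for each of the two
    variables.\<close>
  have quad: "4 * interact W (indicator A) (indicator C) = (\<integral>\<^sup>+x. (\<integral>\<^sup>+y. G A C x y \<partial>lborel) \<partial>lborel)"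
    if [measurable]: "A \<in> sets borel" "C \<in> sets borel" for A C :: "'a set"
  proof -
    have 1: "(\<integral>\<^sup>+y. G A C x y \<partial>lborel) = 2 * ((\<integral>\<^sup>+y. F A C x y \<partial>lborel) + (\<integral>\<^sup>+y. F A C (mirror u x) y \<partial>lborel))" for x
    proof -
      have "(\<integral>\<^sup>+y. G A C x y \<partial>lborel) = (\<integral>\<^sup>+y. (F A C x y + F A C (mirror u x) y) + (\<lambda>y. F A C x y + F A C (mirror u x) y) (mirror u y) \<partial>lborel)"
        by (simp add: G_def)
      also have "\<dots> = 2 * (\<integral>\<^sup>+y. F A C x y + F A C (mirror u x) y \<partial>lborel)"
        by (rule nn_integral_half[OF u]) measurable
      finally show ?thesis by (simp add: nn_integral_add)
    qed
    have "(\<integral>\<^sup>+x. (\<integral>\<^sup>+y. G A C x y \<partial>lborel) \<partial>lborel)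
      = 2 * (\<integral>\<^sup>+x. (\<lambda>x. \<integral>\<^sup>+y. F A C x y \<partial>lborel) x + (\<lambda>x. \<integral>\<^sup>+y. F A C x y \<partial>lborel) (mirror u x) \<partial>lborel)"
      unfolding 1 by (rule nn_integral_cmult) measurable
    also have "\<dots> = 2 * (2 * (\<integral>\<^sup>+x. \<integral>\<^sup>+y. F A C x y \<partial>lborel \<partial>lborel))"
      by (subst nn_integral_half[OF u]) measurable
    finally show ?thesis by (simp add: interact_def F_def mult.assoc[symmetric])
  qed
  have le: "G A C x y \<le> G (polarize u A) (polarize u C) x y" for x y
  proof -
    define p q where "p = W (norm (x - y))" and "q = W (norm (x - mirror u y))"
    have pq: "W (norm (mirror u x - mirror u y)) = p" "W (norm (mirror u x - y)) = q"
      by (auto simp: p_def q_def norm_mirror_diff norm_mirror_diff_swap[OF u])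
    have same: "q \<le> p" if "0 \<le> (x \<bullet> u - u \<bullet> u) * (y \<bullet> u - u \<bullet> u)"
      unfolding p_def q_def by (intro radial_kernelD(2)[OF W] norm_diff_mirror_ge u that) auto
    have opp: "p \<le> q" if "(x \<bullet> u - u \<bullet> u) * (y \<bullet> u - u \<bullet> u) \<le> 0"
      unfolding p_def q_def by (intro radial_kernelD(2)[OF W] norm_diff_mirror_le u that) auto
    have H: "G A C x y =
       indicator A x * indicator C y * p + indicator A (mirror u x) * indicator C y * q +
       (indicator A x * indicator C (mirror u y) * q + indicator A (mirror u x) * indicator C (mirror u y) * p)" for A C
      unfolding G_def F_def pq by (simp add: p_def q_def)
    have pi: "z \<in> polarize u A \<longleftrightarrow> (if z \<bullet> u \<le> u \<bullet> u then z \<in> A \<or> mirror u z \<in> A else z \<in> A \<and> mirror u z \<in> A)"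
       "mirror u z \<in> polarize u A \<longleftrightarrow> (if z \<bullet> u < u \<bullet> u then z \<in> A \<and> mirror u z \<in> A else z \<in> A \<or> mirror u z \<in> A)" for z A
      using u mirror_inner[OF u, of z] by (auto simp: polarize_def)
    \<comment> \<open>On the hyperplane both sign conditions hold, so the two kernel values
      agree.\<close>
    have qp: "q = p" if "x \<bullet> u = u \<bullet> u \<or> y \<bullet> u = u \<bullet> u" using same opp that by (auto intro: antisym)
    show ?thesis
    proof (cases "x \<bullet> u = u \<bullet> u \<or> y \<bullet> u = u \<bullet> u")
      case True
      then have "q = p" by (rule qp)
      then have "G A C x y = (indicator A x + indicator A (mirror u x)) * (indicator C y + indicator C (mirror u y)) * p" for A C
        unfolding H by (simp add: distrib_left distrib_right ac_simps)
      then show ?thesis by (simp add: indicator_polarize_add[OF u])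
    next
      case False
      then consider "x \<bullet> u < u \<bullet> u" "y \<bullet> u < u \<bullet> u" | "x \<bullet> u > u \<bullet> u" "y \<bullet> u > u \<bullet> u"
        | "x \<bullet> u < u \<bullet> u" "y \<bullet> u > u \<bullet> u" | "x \<bullet> u > u \<bullet> u" "y \<bullet> u < u \<bullet> u" by linarith
      then show ?thesis
      proof cases
        case 1 then have "q \<le> p" by (intro same mult_nonpos_nonpos) auto
        then show ?thesis unfolding H indicator_def pi[of x A] pi[of y C] using 1
          by (cases "x \<in> A"; cases "mirror u x \<in> A"; cases "y \<in> C"; cases "mirror u y \<in> C"; simp add: add.commute)
      next
        case 2 then have "q \<le> p" by (intro same mult_nonneg_nonneg) auto
        then show ?thesis unfolding H indicator_def pi[of x A] pi[of y C] using 2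
          by (cases "x \<in> A"; cases "mirror u x \<in> A"; cases "y \<in> C"; cases "mirror u y \<in> C"; simp add: add.commute)
      next
        case 3 then have "p \<le> q" by (intro opp mult_nonpos_nonneg) auto
        then show ?thesis unfolding H indicator_def pi[of x A] pi[of y C] using 3
          by (cases "x \<in> A"; cases "mirror u x \<in> A"; cases "y \<in> C"; cases "mirror u y \<in> C"; simp add: add.commute)
      next
        case 4 then have "p \<le> q" by (intro opp mult_nonneg_nonpos) auto
        then show ?thesis unfolding H indicator_def pi[of x A] pi[of y C] using 4
          by (cases "x \<in> A"; cases "mirror u x \<in> A"; cases "y \<in> C"; cases "mirror u y \<in> C"; simp add: add.commute)
      qed
    qed
  qed
  have "4 * interact W (indicator A) (indicator C) \<le> 4 * interact W (indicator (polarize u A)) (indicator (polarize u C))"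
    unfolding quad[OF assms(3,4)] quad[OF sets_polarize sets_polarize, OF assms(3,4)]
    by (intro nn_integral_mono le)
  then show ?thesis by (simp add: ennreal_mult_le_mult_iff)
qed

section \<open>Reflections that move mass into a ball\<close>

lemma norm_sgn_diff_le:
  fixes u v :: "'a::real_normed_vector"
  assumes "u \<noteq> 0" "v \<noteq> 0"
  shows "norm (sgn u - sgn v) \<le> 2 * norm (u - v) / norm u"
proof -
  have "norm u *\<^sub>R (sgn u - sgn v) = (u - v) - ((norm u - norm v) / norm v) *\<^sub>R v"
    using assms by (simp add: sgn_div_norm scaleR_diff_right left_diff_distrib scaleR_diff_left divide_inverse)
  then have "norm u * norm (sgn u - sgn v) = norm ((u - v) - ((norm u - norm v) / norm v) *\<^sub>R v)"
    by (metis abs_norm_cancel norm_scaleR)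
  also have "\<dots> \<le> norm (u - v) + norm (((norm u - norm v) / norm v) *\<^sub>R v)"
    by (rule norm_triangle_ineq4)
  also have "norm (((norm u - norm v) / norm v) *\<^sub>R v) = \<bar>norm u - norm v\<bar>"
    using assms by simp
  also have "\<bar>norm u - norm v\<bar> \<le> norm (u - v)" by (rule norm_triangle_ineq3)
  finally show ?thesis using assms by (simp add: field_simps)
qed

text \<open>Householder form: the linear part depends only on the direction of \<open>u\<close>, and
  the translation is linear in \<open>u\<close>. This isolates the dependence on \<open>u\<close>
  that has to be shown Lipschitz.\<close>

lemma mirror_sgn:
  assumes "u \<noteq> 0"
  shows "mirror u x = x - (2 * (x \<bullet> sgn u)) *\<^sub>R sgn u + 2 *\<^sub>R u"
proof -
  have "(2 * (x \<bullet> sgn u)) *\<^sub>R sgn u = (2 * (x \<bullet> u / (u \<bullet> u))) *\<^sub>R u"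
    by (simp add: sgn_div_norm power2_norm_eq_inner[symmetric] power2_eq_square divide_inverse mult_ac)
  moreover have "mirror u x = x - (2 * (x \<bullet> u / (u \<bullet> u))) *\<^sub>R u + 2 *\<^sub>R u"
    by (simp add: mirror_def scaleR_diff_left right_diff_distrib)
  ultimately show ?thesis by simp
qed

text \<open>The direction of \<open>u\<close> degenerates at 0, hence the cut-off \<eta>.\<close>

lemma norm_mirror_foot_diff:
  assumes "0 < \<eta>" "\<eta> \<le> norm u" "\<eta> \<le> norm v"
  shows "norm (mirror u x - mirror v x) \<le> (8 * norm x / \<eta> + 2) * norm (u - v)"
proof -
  have nz: "u \<noteq> 0" "v \<noteq> 0" using assms by auto
  let ?s = "sgn u" and ?t = "sgn v"
  have "norm (?s - ?t) \<le> 2 * norm (u - v) / norm u" by (rule norm_sgn_diff_le[OF nz])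
  also have "\<dots> \<le> 2 * norm (u - v) / \<eta>" using assms by (intro divide_left_mono mult_pos_pos) auto
  finally have st: "norm (?s - ?t) \<le> 2 * norm (u - v) / \<eta>" .
  have "mirror u x - mirror v x =
     2 *\<^sub>R (u - v) - (2 * (x \<bullet> (?s - ?t))) *\<^sub>R ?s - (2 * (x \<bullet> ?t)) *\<^sub>R (?s - ?t)"
    unfolding mirror_sgn[OF nz(1)] mirror_sgn[OF nz(2)]
    by (simp add: inner_diff_right algebra_simps)
  also have "norm \<dots> \<le> norm (2 *\<^sub>R (u - v)) + norm ((2 * (x \<bullet> (?s - ?t))) *\<^sub>R ?s) + norm ((2 * (x \<bullet> ?t)) *\<^sub>R (?s - ?t))"
    by (intro norm_triangle_le_diff add_mono order_refl)
  also have "norm ((2 * (x \<bullet> (?s - ?t))) *\<^sub>R ?s) \<le> 2 * (norm x * norm (?s - ?t))"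
    using nz Cauchy_Schwarz_ineq2[of x "?s - ?t"] by (simp add: norm_sgn)
  also have "norm ((2 * (x \<bullet> ?t)) *\<^sub>R (?s - ?t)) \<le> 2 * (norm x * norm (?s - ?t))"
    using nz Cauchy_Schwarz_ineq2[of x ?t] by (simp add: norm_sgn abs_mult mult_right_mono)
  also have "norm (2 *\<^sub>R (u - v)) + 2 * (norm x * norm (?s - ?t)) + 2 * (norm x * norm (?s - ?t))
     = 2 * norm (u - v) + 4 * norm x * norm (?s - ?t)" by simp
  also have "\<dots> \<le> 2 * norm (u - v) + 4 * norm x * (2 * norm (u - v) / \<eta>)"
    using st by (intro add_left_mono mult_left_mono) auto
  also have "\<dots> = (8 * norm x / \<eta> + 2) * norm (u - v)" by (simp add: algebra_simps)
  finally show ?thesis by simp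
qed

text \<open>The foot of the perpendicular from the origin to the bisector of \<open>x\<close> and \<open>y\<close>.\<close>
definition foot :: "'a::real_inner \<Rightarrow> 'a \<Rightarrow> 'a" where
  "foot x y = (((norm x)\<^sup>2 - (norm y)\<^sup>2) / (2 * (norm (x - y))\<^sup>2)) *\<^sub>R (x - y)"

lemma foot_nonzero: "norm y < norm x \<Longrightarrow> foot x y \<noteq> 0"
  using power_strict_mono[of "norm y" "norm x" 2] by (auto simp: foot_def)

lemma mirror_foot:
  assumes "norm y < norm x" shows "mirror (foot x y) x = y"
proof -
  define k where "k = ((norm x)\<^sup>2 - (norm y)\<^sup>2) / (2 * (norm (x - y))\<^sup>2)"
  have u: "foot x y = k *\<^sub>R (x - y)" by (simp add: foot_def k_def)
  have k: "k \<noteq> 0" using foot_nonzero[OF assms] u by auto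
  have n: "(norm (x - y))\<^sup>2 \<noteq> 0" using assms by auto
  have kk: "k * (norm (x - y))\<^sup>2 = ((norm x)\<^sup>2 - (norm y)\<^sup>2) / 2" using n by (simp add: k_def)
  have xx: "x \<bullet> (x - y) = ((norm (x - y))\<^sup>2 + ((norm x)\<^sup>2 - (norm y)\<^sup>2)) / 2"
    by (simp add: power2_norm_eq_inner inner_diff_left inner_diff_right inner_commute)
  have uu: "foot x y \<bullet> foot x y = k * (k * (norm (x - y))\<^sup>2)"
    by (simp add: u power2_norm_eq_inner)
  define \<Delta> where "\<Delta> = (norm x)\<^sup>2 - (norm y)\<^sup>2"
  have D: "\<Delta> \<noteq> 0" using k by (auto simp: k_def \<Delta>_def)
  have "x \<bullet> foot x y / (foot x y \<bullet> foot x y) = (x \<bullet> (x - y)) / (k * (norm (x - y))\<^sup>2)"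
    unfolding uu using k by (simp add: u)
  also have "\<dots> - 1 = (norm (x - y))\<^sup>2 / \<Delta>"
    unfolding kk xx \<Delta>_def[symmetric] using D by (simp add: field_simps)
  finally have "2 * (x \<bullet> foot x y / (foot x y \<bullet> foot x y) - 1) * k = 2 * ((norm (x - y))\<^sup>2 / \<Delta>) * k" by simp
  also have "\<dots> = 1" using n D by (simp add: k_def \<Delta>_def[symmetric])
  finally show ?thesis by (simp add: mirror_def u)
qed

text \<open>The norm of the foot is \<open>(|x| - |y|) * (|x| + |y|) / (2 * |x - y|)\<close>. A gap
  \<eta> between \<open>|y|\<close> and \<open>r\<close> keeps all feet in a fixed annulus, away
  from 0 where the Lipschitz constant blows up.\<close>

lemma norm_foot_bounds:
  assumes "norm y \<le> r - \<eta>" "r \<le> norm x" "norm x \<le> R" "0 < \<eta>" "0 < r"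
  shows "\<eta> * r / (4 * R) \<le> norm (foot x y)" "norm (foot x y) \<le> R"
proof -
  have yx: "norm y < norm x" using assms by linarith
  then have xy: "norm (x - y) > 0" by auto
  have "norm (foot x y) = ((norm x)\<^sup>2 - (norm y)\<^sup>2) / (2 * (norm (x - y))\<^sup>2) * norm (x - y)"
    using power_strict_mono[OF yx, of 2] by (simp add: foot_def abs_of_pos)
  also have "\<dots> = (norm x - norm y) * (norm x + norm y) / (2 * norm (x - y))"
    using xy by (simp add: power2_eq_square field_simps)
  finally have eq: "norm (foot x y) = (norm x - norm y) * (norm x + norm y) / (2 * norm (x - y))" .
  have "norm (x - y) \<le> norm x + norm y" by (rule norm_triangle_ineq4)
  also have "\<dots> \<le> 2 * R" using assms yx by linarith
  finally have u: "norm (x - y) \<le> 2 * R" .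
  have "\<eta> * r \<le> (norm x - norm y) * (norm x + norm y)"
    using assms norm_ge_zero[of y] by (intro mult_mono) linarith+
  then have "\<eta> * r / (2 * (2 * R)) \<le> (norm x - norm y) * (norm x + norm y) / (2 * norm (x - y))"
    using u xy assms yx by (intro frac_le) auto
  then show "\<eta> * r / (4 * R) \<le> norm (foot x y)" by (simp add: eq)
  have "(norm x - norm y) * (norm x + norm y) \<le> norm (x - y) * (2 * R)"
    using assms yx norm_triangle_ineq2[of x y] by (intro mult_mono) auto
  then show "norm (foot x y) \<le> R" using xy by (simp add: eq field_simps)
qed

lemma mirror_pair_measurable [measurable]:
  "(\<lambda>(u, x). mirror u x) \<in> borel_measurable (borel \<Otimes>\<^sub>M (borel :: 'a::euclidean_space measure))"
  unfolding mirror_def case_prod_beta by measurable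

text \<open>
  Averaging over the feet \<open>u\<close>: the fibre \<open>{u. mirror u x \<in> Y}\<close> has measure at least a multiple of
  \<open>|Y|\<close>, because \<open>u \<mapsto> mirror u x\<close> is Lipschitz away from \<open>u = 0\<close>.
\<close>
lemma exists_mirror_moving:
  fixes R r \<eta> :: real
  assumes "0 < r" "r \<le> R" "0 < \<eta>"
  obtains \<gamma> where "\<gamma> > 0"
    "\<And>X Y :: 'a::euclidean_space set. \<lbrakk>X \<in> sets borel; Y \<in> sets borel; X \<subseteq> cball 0 R - ball 0 r; Y \<subseteq> cball 0 (r - \<eta>);
        measure lborel X > 0; measure lborel Y > 0\<rbrakk>
      \<Longrightarrow> \<exists>u. u \<noteq> 0 \<and> \<gamma> * measure lborel X * measure lborel Y \<le> measure lborel {x \<in> X. mirror u x \<in> Y}"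
proof -
  \<comment> \<open>\<open>U\<close> is the annulus that contains all relevant feet by
    \<open>norm_foot_bounds\<close>, and \<open>L\<close> is the Lipschitz constant of the map from
    \<open>u\<close> to \<open>mirror u x\<close> on it.\<close>
  define e where "e = \<eta> * r / (4 * R)"
  define L where "L = 8 * R / e + 2"
  define U where "U = cball 0 R - ball (0::'a) e"
  have e: "e > 0" using assms by (simp add: e_def)
  have L: "L > 0" using e assms by (simp add: L_def add_nonneg_pos)
  have U: "emeasure lborel U < \<infinity>" "U \<in> sets borel"
    using emeasure_mono[of U "cball 0 R" lborel] emeasure_lborel_cball_finite[of "0::'a" R]
    by (auto simp: U_def intro: le_less_trans)
  define mU where "mU = measure lborel U"
  have mU: "emeasure lborel U = ennreal mU" using U by (simp add: mU_def emeasure_eq_ennreal_measure)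
  have mU0: "mU \<ge> 0" by (simp add: mU_def)
  \<comment> \<open>The 1 added to \<open>mU\<close> makes the final comparison strict.\<close>
  define \<gamma> where "\<gamma> = 1 / (L ^ DIM('a) * (mU + 1))"
  have \<gamma>: "\<gamma> > 0" using L mU0 by (simp add: \<gamma>_def)
  show thesis
  proof (rule that[OF \<gamma>])
    fix X Y :: "'a set"
    assume X: "X \<in> sets borel" "X \<subseteq> cball 0 R - ball 0 r" and Y: "Y \<in> sets borel" "Y \<subseteq> cball 0 (r - \<eta>)"
      and pos: "measure lborel X > 0" "measure lborel Y > 0"
    note [measurable] = X(1) Y(1) U(2)
    have fin: "emeasure lborel X < \<infinity>" "emeasure lborel Y < \<infinity>"
      using emeasure_mono[of X "cball 0 R" lborel] emeasure_mono[of Y "cball 0 (r - \<eta>)" lborel]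
        emeasure_lborel_cball_finite[of "0::'a" R]  emeasure_lborel_cball_finite[of "0::'a" "r - \<eta>"] X Y
      by (auto intro: le_less_trans)
    define x0 y0 where "x0 = measure lborel X" and "y0 = measure lborel Y"
    have xy: "emeasure lborel X = ennreal x0" "emeasure lborel Y = ennreal y0" "x0 > 0" "y0 > 0"
      using fin pos by (simp_all add: x0_def y0_def emeasure_eq_ennreal_measure)
    define H where "H u = {x \<in> X. mirror u x \<in> Y}" for u
    have Hm[measurable]: "H u \<in> sets borel" for u
      unfolding H_def by measurable
    \<comment> \<open>If every reflection in \<open>U\<close> moved too little mass from
      \<open>X\<close> to \<open>Y\<close>, integrating the moved mass over \<open>U\<close> and
      exchanging the integrals would contradict the lower bound on the fibres.\<close>
    have "\<exists>u\<in>U. ennreal (\<gamma> * x0 * y0) \<le> emeasure lborel (H u)"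
    proof (rule ccontr)
      assume "\<not> ?thesis"
      then have small: "emeasure lborel (H u) \<le> ennreal (\<gamma> * x0 * y0)" if "u \<in> U" for u using that by auto
      have fibre: "ennreal y0 \<le> ennreal (L ^ DIM('a)) * emeasure lborel {u \<in> U. mirror u x \<in> Y}" if x: "x \<in> X" for x
        unfolding xy(2)[symmetric]
      proof (rule emeasure_Lipschitz_image_le[where f="\<lambda>u. mirror u x"])
        show "{u \<in> U. mirror u x \<in> Y} \<in> sets borel" by measurable
        have xR: "norm x \<le> R" "r \<le> norm x" using x X(2) by auto
        show "norm (mirror u x - mirror v x) \<le> L * norm (u - v)" if "u \<in> {u \<in> U. mirror u x \<in> Y}" "v \<in> {u \<in> U. mirror u x \<in> Y}" for u v
        proof -
          have "norm (mirror u x - mirror v x) \<le> (8 * norm x / e + 2) * norm (u - v)"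
            using that by (intro norm_mirror_foot_diff e) (auto simp: U_def)
          also have "\<dots> \<le> L * norm (u - v)"
            unfolding L_def using xR e by (intro mult_right_mono add_right_mono divide_right_mono) auto
          finally show ?thesis .
        qed
        \<comment> \<open>Each \<open>y\<close> is reached, because the reflection with foot
          \<open>foot x y\<close> sends \<open>x\<close> to \<open>y\<close>.\<close>
        show "Y \<subseteq> (\<lambda>u. mirror u x) ` {u \<in> U. mirror u x \<in> Y}"
        proof
          fix y assume y: "y \<in> Y"
          have yr: "norm y \<le> r - \<eta>" using y Y(2) by auto
          have "mirror (foot x y) x = y" using yr xR assms by (intro mirror_foot) auto
          moreover have "foot x y \<in> U"
            using norm_foot_bounds[OF yr xR(2,1) assms(3,1)] by (auto simp: U_def e_def)
          ultimately show "y \<in> (\<lambda>u. mirror u x) ` {u \<in> U. mirror u x \<in> Y}" using y by force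
        qed
      qed (use L Y in auto)
      have "ennreal (x0 * y0) = (\<integral>\<^sup>+x. ennreal y0 * indicator X x \<partial>lborel)"
        using xy by (simp add: nn_integral_cmult ennreal_mult mult.commute)
      also have "\<dots> \<le> (\<integral>\<^sup>+x. ennreal (L ^ DIM('a)) * (\<integral>\<^sup>+u. indicator U u * indicator (H u) x \<partial>lborel) \<partial>lborel)"
      proof (rule nn_integral_mono)
        fix x :: 'a
        have "(\<integral>\<^sup>+u. indicator U u * indicator (H u) x \<partial>lborel) = (\<integral>\<^sup>+u. indicator {u \<in> U. mirror u x \<in> Y} u \<partial>lborel)" if "x \<in> X"
          using that by (intro nn_integral_cong) (auto simp: indicator_def H_def)
        moreover have "{u \<in> U. mirror u x \<in> Y} \<in> sets borel" by measurable
        ultimately show "ennreal y0 * indicator X x \<le> ennreal (L ^ DIM('a)) * (\<integral>\<^sup>+u. indicator U u * indicator (H u) x \<partial>lborel)"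
          using fibre[of x] by (cases "x \<in> X") auto
      qed
      also have "\<dots> = ennreal (L ^ DIM('a)) * (\<integral>\<^sup>+x. \<integral>\<^sup>+u. indicator U u * indicator (H u) x \<partial>lborel \<partial>lborel)"
        by (rule nn_integral_cmult) (simp add: H_def indicator_def[abs_def])
      also have "(\<integral>\<^sup>+x. \<integral>\<^sup>+u. indicator U u * indicator (H u) x \<partial>lborel \<partial>lborel) = (\<integral>\<^sup>+u. \<integral>\<^sup>+x. indicator U u * indicator (H u) x \<partial>lborel \<partial>lborel)"
        by (rule lborel_pair.Fubini') (simp add: H_def indicator_def[abs_def])
      also have "\<dots> = (\<integral>\<^sup>+u. indicator U u * emeasure lborel (H u) \<partial>lborel)"
        by (intro nn_integral_cong) (simp add: nn_integral_cmult)
      also have "\<dots> \<le> (\<integral>\<^sup>+u. ennreal (\<gamma> * x0 * y0) * indicator U u \<partial>lborel)"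
        using small by (intro nn_integral_mono) (auto simp: indicator_def)
      also have "\<dots> = ennreal (\<gamma> * x0 * y0) * ennreal mU" using mU by (simp add: nn_integral_cmult)
      finally have "ennreal (x0 * y0) \<le> ennreal (L ^ DIM('a)) * (ennreal (\<gamma> * x0 * y0) * ennreal mU)"
        by (simp add: mult_left_mono)
      also have "\<dots> = ennreal (L ^ DIM('a) * (\<gamma> * x0 * y0 * mU))"
        using L \<gamma> xy mU0 by (simp add: ennreal_mult)
      finally have "x0 * y0 \<le> L ^ DIM('a) * (\<gamma> * x0 * y0 * mU)"
        using L \<gamma> xy mU0 by (subst (asm) ennreal_le_iff) auto
      also have "\<dots> = x0 * y0 * (mU / (mU + 1))"
        using L mU0 by (simp add: \<gamma>_def)
      finally have "x0 * y0 \<le> x0 * y0 * (mU / (mU + 1))" .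
      moreover have "x0 * y0 * (mU / (mU + 1)) < x0 * y0 * 1"
        using xy mU0 by (intro mult_strict_left_mono) auto
      ultimately show False by simp
    qed
    then obtain u where u: "u \<in> U" "ennreal (\<gamma> * x0 * y0) \<le> emeasure lborel (H u)" by auto
    have "emeasure lborel (H u) < \<infinity>"
      using emeasure_mono[of "H u" X lborel] fin by (auto simp: H_def intro: le_less_trans)
    then have "\<gamma> * x0 * y0 \<le> measure lborel (H u)"
      using u(2) by (simp add: emeasure_eq_ennreal_measure)
    moreover have "u \<noteq> 0" using u e by (auto simp: U_def)
    ultimately show "\<exists>u. u \<noteq> 0 \<and> \<gamma> * measure lborel X * measure lborel Y \<le> measure lborel {x \<in> X. mirror u x \<in> Y}"
      by (auto simp: x0_def y0_def H_def)
  qed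
qed

text \<open>A point of \<open>A\<close> outside the ball whose mirror image is a vacant point of the
  ball is moved there. Nothing is pushed out in exchange, since of two mirror points the near one
  has the smaller norm.\<close>

lemma polarize_gain:
  fixes A :: "'a::euclidean_space set"
  assumes u: "u \<noteq> 0" and A: "A \<in> sets borel" "emeasure lborel A < \<infinity>"
  shows "measure lborel (polarize u A - ball 0 r) + measure lborel {x \<in> A - ball 0 r. mirror u x \<in> ball 0 r - A}
     \<le> measure lborel (A - ball 0 r)"
proof -
  let ?B = "ball (0::'a) r" and ?P = "polarize u A"
  define G where "G = {x \<in> A - ?B. mirror u x \<in> ?B - A}"
  note [measurable] = A(1) sets_polarize[OF A(1), of u]
  have [measurable]: "?B \<in> sets borel" "?B - A \<in> sets borel" "A - ?B \<in> sets borel" by auto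
  have [measurable]: "G \<in> sets borel" unfolding G_def by measurable
  have pw: "indicator (A \<inter> ?B) x + indicator G x + (indicator (A \<inter> ?B) (mirror u x) + indicator G (mirror u x))
      \<le> (indicator (?P \<inter> ?B) x + indicator (?P \<inter> ?B) (mirror u x) :: ennreal)" for x
  proof -
    have near: "indicator (A \<inter> ?B) x + indicator G x + (indicator (A \<inter> ?B) (mirror u x) + indicator G (mirror u x))
      \<le> (indicator (?P \<inter> ?B) x + indicator (?P \<inter> ?B) (mirror u x) :: ennreal)" if x: "x \<bullet> u < u \<bullet> u" for x
    proof -
      have "norm x \<le> norm (mirror u x)" using x by (intro norm_mirror_ge u) auto
      then have "mirror u x \<in> ?B \<Longrightarrow> x \<in> ?B" by auto
      moreover have "x \<in> ?P \<longleftrightarrow> x \<in> A \<or> mirror u x \<in> A" "mirror u x \<in> ?P \<longleftrightarrow> x \<in> A \<and> mirror u x \<in> A"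
        using x u mirror_inner[OF u, of x] by (auto simp: polarize_def)
      ultimately show ?thesis using u by (auto simp: indicator_def G_def)
    qed
    \<comment> \<open>The symmetrised inequality does not change when the mirror points are
      exchanged, so the far case reduces to the near one.\<close>
    consider "x \<bullet> u < u \<bullet> u" | "x \<bullet> u > u \<bullet> u" | "x \<bullet> u = u \<bullet> u" by linarith
    then show ?thesis
    proof cases
      case 2
      then have "mirror u x \<bullet> u < u \<bullet> u" using mirror_inner[OF u, of x] by simp
      from near[OF this] show ?thesis using u by (simp add: ac_simps)
    next
      case 3
      then have "mirror u x = x" using u by (simp add: mirror_def)
      then show ?thesis using 3 by (auto simp: indicator_def G_def polarize_def)
    qed (rule near)
  qed
  have "(\<integral>\<^sup>+x. indicator (A \<inter> ?B) x + indicator G x \<partial>lborel) \<le> (\<integral>\<^sup>+x. indicator (?P \<inter> ?B) x \<partial>lborel)"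
    by (intro nn_integral_mirror_mono[OF u] pw) measurable
  then have "emeasure lborel (A \<inter> ?B) + emeasure lborel G \<le> emeasure lborel (?P \<inter> ?B)"
    by (simp add: nn_integral_add)
  moreover have fin: "?P \<in> fmeasurable lborel" "A \<in> fmeasurable lborel"
    using A emeasure_polarize[OF u A(1)] by (auto simp: fmeasurable_def)
  have "A \<inter> ?B \<in> fmeasurable lborel" "G \<in> fmeasurable lborel" "?P \<inter> ?B \<in> fmeasurable lborel"
    by (rule fmeasurableI2[OF fin(2)], auto, rule fmeasurableI2[OF fin(2)], simp add: G_def subset_iff, measurable, rule fmeasurableI2[OF fin(1)], auto)
  ultimately have "measure lborel (A \<inter> ?B) + measure lborel G \<le> measure lborel (?P \<inter> ?B)"
    by (simp add: emeasure_eq_measure2 flip: ennreal_plus)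
  moreover have "measure lborel ?P = measure lborel A" using emeasure_polarize[OF u A(1)] by (simp add: measure_def)
  moreover have "measure lborel Z = measure lborel (Z \<inter> ?B) + measure lborel (Z - ?B)" if "Z \<in> fmeasurable lborel" for Z
  proof -
    have "measure lborel ((Z \<inter> ?B) \<union> (Z - ?B)) = measure lborel (Z \<inter> ?B) + measure lborel (Z - ?B)"
      using that by (intro measure_Un_AE) (auto intro!: fmeasurable_Int_fmeasurable fmeasurable_Diff)
    then show ?thesis by (simp add: Int_Diff_Un)
  qed
  ultimately show ?thesis using fin by (fold G_def) (smt (verit))
qed

lemma finite_emeasure_subset_cball:
  fixes A :: "'a::euclidean_space set"
  assumes "A \<subseteq> cball 0 R" shows "emeasure lborel A < \<infinity>"
  using emeasure_mono[of A "cball 0 R" lborel] emeasure_lborel_cball_finite[of "0::'a" R] assms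
  by (auto intro: le_less_trans)

lemma measure_Int_Diff:
  assumes "Z \<in> fmeasurable M" "T \<in> sets M"
  shows "measure M Z = measure M (Z \<inter> T) + measure M (Z - T)"
proof -
  have "measure M ((Z \<inter> T) \<union> (Z - T)) = measure M (Z \<inter> T) + measure M (Z - T)"
    using assms by (intro measure_Un_AE) (auto intro!: fmeasurable_Int_fmeasurable fmeasurable_Diff)
  then show ?thesis by (simp add: Int_Diff_Un)
qed

text \<open>The point is that \<open>g\<close> depends on \<open>r\<close>, \<open>R\<close> and
  \<delta> but not on the set: only a uniform gain contradicts a positive infimum.\<close>

lemma uniform_polarize_gain:
  fixes r R \<delta> :: real
  assumes "0 < r" "r \<le> R" "0 < \<delta>"
  obtains g where "g > 0"
    "\<And>A :: 'a::euclidean_space set. \<lbrakk>A \<in> sets borel; A \<subseteq> cball 0 R; emeasure lborel A = emeasure lborel (ball (0::'a) r);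
        \<delta> \<le> measure lborel (A - ball (0::'a) r)\<rbrakk>
      \<Longrightarrow> \<exists>u. u \<noteq> 0 \<and> measure lborel (polarize u A - ball (0::'a) r) + g \<le> measure lborel (A - ball (0::'a) r)"
proof -
  let ?B = "ball (0::'a) r" and ?\<omega> = "unit_ball_vol (real DIM('a))"
  have "((\<lambda>\<eta>. ?\<omega> * r ^ DIM('a) - ?\<omega> * (r - \<eta>) ^ DIM('a)) \<longlongrightarrow> ?\<omega> * r ^ DIM('a) - ?\<omega> * (r - 0) ^ DIM('a)) (at_right 0)"
    by (intro tendsto_intros)
  then have "\<forall>\<^sub>F \<eta> in at_right 0. ?\<omega> * r ^ DIM('a) - ?\<omega> * (r - \<eta>) ^ DIM('a) < \<delta> / 2"
    using assms by (intro order_tendstoD) auto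
  moreover have "\<forall>\<^sub>F \<eta> in at_right 0. \<eta> < r \<and> 0 < \<eta>"
    using assms eventually_at_right_less[of "0::real"] by (auto simp: eventually_at_right_field)
  ultimately have "\<forall>\<^sub>F \<eta> in at_right 0. ?\<omega> * r ^ DIM('a) - ?\<omega> * (r - \<eta>) ^ DIM('a) < \<delta> / 2 \<and> \<eta> < r \<and> 0 < \<eta>"
    by eventually_elim auto
  \<comment> \<open>The shell between the radii \<open>r - \<eta>\<close> and \<open>r\<close> has
    volume below \<open>\<delta> / 2\<close>, so at least \<open>\<delta> / 2\<close> of the vacant
    part of the ball lies in the inner ball, where \<open>exists_mirror_moving\<close>
    applies.\<close>
  then obtain \<eta> where \<eta>: "?\<omega> * r ^ DIM('a) - ?\<omega> * (r - \<eta>) ^ DIM('a) < \<delta> / 2" "\<eta> < r" "0 < \<eta>"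
    using eventually_happens'[OF trivial_limit_at_right_real] by blast
  let ?D = "cball (0::'a) (r - \<eta>)"
  obtain \<gamma> where \<gamma>: "\<gamma> > 0"
    "\<And>X Y :: 'a set. \<lbrakk>X \<in> sets borel; Y \<in> sets borel; X \<subseteq> cball 0 R - ball (0::'a) r; Y \<subseteq> cball 0 (r - \<eta>);
        measure lborel X > 0; measure lborel Y > 0\<rbrakk>
      \<Longrightarrow> \<exists>u. u \<noteq> 0 \<and> \<gamma> * measure lborel X * measure lborel Y \<le> measure lborel {x \<in> X. mirror u x \<in> Y}"
    using exists_mirror_moving[OF assms(1,2) \<eta>(3), where 'a='a] by blast
  show thesis
  proof (rule that[of "\<gamma> * \<delta> * (\<delta> / 2)"])
    show "0 < \<gamma> * \<delta> * (\<delta> / 2)" using \<gamma> assms by simp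
    fix A :: "'a set"
    assume A: "A \<in> sets borel" "A \<subseteq> cball 0 R" "emeasure lborel A = emeasure lborel ?B"
      and \<delta>: "\<delta> \<le> measure lborel (A - ?B)"
    have finA: "A \<in> fmeasurable lborel" "?B \<in> fmeasurable lborel" "?D \<in> fmeasurable lborel"
      using A finite_emeasure_subset_cball[OF A(2)] emeasure_lborel_ball_finite[of "0::'a" r] emeasure_lborel_cball_finite[of "0::'a" "r - \<eta>"]
      by (auto simp: fmeasurable_def)
    define X Y where "X = A - ?B" and "Y = (?B - A) \<inter> ?D"
    \<comment> \<open>Since \<open>A\<close> has the volume of the ball, the vacancy inside equals
      the excess outside.\<close>
    have mAB: "measure lborel (?B - A) = measure lborel (A - ?B)"
    proof -
      have "measure lborel A = measure lborel ?B" using A by (simp add: measure_def)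
      then show ?thesis using measure_Int_Diff[of A lborel ?B] measure_Int_Diff[of ?B lborel A] finA
        by (simp add: fmeasurableD Int_commute A(1))
    qed
    have "measure lborel (?B - A) \<le> measure lborel (Y \<union> (?B - ?D))"
      using finA by (intro measure_mono_fmeasurable) (auto simp: Y_def)
    also have "\<dots> \<le> measure lborel Y + measure lborel (?B - ?D)"
      using finA by (intro measure_Un_le) (auto simp: Y_def fmeasurableD)
    also have "measure lborel (?B - ?D) = ?\<omega> * r ^ DIM('a) - ?\<omega> * (r - \<eta>) ^ DIM('a)"
      using finA \<eta> assms by (subst measurable_measure_Diff) (auto simp: content_ball content_cball fmeasurableD)
    finally have Y: "\<delta> / 2 \<le> measure lborel Y" using \<delta> \<eta> mAB by linarith
    have X: "\<delta> \<le> measure lborel X" using \<delta> by (simp add: X_def)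
    have "\<exists>u. u \<noteq> 0 \<and> \<gamma> * measure lborel X * measure lborel Y \<le> measure lborel {x \<in> X. mirror u x \<in> Y}"
      using A X Y assms by (intro \<gamma>(2)) (auto simp: X_def Y_def)
    then obtain u where u: "u \<noteq> 0" "\<gamma> * measure lborel X * measure lborel Y \<le> measure lborel {x \<in> X. mirror u x \<in> Y}" by blast
    have "\<gamma> * \<delta> * (\<delta> / 2) \<le> \<gamma> * measure lborel X * measure lborel Y"
      using X Y \<gamma> assms by (intro mult_mono) auto
    also note u(2)
    also have "measure lborel {x \<in> X. mirror u x \<in> Y} \<le> measure lborel {x \<in> A - ?B. mirror u x \<in> ?B - A}"
    proof (intro measure_mono_fmeasurable)
      note [measurable] = A(1)
      have [measurable]: "X \<in> sets borel" "Y \<in> sets borel" "A - ?B \<in> sets borel" "?B - A \<in> sets borel" using A by (auto simp: X_def Y_def)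
      show "{x \<in> X. mirror u x \<in> Y} \<in> sets lborel" by measurable
      have "{x \<in> A - ?B. mirror u x \<in> ?B - A} \<in> sets lborel" by measurable
      then show "{x \<in> A - ?B. mirror u x \<in> ?B - A} \<in> fmeasurable lborel"
        by (intro fmeasurableI2[OF finA(1)]) auto
    qed (auto simp: X_def Y_def)
    finally have "\<gamma> * \<delta> * (\<delta> / 2) \<le> measure lborel {x \<in> A - ?B. mirror u x \<in> ?B - A}" .
    moreover have "measure lborel (polarize u A - ?B) + measure lborel {x \<in> A - ?B. mirror u x \<in> ?B - A} \<le> measure lborel (A - ?B)"
      using finA by (intro polarize_gain u A) (auto simp: fmeasurable_def)
    ultimately show "\<exists>u. u \<noteq> 0 \<and> measure lborel (polarize u A - ?B) + \<gamma> * \<delta> * (\<delta> / 2) \<le> measure lborel (A - ?B)"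
      using u(1) by (intro exI[of _ u]) linarith
  qed
qed

section \<open>Riesz rearrangement against the bathtub constraint\<close>

text \<open>By the uniform gain, the total mass outside the two balls cannot have a positive infimum over
  all pairs of sets that do not decrease the interaction.\<close>
lemma polarizations_approach_balls:
  fixes A C :: "'a::euclidean_space set"
  assumes W: "radial_kernel W"
    and A: "A \<in> sets borel" "A \<subseteq> cball 0 R" "emeasure lborel A = emeasure lborel (ball (0::'a) a)"
    and C: "C \<in> sets borel" "C \<subseteq> cball 0 R" "emeasure lborel C = emeasure lborel (ball (0::'a) c)"
    and ac: "0 < a" "a \<le> R" "0 < c" "c \<le> R" and \<epsilon>: "0 < \<epsilon>"
  obtains A' C' :: "'a set" where "A' \<in> sets borel" "A' \<subseteq> cball 0 R" "C' \<in> sets borel" "C' \<subseteq> cball 0 R"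
    "interact W (indicator A) (indicator C) \<le> interact W (indicator A') (indicator C')"
    "measure lborel (A' - ball (0::'a) a) + measure lborel (C' - ball (0::'a) c) < \<epsilon>"
proof -
  define Q where "Q = {(A', C') |A' C' :: 'a set. A' \<in> sets borel \<and> A' \<subseteq> cball 0 R \<and> C' \<in> sets borel \<and> C' \<subseteq> cball 0 R \<and>
     emeasure lborel A' = emeasure lborel (ball (0::'a) a) \<and> emeasure lborel C' = emeasure lborel (ball (0::'a) c) \<and>
     interact W (indicator A) (indicator C) \<le> interact W (indicator A') (indicator C')}"
  define \<phi> where "\<phi> P = measure lborel (fst P - ball (0::'a) a) + measure lborel (snd P - ball (0::'a) c)" for P :: "'a set \<times> 'a set"
  have \<phi>0: "\<phi> P \<ge> 0" for P by (simp add: \<phi>_def)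
  have QAC: "(A, C) \<in> Q" using A C by (auto simp: Q_def)
  have bdd: "bdd_below (\<phi> ` Q)" using \<phi>0 by (intro bdd_belowI[of _ 0]) auto
  have Qpol: "(polarize u A', polarize u C') \<in> Q" if "(A', C') \<in> Q" "u \<noteq> 0" for A' C' u
    using that interact_polarize[OF W that(2), of A' C']
    by (auto simp: Q_def emeasure_polarize sets_polarize polarize_subset_cball intro: order_trans simp del: sets.sets_into_space)
  have "\<exists>P\<in>Q. \<phi> P < \<epsilon>"
  proof (rule ccontr)
    assume "\<not> ?thesis"
    then have ge: "\<epsilon> \<le> \<phi> P" if "P \<in> Q" for P using that by force
    obtain g1 where g1: "g1 > 0"
      "\<And>A :: 'a set. \<lbrakk>A \<in> sets borel; A \<subseteq> cball 0 R; emeasure lborel A = emeasure lborel (ball (0::'a) a);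
        \<epsilon> / 2 \<le> measure lborel (A - ball (0::'a) a)\<rbrakk>
      \<Longrightarrow> \<exists>u. u \<noteq> 0 \<and> measure lborel (polarize u A - ball (0::'a) a) + g1 \<le> measure lborel (A - ball (0::'a) a)"
      using uniform_polarize_gain[of a R "\<epsilon> / 2", where 'a='a] ac \<epsilon> by (metis half_gt_zero)
    obtain g2 where g2: "g2 > 0"
      "\<And>A :: 'a set. \<lbrakk>A \<in> sets borel; A \<subseteq> cball 0 R; emeasure lborel A = emeasure lborel (ball (0::'a) c);
        \<epsilon> / 2 \<le> measure lborel (A - ball (0::'a) c)\<rbrakk>
      \<Longrightarrow> \<exists>u. u \<noteq> 0 \<and> measure lborel (polarize u A - ball (0::'a) c) + g2 \<le> measure lborel (A - ball (0::'a) c)"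
      using uniform_polarize_gain[of c R "\<epsilon> / 2", where 'a='a] ac \<epsilon> by (metis half_gt_zero)
    \<comment> \<open>A pair within \<open>min g1 g2\<close> of the infimum is polarized once more
      and then falls below the infimum.\<close>
    have "Inf (\<phi> ` Q) < Inf (\<phi> ` Q) + min g1 g2" using g1 g2 by simp
    then obtain P where P: "P \<in> Q" "\<phi> P < Inf (\<phi> ` Q) + min g1 g2"
      using cInf_lessD[of "\<phi> ` Q"] QAC by blast
    obtain A' C' where PAC: "P = (A', C')" by fastforce
    have Q': "A' \<in> sets borel" "A' \<subseteq> cball 0 R" "C' \<in> sets borel" "C' \<subseteq> cball 0 R"
       "emeasure lborel A' = emeasure lborel (ball (0::'a) a)" "emeasure lborel C' = emeasure lborel (ball (0::'a) c)"
      using P PAC by (auto simp: Q_def)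
    have mono: "measure lborel (polarize u A' - ball (0::'a) a) \<le> measure lborel (A' - ball (0::'a) a)"
         "measure lborel (polarize u C' - ball (0::'a) c) \<le> measure lborel (C' - ball (0::'a) c)" if "u \<noteq> 0" for u
      using polarize_gain[OF that Q'(1), of a] polarize_gain[OF that Q'(3), of c]
        finite_emeasure_subset_cball[OF Q'(2)] finite_emeasure_subset_cball[OF Q'(4)]
      by (smt (verit) measure_nonneg)+
    \<comment> \<open>One reflection has to act on both sets. It is chosen for a set with excess at
      least \<open>\<epsilon> / 2\<close>; the excess of the other does not grow.\<close>
    have "\<epsilon> / 2 \<le> measure lborel (A' - ball (0::'a) a) \<or> \<epsilon> / 2 \<le> measure lborel (C' - ball (0::'a) c)"
      using ge[OF P(1)] by (auto simp: \<phi>_def PAC)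
    then obtain u where u: "u \<noteq> 0" "\<phi> (polarize u A', polarize u C') + min g1 g2 \<le> \<phi> P"
    proof
      assume "\<epsilon> / 2 \<le> measure lborel (A' - ball (0::'a) a)"
      then obtain u where u: "u \<noteq> 0" "measure lborel (polarize u A' - ball (0::'a) a) + g1 \<le> measure lborel (A' - ball (0::'a) a)"
        using g1(2) Q' by blast
      show thesis by (rule that[OF u(1)]) (use u(2) mono(2)[OF u(1)] in \<open>simp add: \<phi>_def PAC\<close>)
    next
      assume "\<epsilon> / 2 \<le> measure lborel (C' - ball (0::'a) c)"
      then obtain u where u: "u \<noteq> 0" "measure lborel (polarize u C' - ball (0::'a) c) + g2 \<le> measure lborel (C' - ball (0::'a) c)"
        using g2(2) Q' by blast
      show thesis by (rule that[OF u(1)]) (use u(2) mono(1)[OF u(1)] in \<open>simp add: \<phi>_def PAC\<close>)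
    qed
    have "Inf (\<phi> ` Q) \<le> \<phi> (polarize u A', polarize u C')"
      using Qpol[OF _ u(1)] P(1) PAC bdd by (intro cInf_lower) auto
    then show False using u(2) P(2) by linarith
  qed
  then obtain A' C' where "(A', C') \<in> Q" "\<phi> (A', C') < \<epsilon>" by auto
  then show thesis by (intro that[of A' C']) (auto simp: Q_def \<phi>_def)
qed

section \<open>Potentials, and Riesz's inequality for sets\<close>

definition potential :: "(real \<Rightarrow> ennreal) \<Rightarrow> ('a::euclidean_space \<Rightarrow> ennreal) \<Rightarrow> 'a \<Rightarrow> ennreal" where
  "potential W f x = (\<integral>\<^sup>+y. f y * W (norm (x - y)) \<partial>lborel)"

lemma potential_measurable:
  assumes "radial_kernel W" and [measurable]: "f \<in> borel_measurable borel"
  shows "potential W f \<in> borel_measurable borel"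
proof -
  note [measurable] = radial_kernelD(1)[OF assms(1)]
  show ?thesis unfolding potential_def by measurable
qed

lemma interact_potential:
  assumes "radial_kernel W" and [measurable]: "f \<in> borel_measurable borel" "g \<in> borel_measurable borel"
  shows "interact W f g = (\<integral>\<^sup>+x. f x * potential W g x \<partial>lborel)"
proof -
  note [measurable] = radial_kernelD(1)[OF assms(1)]
  show ?thesis unfolding interact_def potential_def by (simp add: nn_integral_cmult mult.assoc)
qed

lemma interact_commute:
  assumes "radial_kernel W" and [measurable]: "f \<in> borel_measurable borel" "g \<in> borel_measurable borel"
  shows "interact W f g = interact W g f"
proof -
  note [measurable] = radial_kernelD(1)[OF assms(1)]
  have "interact W f g = (\<integral>\<^sup>+y. \<integral>\<^sup>+x. f x * g y * W (norm (x - y)) \<partial>lborel \<partial>lborel)"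
    unfolding interact_def by (rule lborel_pair.Fubini'[symmetric]) measurable
  then show ?thesis by (simp add: interact_def norm_minus_commute mult.commute mult.left_commute)
qed

lemma interact_mono:
  assumes "\<And>x. f x \<le> f' x" "\<And>x. g x \<le> g' x" shows "interact W f g \<le> interact W f' g'"
  unfolding interact_def using assms by (intro nn_integral_mono mult_right_mono mult_mono) auto

text \<open>Splitting at distance 1 gives a bound that is uniform in \<open>x\<close>: local
  integrability controls the near part, and the kernel is at most \<open>W 1\<close> on the far
  part.\<close>

lemma potential_indicator_le:
  fixes C :: "'a::euclidean_space set"
  assumes W: "radial_kernel W" and [measurable]: "C \<in> sets borel"
  shows "potential W (indicator C) x \<le> (\<integral>\<^sup>+z. indicator (ball (0::'a) 1) z * W (norm z) \<partial>lborel) + W 1 * emeasure lborel C"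
proof -
  note [measurable] = radial_kernelD(1)[OF W]
  have [measurable]: "ball (0::'a) 1 \<in> sets borel" by simp
  have "potential W (indicator C) x \<le> (\<integral>\<^sup>+y. indicator (ball (0::'a) 1) (x - y) * W (norm (x - y)) + W 1 * indicator C y \<partial>lborel)"
    unfolding potential_def
    by (intro nn_integral_mono) (auto simp: indicator_def not_less intro: radial_kernelD(2)[OF W] split: if_splits)
  also have "\<dots> = (\<integral>\<^sup>+y. indicator (ball (0::'a) 1) (x - y) * W (norm (x - y)) \<partial>lborel) + W 1 * emeasure lborel C"
    by (simp add: nn_integral_add nn_integral_cmult)
  also have "(\<integral>\<^sup>+y. indicator (ball (0::'a) 1) (x - y) * W (norm (x - y)) \<partial>lborel)
     = (\<integral>\<^sup>+z. indicator (ball (0::'a) 1) z * W (norm z) \<partial>distr lborel borel (\<lambda>y. x - y))"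
    by (subst nn_integral_distr) auto
  also have "distr lborel borel (\<lambda>y. x - y) = (lborel :: 'a measure)"
    by (rule distr_lborel_isometric_involution) (auto simp: norm_minus_commute)
  finally show ?thesis .
qed

text \<open>The reflection in the bisector of \<open>x\<close> and \<open>x'\<close> exchanges the
  two points. A ball about the origin contains the near one of two mirror points whenever it
  contains the far one, and the near one is on the side of \<open>x\<close>.\<close>

lemma potential_ball_antimono:
  fixes x x' :: "'a::euclidean_space"
  assumes W: "radial_kernel W" and x: "norm x < norm x'"
  shows "potential W (indicator (ball (0::'a) c)) x' \<le> potential W (indicator (ball (0::'a) c)) x"
proof -
  note [measurable] = radial_kernelD(1)[OF W]
  have [measurable]: "ball (0::'a) c \<in> sets borel" by simp
  define u where "u = foot x' x"
  have u: "u \<noteq> 0" "mirror u x' = x" using foot_nonzero[OF x] mirror_foot[OF x] by (auto simp: u_def)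
  have x': "mirror u x = x'" using u by force
  have far: "x \<bullet> u < u \<bullet> u"
  proof (rule ccontr)
    assume "\<not> x \<bullet> u < u \<bullet> u"
    then have "norm (mirror u x) \<le> norm x" using u by (intro norm_mirror_le) auto
    then show False using x x' by simp
  qed
  show ?thesis unfolding potential_def
  proof (rule nn_integral_mirror_mono[OF u(1)])
    fix z
    let ?b = "\<lambda>z. indicator (ball (0::'a) c) z :: ennreal"
    define p q where "p = W (norm (x - z))" and "q = W (norm (x - mirror u z))"
    have pq: "W (norm (x' - z)) = q" "W (norm (x' - mirror u z)) = p"
      using norm_mirror_diff[of u x "mirror u z"] norm_mirror_diff[of u x z] u x' by (simp_all add: p_def q_def)
    have "?b z * q + ?b (mirror u z) * p \<le> ?b z * p + ?b (mirror u z) * q"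
    proof (cases "z \<bullet> u \<le> u \<bullet> u")
      case True
      then have "q \<le> p" unfolding p_def q_def using far u
        by (intro radial_kernelD(2)[OF W] norm_diff_mirror_ge mult_nonpos_nonpos) auto
      moreover have "norm z \<le> norm (mirror u z)" using True u by (intro norm_mirror_ge) auto
      ultimately show ?thesis by (auto simp: indicator_def add.commute)
    next
      case False
      then have "p \<le> q" unfolding p_def q_def using far u
        by (intro radial_kernelD(2)[OF W] norm_diff_mirror_le mult_nonpos_nonneg) auto
      moreover have "norm (mirror u z) \<le> norm z" using False u by (intro norm_mirror_le) auto
      ultimately show ?thesis by (auto simp: indicator_def add.commute)
    qed
    then show "?b z * W (norm (x' - z)) + ?b (mirror u z) * W (norm (x' - mirror u z))
       \<le> ?b z * W (norm (x - z)) + ?b (mirror u z) * W (norm (x - mirror u z))"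
      unfolding pq by (simp add: p_def q_def)
  qed measurable
qed


lemma emeasure_eq_ball:
  fixes A :: "'a::euclidean_space set"
  assumes "emeasure lborel A < \<infinity>"
  shows "\<exists>r\<ge>0. emeasure lborel A = emeasure lborel (ball (0::'a) r)"
proof (intro exI conjI)
  let ?\<omega> = "unit_ball_vol (real DIM('a))" and ?m = "measure lborel A"
  let ?r = "root DIM('a) (?m / ?\<omega>)"
  have \<omega>: "?\<omega> > 0" by simp
  have w0: "?\<omega> \<noteq> 0" using unit_ball_vol_pos[of "real DIM('a)"] by linarith
  show r: "?r \<ge> 0" using \<omega> by (intro real_root_ge_zero divide_nonneg_nonneg) auto
  have "?r ^ DIM('a) = ?m / ?\<omega>" using \<omega> by (intro real_root_pow_pos2) (auto intro!: divide_nonneg_nonneg)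
  then have "?\<omega> * ?r ^ DIM('a) = ?m" by (simp add: w0)
  then show "emeasure lborel A = emeasure lborel (ball (0::'a) ?r)"
    using assms by (simp add: emeasure_ball[OF r] emeasure_eq_ennreal_measure)
qed

lemma interact_zero_measure:
  fixes A C :: "'a::euclidean_space set"
  assumes "radial_kernel W" "A \<in> sets borel" "C \<in> sets borel" "emeasure lborel A = 0"
  shows "interact W (indicator A) (indicator C) = 0"
proof -
  have "A \<in> null_sets lborel" using assms by (auto simp: null_sets_def)
  then have "AE x in lborel. x \<notin> A" by (rule AE_not_in)
  then have "(\<integral>\<^sup>+x. indicator A x * potential W (indicator C) x \<partial>lborel) = (\<integral>\<^sup>+x. 0 \<partial>(lborel :: 'a measure))"
    by (intro nn_integral_cong_AE) (auto elim!: eventually_mono)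
  then show ?thesis using assms by (subst interact_potential) auto
qed

text \<open>Continuity of the interaction with respect to the volume outside \<open>B\<close>: this
  turns sets that are almost balls into balls.\<close>

lemma interact_indicator_diff:
  fixes A B C :: "'a::euclidean_space set"
  assumes W: "radial_kernel W" and [measurable]: "A \<in> sets borel" "B \<in> sets borel" "C \<in> sets borel"
    and K: "\<And>x. potential W (indicator C) x \<le> K"
  shows "interact W (indicator A) (indicator C) \<le> interact W (indicator B) (indicator C) + K * emeasure lborel (A - B)"
proof -
  note [measurable] = potential_measurable[OF W]
  have "interact W (indicator A) (indicator C) \<le> (\<integral>\<^sup>+x. indicator B x * potential W (indicator C) x + K * indicator (A - B) x \<partial>lborel)"
    unfolding interact_potential[OF W borel_measurable_indicator borel_measurable_indicator, OF assms(2,4)]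
    using K by (intro nn_integral_mono) (auto simp: indicator_def)
  also have "\<dots> = interact W (indicator B) (indicator C) + K * emeasure lborel (A - B)"
    unfolding interact_potential[OF W borel_measurable_indicator borel_measurable_indicator, OF assms(3,4)]
    by (subst nn_integral_add) (auto simp: nn_integral_cmult)
  finally show ?thesis .
qed

lemma riesz_rearrangement_bounded:
  fixes A C :: "'a::euclidean_space set"
  assumes W: "radial_kernel W" and fin: "(\<integral>\<^sup>+z. indicator (ball (0::'a) 1) z * W (norm z) \<partial>lborel) < \<infinity>" "W 1 < \<infinity>"
    and A: "A \<in> sets borel" "A \<subseteq> cball 0 R" "emeasure lborel A = emeasure lborel (ball (0::'a) a)" "0 \<le> a"
    and C: "C \<in> sets borel" "C \<subseteq> cball 0 R" "emeasure lborel C = emeasure lborel (ball (0::'a) c)" "0 \<le> c"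
  shows "interact W (indicator A) (indicator C) \<le> interact W (indicator (ball (0::'a) a)) (indicator (ball (0::'a) c))"
proof (cases "a = 0 \<or> c = 0")
  case True
  then have "interact W (indicator A) (indicator C) = 0"
  proof
    assume "a = 0" then show ?thesis using A C W by (intro interact_zero_measure) auto
  next
    assume "c = 0" then have "interact W (indicator C) (indicator A) = 0" using A C W by (intro interact_zero_measure) auto
    then show ?thesis using interact_commute[OF W, of "indicator A" "indicator C"] A C by simp
  qed
  then show ?thesis by simp
next
  case False
  \<comment> \<open>The enclosing radius must also cover both target balls, as
    \<open>polarizations_approach_balls\<close> demands.\<close>
  define R' where "R' = max R (max a c)"
  define K where "K = (\<integral>\<^sup>+z. indicator (ball (0::'a) 1) z * W (norm z) \<partial>lborel) + W 1 * emeasure lborel (cball (0::'a) R')"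
  have "K < \<infinity>" unfolding K_def using fin emeasure_lborel_cball_finite[of "0::'a" R'] by (auto simp: ennreal_mult_less_top)
  then obtain k where k: "K = ennreal k" "k \<ge> 0" by (cases K) auto
  have pot: "potential W (indicator D) x \<le> K" if "D \<in> sets borel" "D \<subseteq> cball 0 R'" for D :: "'a set" and x
  proof -
    have "emeasure lborel D \<le> emeasure lborel (cball (0::'a) R')" by (rule emeasure_mono[OF that(2)]) simp
    then show ?thesis unfolding K_def
      by (intro order_trans[OF potential_indicator_le[OF W that(1)]] add_left_mono mult_left_mono) auto
  qed
  show ?thesis
  proof (rule ennreal_le_epsilon)
    fix e :: real assume e: "0 < e"
    \<comment> \<open>Dividing by \<open>k + 1\<close> covers the case that \<open>k\<close> is
      0.\<close>
    define \<epsilon> where "\<epsilon> = e / (k + 1)"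
    have \<epsilon>: "\<epsilon> > 0" using e k by (simp add: \<epsilon>_def)
    obtain A' C' where AC: "A' \<in> sets borel" "A' \<subseteq> cball 0 R'" "C' \<in> sets borel" "C' \<subseteq> cball 0 R'"
      "interact W (indicator A) (indicator C) \<le> interact W (indicator A') (indicator C')"
      "measure lborel (A' - ball (0::'a) a) + measure lborel (C' - ball (0::'a) c) < \<epsilon>"
      by (rule polarizations_approach_balls[OF W A(1) _ A(3) C(1) _ C(3) _ _ _ _ \<epsilon>, where R=R'])
         (use A C False in \<open>auto simp: R'_def\<close>)
    have meq: "emeasure lborel (D - E) = ennreal (measure lborel (D - E))" if "D \<subseteq> cball 0 R'" for D E :: "'a set"
    proof -
      have "D - E \<subseteq> cball 0 R'" using that by auto
      from finite_emeasure_subset_cball[OF this] show ?thesis by (simp add: emeasure_eq_ennreal_measure)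
    qed
    note AC(5)
    also have "interact W (indicator A') (indicator C') \<le> interact W (indicator (ball (0::'a) a)) (indicator C') + K * emeasure lborel (A' - ball (0::'a) a)"
      using AC pot by (intro interact_indicator_diff[OF W]) auto
    also have "interact W (indicator (ball (0::'a) a)) (indicator C') = interact W (indicator C') (indicator (ball (0::'a) a))"
      using AC by (intro interact_commute[OF W] borel_measurable_indicator) auto
    also have "\<dots> \<le> interact W (indicator (ball (0::'a) c)) (indicator (ball (0::'a) a)) + K * emeasure lborel (C' - ball (0::'a) c)"
      using AC by (intro interact_indicator_diff[OF W] pot) (auto simp: R'_def)
    also have "interact W (indicator (ball (0::'a) c)) (indicator (ball (0::'a) a)) = interact W (indicator (ball (0::'a) a)) (indicator (ball (0::'a) c))"
      by (intro interact_commute[OF W] borel_measurable_indicator) auto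
    finally have "interact W (indicator A) (indicator C) \<le> interact W (indicator (ball (0::'a) a)) (indicator (ball (0::'a) c))
         + (K * emeasure lborel (C' - ball (0::'a) c) + K * emeasure lborel (A' - ball (0::'a) a))" by (simp add: add.assoc)
    also have "K * emeasure lborel (C' - ball (0::'a) c) + K * emeasure lborel (A' - ball (0::'a) a)
        = ennreal (k * (measure lborel (A' - ball (0::'a) a) + measure lborel (C' - ball (0::'a) c)))"
      using k AC by (simp add: meq distrib_left ennreal_mult[symmetric] add.commute flip: ennreal_plus)
    also have "\<dots> \<le> ennreal e"
    proof (rule ennreal_leI)
      have "k * (measure lborel (A' - ball (0::'a) a) + measure lborel (C' - ball (0::'a) c)) \<le> k * \<epsilon>"
        using AC(6) k by (intro mult_left_mono) auto
      also have "k * \<epsilon> \<le> (k + 1) * \<epsilon>" using \<epsilon> by (intro mult_right_mono) auto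
      also have "\<dots> = e" using k by (simp add: \<epsilon>_def)
      finally show "k * (measure lborel (A' - ball (0::'a) a) + measure lborel (C' - ball (0::'a) c)) \<le> e" .
    qed
    finally show "interact W (indicator A) (indicator C) \<le> interact W (indicator (ball (0::'a) a)) (indicator (ball (0::'a) c)) + ennreal e"
      by (simp add: add_left_mono)
  qed
qed

text \<open>Truncation to the balls of radius \<open>n\<close> reduces to bounded sets. The
  truncated volumes belong to smaller balls, which are contained in the target balls, and monotone
  convergence removes the truncation.\<close>

theorem riesz_rearrangement_sets:
  fixes A C :: "'a::euclidean_space set"
  assumes W: "radial_kernel W" and fin: "(\<integral>\<^sup>+z. indicator (ball (0::'a) 1) z * W (norm z) \<partial>lborel) < \<infinity>" "W 1 < \<infinity>"
    and A: "A \<in> sets borel" "emeasure lborel A = emeasure lborel (ball (0::'a) a)" "0 \<le> a"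
    and C: "C \<in> sets borel" "emeasure lborel C = emeasure lborel (ball (0::'a) c)" "0 \<le> c"
  shows "interact W (indicator A) (indicator C) \<le> interact W (indicator (ball (0::'a) a)) (indicator (ball (0::'a) c))"
proof -
  note [measurable] = radial_kernelD(1)[OF W] A(1) C(1)
  have [measurable]: "cball (0::'a) r \<in> sets borel" for r by simp
  define f where "f n x y = (indicator (A \<inter> cball 0 (real n)) x * indicator (C \<inter> cball 0 (real n)) y * W (norm (x - y)))" for n and x y :: 'a
  have fmono: "f m x y \<le> f n x y" if "m \<le> n" for m n x y
    using that unfolding f_def by (intro mult_right_mono mult_mono) (auto simp: indicator_def)
  have fle: "f n x y \<le> indicator A x * indicator C y * W (norm (x - y))" for n x y
    unfolding f_def by (intro mult_right_mono mult_mono) (auto simp: indicator_def)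
  have SUPf: "(SUP n. f n x y) = indicator A x * indicator C y * W (norm (x - y))" for x y
  proof (rule antisym)
    obtain n where "norm x \<le> real n" "norm y \<le> real n"
      using real_arch_simple[of "max (norm x) (norm y)"] by auto
    then have "indicator A x * indicator C y * W (norm (x - y)) = f n x y"
      by (auto simp: f_def indicator_def)
    then show "indicator A x * indicator C y * W (norm (x - y)) \<le> (SUP n. f n x y)"
      by (metis SUP_upper UNIV_I)
  qed (rule SUP_least, rule fle)
  have fm[measurable]: "(\<lambda>(x,y). f n x y) \<in> borel_measurable (borel \<Otimes>\<^sub>M borel)" for n
    unfolding f_def by measurable
  have fm1[measurable]: "f n x \<in> borel_measurable borel" for n x
    unfolding f_def by measurable
  have "interact W (indicator A) (indicator C) = (\<integral>\<^sup>+x. (SUP n. \<integral>\<^sup>+y. f n x y \<partial>lborel) \<partial>lborel)"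
    unfolding interact_def SUPf[symmetric]
    by (intro nn_integral_cong nn_integral_monotone_convergence_SUP) (auto simp: incseq_def le_fun_def fmono)
  also have "\<dots> = (SUP n. \<integral>\<^sup>+x. \<integral>\<^sup>+y. f n x y \<partial>lborel \<partial>lborel)"
    by (intro nn_integral_monotone_convergence_SUP) (auto simp: incseq_def le_fun_def intro!: nn_integral_mono fmono)
  also have "\<dots> \<le> interact W (indicator (ball (0::'a) a)) (indicator (ball (0::'a) c))"
  proof (rule SUP_least)
    fix n
    have sub: "\<exists>r'\<ge>0. r' \<le> r \<and> emeasure lborel (D \<inter> cball 0 (real n)) = emeasure lborel (ball (0::'a) r')"
      if D: "D \<in> sets borel" "emeasure lborel D = emeasure lborel (ball (0::'a) r)" "0 \<le> r" for D :: "'a set" and r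
    proof -
      have "emeasure lborel (D \<inter> cball 0 (real n)) < \<infinity>"
        by (rule finite_emeasure_subset_cball[of _ "real n"]) auto
      from emeasure_eq_ball[OF this] obtain r' where r': "r' \<ge> 0" "emeasure lborel (D \<inter> cball 0 (real n)) = emeasure lborel (ball (0::'a) r')"
        by blast
      have "emeasure lborel (D \<inter> cball 0 (real n)) \<le> emeasure lborel D"
        by (rule emeasure_mono) (use D(1) in auto)
      then have "emeasure lborel (ball (0::'a) r') \<le> emeasure lborel (ball (0::'a) r)"
        by (simp only: r'(2) D(2))
      then have "r' ^ DIM('a) \<le> r ^ DIM('a)"
        using r' D by (simp add: emeasure_ball ennreal_le_iff)
      then have "r' \<le> r" using D(3) r'(1) by (simp add: power_mono_iff)
      then show ?thesis using r' by auto
    qed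
    obtain a' where a': "a' \<ge> 0" "a' \<le> a" "emeasure lborel (A \<inter> cball 0 (real n)) = emeasure lborel (ball (0::'a) a')"
      using sub[OF A] by auto
    obtain c' where c': "c' \<ge> 0" "c' \<le> c" "emeasure lborel (C \<inter> cball 0 (real n)) = emeasure lborel (ball (0::'a) c')"
      using sub[OF C] by auto
    have "(\<integral>\<^sup>+x. \<integral>\<^sup>+y. f n x y \<partial>lborel \<partial>lborel) = interact W (indicator (A \<inter> cball 0 (real n))) (indicator (C \<inter> cball 0 (real n)))"
      by (simp add: interact_def f_def)
    also have "\<dots> \<le> interact W (indicator (ball (0::'a) a')) (indicator (ball (0::'a) c'))"
      using a' c' A C by (intro riesz_rearrangement_bounded[OF W fin, where R="real n"]) auto
    also have "\<dots> \<le> interact W (indicator (ball (0::'a) a)) (indicator (ball (0::'a) c))"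
      using a' c' by (intro interact_mono) (auto simp: indicator_def)
    finally show "(\<integral>\<^sup>+x. \<integral>\<^sup>+y. f n x y \<partial>lborel \<partial>lborel) \<le> interact W (indicator (ball (0::'a) a)) (indicator (ball (0::'a) c))" .
  qed
  finally show ?thesis .
qed

section \<open>From sets to densities with values in the unit interval\<close>

lemma nn_integral_layer_cake:
  fixes g :: "'a::euclidean_space \<Rightarrow> real"
  assumes [measurable]: "g \<in> borel_measurable borel" "V \<in> borel_measurable borel" and g: "\<And>x. 0 \<le> g x" "\<And>x. g x \<le> 1"
  shows "(\<integral>\<^sup>+x. ennreal (g x) * V x \<partial>lborel) =
     (\<integral>\<^sup>+s. indicator {0<..<1} s * (\<integral>\<^sup>+x. indicator {x. s < g x} x * V x \<partial>lborel) \<partial>lborel)"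
proof -
  have 1: "ennreal (g x) = (\<integral>\<^sup>+s. indicator {0<..<1} s * indicator {x. s < g x} x \<partial>lborel)" for x
  proof -
    have "(\<integral>\<^sup>+s. indicator {0<..<1} s * indicator {x. s < g x} x \<partial>lborel) = (\<integral>\<^sup>+s. indicator {0<..<g x} s \<partial>lborel)"
      using g[of x] by (intro nn_integral_cong) (auto simp: indicator_def)
    then show ?thesis using g[of x] by simp
  qed
  have "(\<integral>\<^sup>+x. ennreal (g x) * V x \<partial>lborel) = (\<integral>\<^sup>+x. (\<integral>\<^sup>+s. indicator {0<..<1} s * indicator {x. s < g x} x * V x \<partial>lborel) \<partial>lborel)"
    unfolding 1 by (intro nn_integral_cong nn_integral_multc[symmetric]) measurable
  also have "\<dots> = (\<integral>\<^sup>+s. (\<integral>\<^sup>+x. indicator {0<..<1} s * indicator {x. s < g x} x * V x \<partial>lborel) \<partial>lborel)"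
    by (rule lborel_pair.Fubini') measurable
  also have "\<dots> = (\<integral>\<^sup>+s. indicator {0<..<1} s * (\<integral>\<^sup>+x. indicator {x. s < g x} x * V x \<partial>lborel) \<partial>lborel)"
    by (intro nn_integral_cong) (simp add: mult.assoc nn_integral_cmult)
  finally show ?thesis .
qed

text \<open>Here \<open>v\<close> is a Lagrange multiplier for the volume: \<open>V\<close> is at
  least \<open>v\<close> inside the ball and at most \<open>v\<close> outside. It lets
  \<open>A\<close> have any volume, and the additive form avoids subtraction in
  \<open>ennreal\<close>. The bound by \<open>K\<close> serves to show that \<open>v\<close> is
  finite.\<close>

lemma bathtub_set:
  fixes V :: "'a::euclidean_space \<Rightarrow> ennreal"
  assumes [measurable]: "V \<in> borel_measurable borel" and V: "\<And>x x'. norm x < norm x' \<Longrightarrow> V x' \<le> V x" and K: "\<And>x. V x \<le> K"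
  obtains v where "v \<le> K" "\<And>A. A \<in> sets borel \<Longrightarrow>
     (\<integral>\<^sup>+x. indicator A x * V x \<partial>lborel) + v * emeasure lborel (ball (0::'a) r)
       \<le> (\<integral>\<^sup>+x. indicator (ball (0::'a) r) x * V x \<partial>lborel) + v * emeasure lborel A"
proof (rule that)
  define v where "v = (SUP x\<in>{x. r \<le> norm x}. V x)"
  show "v \<le> K" unfolding v_def using K by (intro SUP_least) auto
  have out: "V x \<le> v" if "r \<le> norm x" for x unfolding v_def using that by (intro SUP_upper) auto
  have "in": "v \<le> V x" if "norm x < r" for x unfolding v_def using that by (intro SUP_least V) auto
  fix A :: "'a set" assume [measurable]: "A \<in> sets borel"
  have [measurable]: "ball (0::'a) r \<in> sets borel" by simp
  have "(\<integral>\<^sup>+x. indicator A x * V x + v * indicator (ball (0::'a) r) x \<partial>lborel) \<le> (\<integral>\<^sup>+x. indicator (ball (0::'a) r) x * V x + v * indicator A x \<partial>lborel)"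
    using out "in" by (intro nn_integral_mono) (auto simp: indicator_def not_less add.commute)
  then show "(\<integral>\<^sup>+x. indicator A x * V x \<partial>lborel) + v * emeasure lborel (ball (0::'a) r)
       \<le> (\<integral>\<^sup>+x. indicator (ball (0::'a) r) x * V x \<partial>lborel) + v * emeasure lborel A"
    by (simp add: nn_integral_add nn_integral_cmult)
qed


text \<open>The comparison is with the ball of the same mass and not with the symmetric decreasing
  rearrangement of \<open>g\<close>. Level sets are compared with balls of their own volume by
  Riesz's inequality, and averaging over the levels with the multiplier of
  \<open>bathtub_set\<close> replaces all these balls by the one of radius \<open>r\<close>.\<close>

theorem riesz_rearrangement_bathtub:
  fixes g :: "'a::euclidean_space \<Rightarrow> real"
  assumes W: "radial_kernel W" and fin: "(\<integral>\<^sup>+z. indicator (ball (0::'a) 1) z * W (norm z) \<partial>lborel) < \<infinity>"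
    and gm[measurable]: "g \<in> borel_measurable borel" and g: "\<And>x. 0 \<le> g x" "\<And>x. g x \<le> 1"
    and r: "0 \<le> r" "(\<integral>\<^sup>+x. ennreal (g x) \<partial>lborel) = emeasure lborel (ball (0::'a) r)"
  shows "interact W (\<lambda>x. ennreal (g x)) (\<lambda>x. ennreal (g x)) \<le> interact W (indicator (ball (0::'a) r)) (indicator (ball (0::'a) r))"
proof -
  \<comment> \<open>On the unit ball the kernel is at least \<open>W 1\<close>, so local
    integrability forces \<open>W 1\<close> to be finite.\<close>
  have fin1: "W 1 < \<infinity>"
  proof -
    have "W 1 * emeasure lborel (ball (0::'a) 1) = (\<integral>\<^sup>+z. W 1 * indicator (ball (0::'a) 1) z \<partial>lborel)"
      by (rule nn_integral_cmult_indicator[symmetric]) simp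
    also have "\<dots> \<le> (\<integral>\<^sup>+z. indicator (ball (0::'a) 1) z * W (norm z) \<partial>lborel)"
      by (intro nn_integral_mono) (auto simp: indicator_def intro!: radial_kernelD(2)[OF W])
    finally have "W 1 * emeasure lborel (ball (0::'a) 1) < \<infinity>" using fin by (rule le_less_trans)
    moreover have "emeasure lborel (ball (0::'a) 1) \<noteq> 0"
      using unit_ball_vol_pos[of "real DIM('a)"] by (simp add: emeasure_ball less_le)
    ultimately show ?thesis by (auto simp: ennreal_mult_less_top)
  qed
  define A where "A s = {x. s < g x}" for s
  have [measurable]: "A s \<in> sets borel" for s unfolding A_def by measurable
  define B where "B = ball (0::'a) r"
  have [measurable]: "B \<in> sets borel" by (simp add: B_def)
  have Bfin: "emeasure lborel B < \<infinity>" using emeasure_lborel_ball_finite[of "0::'a" r] by (simp add: B_def)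
  have cake: "(\<integral>\<^sup>+x. ennreal (g x) * V x \<partial>lborel) = (\<integral>\<^sup>+s. indicator {0<..<1} s * (\<integral>\<^sup>+x. indicator (A s) x * V x \<partial>lborel) \<partial>lborel)"
    if "V \<in> borel_measurable borel" for V
    unfolding A_def by (rule nn_integral_layer_cake) (use that g in auto)
  have cakeI: "interact W (\<lambda>x. ennreal (g x)) f = (\<integral>\<^sup>+s. indicator {0<..<1} s * interact W (indicator (A s)) f \<partial>lborel)"
    if [measurable]: "f \<in> borel_measurable borel" for f
    using cake[OF potential_measurable[OF W that]] by (simp add: interact_potential[OF W])
  have cakem: "(\<integral>\<^sup>+s. indicator {0<..<1} s * emeasure lborel (A s) \<partial>lborel) = emeasure lborel B"
    using cake[of "\<lambda>_. 1"] r by (simp add: B_def)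
  have meas: "(\<lambda>s. emeasure lborel (A s)) \<in> borel_measurable borel"
  proof -
    have "(\<lambda>s. \<integral>\<^sup>+x. indicator {x. s < g x} x \<partial>lborel) \<in> borel_measurable borel" by measurable
    then show ?thesis by (simp add: A_def[symmetric])
  qed
  have measI: "(\<lambda>s. interact W (indicator (A s)) f) \<in> borel_measurable borel" if [measurable]: "f \<in> borel_measurable borel" for f
  proof -
    note [measurable] = potential_measurable[OF W that]
    have "(\<lambda>s. \<integral>\<^sup>+x. indicator {x. s < g x} x * potential W f x \<partial>lborel) \<in> borel_measurable borel" by measurable
    then show ?thesis by (simp add: A_def[symmetric] interact_potential[OF W])
  qed
  \<comment> \<open>Chebyshev's inequality: positive levels have finite volume.\<close>
  have radius: "\<exists>a\<ge>0. emeasure lborel (A s) = emeasure lborel (ball (0::'a) a)" if s: "0 < s" for s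
  proof -
    have "ennreal s * emeasure lborel (A s) = (\<integral>\<^sup>+x. ennreal s * indicator (A s) x \<partial>lborel)"
      by (simp add: nn_integral_cmult)
    also have "\<dots> \<le> (\<integral>\<^sup>+x. ennreal (g x) \<partial>lborel)"
      using g by (intro nn_integral_mono) (auto simp: indicator_def A_def intro!: ennreal_leI)
    also have "\<dots> < \<infinity>" using r Bfin by (simp add: B_def)
    finally have "emeasure lborel (A s) < \<infinity>" using s by (auto simp: ennreal_mult_less_top)
    then show ?thesis by (rule emeasure_eq_ball)
  qed
  \<comment> \<open>Replaces the first factor \<open>g\<close> by \<open>B\<close>. The volumes of
    the level sets average to that of \<open>B\<close>, so the multiplier terms cancel after
    integration over \<open>s\<close>.\<close>
  have stage: "interact W (\<lambda>x. ennreal (g x)) f \<le> interact W (indicator B) (indicator (ball (0::'a) c))"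
    if f[measurable]: "f \<in> borel_measurable borel"
      and le: "\<And>s a. 0 < s \<Longrightarrow> 0 \<le> a \<Longrightarrow> emeasure lborel (A s) = emeasure lborel (ball (0::'a) a)
           \<Longrightarrow> interact W (indicator (A s)) f \<le> interact W (indicator (ball (0::'a) a)) (indicator (ball (0::'a) c))" for f c
  proof -
    define V where "V = potential W (indicator (ball (0::'a) c))"
    have [measurable]: "V \<in> borel_measurable borel" unfolding V_def by (rule potential_measurable[OF W], rule borel_measurable_indicator) simp
    have IV: "(\<integral>\<^sup>+x. indicator D x * V x \<partial>lborel) = interact W (indicator D) (indicator (ball (0::'a) c))" if "D \<in> sets borel" for D
      unfolding V_def by (rule interact_potential[OF W, symmetric]) (use that in \<open>auto intro!: borel_measurable_indicator\<close>)
    define K where "K = (\<integral>\<^sup>+z. indicator (ball (0::'a) 1) z * W (norm z) \<partial>lborel) + W 1 * emeasure lborel (ball (0::'a) c)"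
    have K: "K < \<infinity>" unfolding K_def using fin fin1 emeasure_lborel_ball_finite[of "0::'a" c] by (auto simp: ennreal_mult_less_top)
    obtain v where v: "v \<le> K" "\<And>D. D \<in> sets borel \<Longrightarrow>
     (\<integral>\<^sup>+x. indicator D x * V x \<partial>lborel) + v * emeasure lborel (ball (0::'a) r)
       \<le> (\<integral>\<^sup>+x. indicator (ball (0::'a) r) x * V x \<partial>lborel) + v * emeasure lborel D"
      by (rule bathtub_set[of V K r])
         (auto simp: V_def K_def intro!: potential_ball_antimono[OF W] potential_indicator_le[OF W] potential_measurable[OF W] borel_measurable_indicator)
    have vfin: "v < \<infinity>" using v(1) K by (rule le_less_trans)
    define e where "e = v * emeasure lborel B"
    have efin: "e \<noteq> \<infinity>" using vfin Bfin by (auto simp: e_def ennreal_mult_eq_top_iff)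
    have pt: "interact W (indicator (A s)) f + e \<le> interact W (indicator B) (indicator (ball (0::'a) c)) + v * emeasure lborel (A s)" if s: "0 < s" for s
    proof -
      obtain a where a: "a \<ge> 0" "emeasure lborel (A s) = emeasure lborel (ball (0::'a) a)" using radius[OF s] by auto
      have "interact W (indicator (A s)) f + e \<le> interact W (indicator (ball (0::'a) a)) (indicator (ball (0::'a) c)) + e"
        by (intro add_right_mono le s a)
      also have "\<dots> \<le> interact W (indicator B) (indicator (ball (0::'a) c)) + v * emeasure lborel (ball (0::'a) a)"
        using v(2)[of "ball (0::'a) a"] IV by (simp add: B_def e_def)
      finally show ?thesis using a by simp
    qed
    have one: "(\<integral>\<^sup>+s. indicator {0<..<1::real} s * x \<partial>lborel) = x" for x :: ennreal
      by (simp add: nn_integral_multc emeasure_lborel_Ioo[of "0::real" 1])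
    have "interact W (\<lambda>x. ennreal (g x)) f + e = (\<integral>\<^sup>+s. indicator {0<..<1} s * interact W (indicator (A s)) f + indicator {0<..<1} s * e \<partial>lborel)"
      unfolding cakeI[OF f] using measI[OF f] by (subst nn_integral_add) (simp_all add: one)
    also have "\<dots> \<le> (\<integral>\<^sup>+s. indicator {0<..<1} s * interact W (indicator B) (indicator (ball (0::'a) c)) + v * (indicator {0<..<1} s * emeasure lborel (A s)) \<partial>lborel)"
      using pt by (intro nn_integral_mono) (auto simp: indicator_def)
    also have "\<dots> = interact W (indicator B) (indicator (ball (0::'a) c)) + e"
      using meas by (subst nn_integral_add) (simp_all add: one nn_integral_cmult cakem e_def)
    finally show ?thesis using efin by (simp add: ennreal_add_left_cancel_le add.commute[of _ e])
  qed
  have gm': "(\<lambda>x. ennreal (g x)) \<in> borel_measurable borel" by measurable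
  have "interact W (\<lambda>x. ennreal (g x)) (\<lambda>x. ennreal (g x)) \<le> interact W (indicator B) (indicator (ball (0::'a) r))"
  proof (rule stage[OF gm'])
    \<comment> \<open>With a level set of one factor fixed, a second use of \<open>stage\<close>
      replaces the other factor; Riesz's inequality then concerns two level sets.\<close>
    fix s a :: real assume s: "0 < s" and a: "0 \<le> a" "emeasure lborel (A s) = emeasure lborel (ball (0::'a) a)"
    have "interact W (indicator (A s)) (\<lambda>x. ennreal (g x)) = interact W (\<lambda>x. ennreal (g x)) (indicator (A s))"
      by (rule interact_commute[OF W]) measurable
    also have "\<dots> \<le> interact W (indicator B) (indicator (ball (0::'a) a))"
    proof (rule stage)
      fix s' a' :: real assume s': "0 < s'" and a': "0 \<le> a'" "emeasure lborel (A s') = emeasure lborel (ball (0::'a) a')"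
      show "interact W (indicator (A s')) (indicator (A s)) \<le> interact W (indicator (ball (0::'a) a')) (indicator (ball (0::'a) a))"
        by (rule riesz_rearrangement_sets[OF W fin fin1 _ a'(2,1) _ a(2,1)]) measurable
    qed measurable
    also have "\<dots> = interact W (indicator (ball (0::'a) a)) (indicator (ball (0::'a) r))"
      unfolding B_def by (intro interact_commute[OF W] borel_measurable_indicator) auto
    finally show "interact W (indicator (A s)) (\<lambda>x. ennreal (g x)) \<le> interact W (indicator (ball (0::'a) a)) (indicator (ball (0::'a) r))" .
  qed
  then show ?thesis by (simp add: B_def)
qed

section \<open>Minimising \<open>P (t\<^sup>p + (1 - t)\<^sup>p) - Q (t\<^sup>q + (1 - t)\<^sup>q)\<close>\<close>

text \<open>Up to the factor \<open>- p\<close>, \<open>powr_gap (p - 1)\<close> is the derivative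
  of \<open>t powr p + (1 - t) powr p\<close>.\<close>

definition powr_gap :: "real \<Rightarrow> real \<Rightarrow> real" where
  "powr_gap a t = (1 - t) powr a - t powr a"

lemma sinh_less_mult_cosh:
  fixes z :: real
  assumes "0 < z" shows "sinh z < z * cosh z"
proof -
  have "0 * cosh 0 - sinh 0 < z * cosh z - sinh z"
  proof (rule DERIV_pos_imp_increasing_open[OF assms, of "\<lambda>z. z * cosh z - sinh z"])
    show "continuous_on {0..z} (\<lambda>z. z * cosh z - sinh z)" by (intro continuous_intros)
    fix x :: real assume x: "0 < x" "x < z" 
    show "\<exists>y. ((\<lambda>z. z * cosh z - sinh z) has_real_derivative y) (at x) \<and> y > 0"
      using x by (intro exI[of _ "x * sinh x"]) (auto intro!: derivative_eq_intros)
  qed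
  then show ?thesis by simp
qed

text \<open>The left side is the derivative of \<open>\<beta> * coth (\<beta> * y)\<close> in
  \<beta>, written with \<open>z = \<beta> * y\<close>. Since
  \<open>coth z - tanh z = 1 / (sinh z * cosh z)\<close>, the claim for \<open>y = z\<close> is
  \<open>tanh z < z\<close>.\<close>

lemma coth_minus_tanh_less:
  fixes z y :: real
  assumes "0 < z" "z \<le> y"
  shows "cosh z / sinh z - z / (sinh z)\<^sup>2 < tanh y"
proof -
  have s: "sinh z > 0" "cosh z > 0" using assms by (auto intro: cosh_real_pos)
  have "cosh z / sinh z - sinh z / cosh z = 1 / (sinh z * cosh z)"
    using s cosh_square_eq[of z] by (simp add: field_simps power2_eq_square)
  also have "\<dots> = sinh z / ((sinh z)\<^sup>2 * cosh z)" using s by (simp add: field_simps power2_eq_square)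
  also have "\<dots> < z * cosh z / ((sinh z)\<^sup>2 * cosh z)"
    using s sinh_less_mult_cosh[OF assms(1)] by (intro divide_strict_right_mono) auto
  also have "\<dots> = z / (sinh z)\<^sup>2" using s by simp
  finally have "cosh z / sinh z - z / (sinh z)\<^sup>2 < tanh z" by (simp add: tanh_def)
  also have "tanh z \<le> tanh y" using assms(2) by simp
  finally show ?thesis .
qed

text \<open>The function of \<beta> compared here is the logarithmic derivative in \<open>y\<close>
  of \<open>sinh (\<beta> * y) / cosh y powr \<beta>\<close>. The bound \<open>b \<le> 1\<close>
  guarantees \<open>\<beta> * y \<le> y\<close>, as the preceding estimate requires.\<close>

lemma coth_scaled_strict_decreasing:
  fixes y a b :: real
  assumes "0 < y" "0 < a" "a < b" "b \<le> 1"
  shows "b * (cosh (b * y) / sinh (b * y)) - b * tanh y < a * (cosh (a * y) / sinh (a * y)) - a * tanh y"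
proof -
  let ?\<psi> = "\<lambda>\<beta>. \<beta> * (cosh (\<beta> * y) / sinh (\<beta> * y)) - \<beta> * tanh y"
  show "?\<psi> b < ?\<psi> a"
  proof (rule DERIV_neg_imp_decreasing[OF assms(3)])
    fix x assume x: "a \<le> x" "x \<le> b"
    have xy: "0 < x * y" "x * y \<le> y" using x assms by (auto simp: mult_le_cancel_right1)
    have "sinh (x * y) > 0" using xy(1) by simp
    then have s: "sinh (x * y) \<noteq> 0" by linarith
    have "(?\<psi> has_real_derivative
       (1 * (cosh (x * y) / sinh (x * y)) + ((sinh (x * y) * y) * sinh (x * y) - cosh (x * y) * (cosh (x * y) * y)) / (sinh (x * y) * sinh (x * y)) * x - tanh y)) (at x)"
      using s by (auto intro!: derivative_eq_intros simp: field_simps)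
    moreover have "(sinh (x * y) * y) * sinh (x * y) - cosh (x * y) * (cosh (x * y) * y) = - y"
      using cosh_square_eq[of "x * y"] by (simp add: power2_eq_square algebra_simps)
    ultimately have "(?\<psi> has_real_derivative (cosh (x * y) / sinh (x * y) - x * y / (sinh (x * y))\<^sup>2 - tanh y)) (at x)"
      by (simp add: power2_eq_square mult.commute)
    then show "\<exists>D. (?\<psi> has_real_derivative D) (at x) \<and> D < 0"
      using coth_minus_tanh_less[OF xy] by (intro exI conjI) auto
  qed
qed

lemma powr_gap_pos: "0 \<le> t \<Longrightarrow> t < 1/2 \<Longrightarrow> 0 < a \<Longrightarrow> 0 < powr_gap a t"
  unfolding powr_gap_def by (simp add: powr_less_mono2)

text \<open>In the variable \<open>y = ln ((1 - t) / t) / 2\<close> the gaps become hyperbolic sines.\<close>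
lemma powr_gap_sinh:
  assumes y: "y = ln ((1 - t) / t) / 2" and t: "0 < t" "t < 1/2"
  shows "powr_gap a t = 2 * sinh (a * y) / (2 * cosh y) powr a" "0 < y"
proof -
  have q: "(1 - t) / t > 1" using t by (simp add: field_simps)
  then have "ln ((1 - t) / t) > 0" by (rule ln_gt_zero)
  then show "0 < y" unfolding y by simp
  have "2 * y = ln ((1 - t) / t)" using y by simp
  moreover have "(1 - t) / t > 0" using q by linarith
  ultimately have e2: "exp (2 * y) = (1 - t) / t" by (simp only: exp_ln)
  have c: "2 * cosh y = exp y + exp (- y)" by (simp add: cosh_def)
  have c0: "2 * cosh y > 0" by (simp add: cosh_real_pos)
  have ey: "exp y * exp y = (1 - t) / t" using e2 by (simp add: exp_double power2_eq_square)
  have 1: "1 - t = exp y / (2 * cosh y)"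
  proof -
    have "(1 - t) * (exp y + exp (- y)) * exp y = exp y * exp y"
      using t ey by (simp add: algebra_simps exp_minus) (simp add: field_simps)
    then have "(1 - t) * (exp y + exp (- y)) = exp y" by simp
    then show ?thesis using c0 unfolding c by (simp add: field_simps)
  qed
  have 2: "t = exp (- y) / (2 * cosh y)"
    using 1 c0 unfolding c by (simp add: field_simps)
  have "(1 - t) powr a = exp (a * y) / (2 * cosh y) powr a"
    using c0 by (subst 1) (simp add: powr_divide exp_powr_real mult.commute)
  moreover have "t powr a = exp (- (a * y)) / (2 * cosh y) powr a"
    using c0 by (subst 2) (simp add: powr_divide exp_powr_real mult.commute)
  ultimately show "powr_gap a t = 2 * sinh (a * y) / (2 * cosh y) powr a"
    by (simp add: powr_gap_def sinh_def diff_divide_distrib)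
qed

text \<open>This is the logarithm of the quotient of two gaps in the hyperbolic variable, up to an
  additive constant; its derivative is negative by
  \<open>coth_scaled_strict_decreasing\<close>.\<close>

lemma sinh_ratio_strict_decreasing:
  fixes a b y z :: real
  assumes "0 < a" "a < b" "b \<le> 1" "0 < y" "y < z"
  shows "ln (sinh (b * z)) - ln (sinh (a * z)) - (b - a) * ln (cosh z)
       < ln (sinh (b * y)) - ln (sinh (a * y)) - (b - a) * ln (cosh y)"
proof (rule DERIV_neg_imp_decreasing[OF assms(5)])
  fix x assume x: "y \<le> x" "x \<le> z"
  have x0: "0 < x" using x assms by simp
  have s: "sinh (b * x) > 0" "sinh (a * x) > 0" "cosh x > 0" using x0 assms by (auto intro: cosh_real_pos)
  have "((\<lambda>x. ln (sinh (b * x)) - ln (sinh (a * x)) - (b - a) * ln (cosh x)) has_real_derivative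
     (cosh (b * x) * b / sinh (b * x) - cosh (a * x) * a / sinh (a * x) - (b - a) * (sinh x / cosh x))) (at x)"
    using s by (auto intro!: derivative_eq_intros simp: field_simps)
  moreover have "cosh (b * x) * b / sinh (b * x) - cosh (a * x) * a / sinh (a * x) - (b - a) * (sinh x / cosh x) < 0"
  proof -
    have "cosh (b * x) * b / sinh (b * x) = b * (cosh (b * x) / sinh (b * x))"
      "cosh (a * x) * a / sinh (a * x) = a * (cosh (a * x) / sinh (a * x))"
      "(b - a) * (sinh x / cosh x) = b * tanh x - a * tanh x"
      by (simp_all add: tanh_def left_diff_distrib diff_divide_distrib)
    then show ?thesis using coth_scaled_strict_decreasing[OF x0 assms(1,2,3)] by linarith
  qed
  ultimately show "\<exists>D. ((\<lambda>x. ln (sinh (b * x)) - ln (sinh (a * x)) - (b - a) * ln (cosh x)) has_real_derivative D) (at x) \<and> D < 0"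
    by blast
qed

lemma powr_gap_ratio_less_aux:
  assumes ab: "0 < a" "a < b" "b \<le> 1" and t: "0 < t" "t < t'" "t' < 1/2"
  shows "powr_gap b t / powr_gap a t < powr_gap b t' / powr_gap a t'"
proof -
  \<comment> \<open>Larger \<open>t\<close> means smaller hyperbolic variable, so a decrease in
    \<open>y\<close> is an increase in \<open>t\<close>.\<close>
  define y z where "y = ln ((1 - t') / t') / 2" and "z = ln ((1 - t) / t) / 2"
  have r: "ln (powr_gap b x / powr_gap a x) =
     ln (sinh (b * w)) - ln (sinh (a * w)) - (b - a) * ln (cosh w) - (b - a) * ln 2"
    if w: "w = ln ((1 - x) / x) / 2" and x: "0 < x" "x < 1/2" for w x
  proof -
    note g = powr_gap_sinh[OF w x]
    have s: "sinh (b * w) > 0" "sinh (a * w) > 0" "cosh w > 0" using g(2) ab by (auto intro: cosh_real_pos)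
    have L: "ln (powr_gap c x) = ln 2 + ln (sinh (c * w)) - c * (ln 2 + ln (cosh w))" if "c > 0" for c
    proof -
      have "sinh (c * w) > 0" using g(2) that by simp
      then show ?thesis unfolding g(1) using s g(2) that by (simp add: ln_div ln_mult ln_powr)
    qed
    have "powr_gap a x > 0" "powr_gap b x > 0" using ab x by (auto intro!: powr_gap_pos)
    then have "ln (powr_gap b x / powr_gap a x) = ln (powr_gap b x) - ln (powr_gap a x)"
      by (simp add: ln_div)
    moreover have "0 < b" using ab by simp
    ultimately show ?thesis unfolding L[OF ab(1)] L[OF \<open>0 < b\<close>] by (simp add: algebra_simps)
  qed
  have "(1 - t') / t' < (1 - t) / t" using t by (simp add: field_simps)
  then have "y < z" unfolding y_def z_def using t by simp
  moreover have "0 < y" using powr_gap_sinh(2)[OF y_def] t by auto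
  ultimately have "ln (powr_gap b t / powr_gap a t) < ln (powr_gap b t' / powr_gap a t')"
    using sinh_ratio_strict_decreasing[OF ab, of y z] r[OF y_def] r[OF z_def] t by simp
  then show ?thesis
    using powr_gap_pos[of t a] powr_gap_pos[of t b] powr_gap_pos[of t' a] powr_gap_pos[of t' b] ab t by simp
qed

lemma continuous_on_powr_gap: "0 < a \<Longrightarrow> continuous_on {0..1/2} (powr_gap a)"
  unfolding powr_gap_def[abs_def] by (intro continuous_intros continuous_on_powr') auto

text \<open>At \<open>t = 0\<close> the hyperbolic variable is infinite. This endpoint is added by
  continuity, and comparing through \<open>t' / 2\<close> keeps the inequality strict.\<close>

lemma powr_gap_ratio_less:
  assumes ab: "0 < a" "a < b" "b \<le> 1" and t: "0 \<le> t" "t < t'" "t' < 1/2"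
  shows "powr_gap b t / powr_gap a t < powr_gap b t' / powr_gap a t'"
proof (cases "t = 0")
  case True
  let ?R = "\<lambda>t. powr_gap b t / powr_gap a t"
  have "continuous_on {0..t'} ?R"
    using ab t powr_gap_pos[of _ a]
    by (intro continuous_on_divide continuous_on_subset[OF continuous_on_powr_gap]) (auto simp: less_le_trans, force)
  then have "(?R \<longlongrightarrow> ?R 0) (at 0 within {0..t'})" using t True by (auto simp: continuous_on_def)
  then have lim: "(?R \<longlongrightarrow> ?R 0) (at_right 0)"
    using t True by (simp add: at_within_Icc_at_right)
  have "?R 0 \<le> ?R (t' / 2)"
  proof (rule tendsto_upperbound[OF lim])
    have "\<forall>\<^sub>F x in at_right 0. x \<in> {0<..<t' / 2}" using t True by (intro eventually_at_right_real) auto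
    then show "\<forall>\<^sub>F x in at_right 0. ?R x \<le> ?R (t' / 2)"
      by eventually_elim (use powr_gap_ratio_less_aux[OF ab, of _ "t'/2"] t in \<open>auto intro: less_imp_le\<close>)
  qed simp
  also have "\<dots> < ?R t'" using t True by (intro powr_gap_ratio_less_aux ab) auto
  finally show ?thesis using True by simp
qed (use powr_gap_ratio_less_aux assms in auto)

section \<open>Shape of the reduced energy between \<open>t = 0\<close> and
  \<open>t = 1/2\<close>\<close>

definition powr_sum :: "real \<Rightarrow> real \<Rightarrow> real" where
  "powr_sum p t = t powr p + (1 - t) powr p"

lemma continuous_on_powr_sum: "0 < p \<Longrightarrow> continuous_on {0..1/2} (powr_sum p)"
  unfolding powr_sum_def[abs_def] by (intro continuous_intros continuous_on_powr') auto

lemma powr_sum_deriv: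
  assumes "0 < t" "t < 1"
  shows "(powr_sum p has_real_derivative (- p * powr_gap (p - 1) t)) (at t)"
  unfolding powr_sum_def[abs_def] powr_gap_def using assms
  by (auto intro!: derivative_eq_intros simp: algebra_simps)

lemma powr_sum_diff_deriv:
  assumes "0 < t" "t < 1"
  shows "((\<lambda>t. P * powr_sum p t - Q * powr_sum q t) has_real_derivative
     (Q * q * powr_gap (q - 1) t - P * p * powr_gap (p - 1) t)) (at t)"
  using assms by (auto intro!: derivative_eq_intros powr_sum_deriv simp: algebra_simps)

lemma powr_sum_diff_less:
  assumes st: "0 \<le> s" "s < t" "t \<le> 1/2" and pq: "0 < p" "0 < q"
    and pos: "\<And>x. s < x \<Longrightarrow> x < t \<Longrightarrow> P * p * powr_gap (p - 1) x < Q * q * powr_gap (q - 1) x"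
  shows "P * powr_sum p s - Q * powr_sum q s < P * powr_sum p t - Q * powr_sum q t"
proof (rule DERIV_pos_imp_increasing_open[OF st(2)])
  show "continuous_on {s..t} (\<lambda>t. P * powr_sum p t - Q * powr_sum q t)"
    using st pq by (intro continuous_intros continuous_on_subset[OF continuous_on_powr_sum]) auto
  fix x assume "s < x" "x < t"
  then show "\<exists>y. ((\<lambda>t. P * powr_sum p t - Q * powr_sum q t) has_real_derivative y) (at x) \<and> 0 < y"
    using powr_sum_diff_deriv[of x P p Q q] pos[of x] st by (intro exI conjI) auto
qed

lemma powr_sum_diff_greater:
  assumes st: "0 \<le> s" "s < t" "t \<le> 1/2" and pq: "0 < p" "0 < q"
    and pos: "\<And>x. s < x \<Longrightarrow> x < t \<Longrightarrow> Q * q * powr_gap (q - 1) x < P * p * powr_gap (p - 1) x"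
  shows "P * powr_sum p t - Q * powr_sum q t < P * powr_sum p s - Q * powr_sum q s"
  using powr_sum_diff_less[OF st pq(2,1), of Q P] pos by simp

text \<open>The derivative is positive while the gap ratio is below \<open>?c\<close> and negative
  once it is above. As the ratio increases, the function rises and then falls, so every interior
  value exceeds the value at one of the endpoints.\<close>

lemma powr_sum_diff_first_order_aux:
  assumes pq: "1 < q" "q < p" "p \<le> 2" and PQ: "0 < P" "0 < Q" and t: "0 < t" "t < 1/2"
  shows "min (P * powr_sum p 0 - Q * powr_sum q 0) (P * powr_sum p (1/2) - Q * powr_sum q (1/2))
     < P * powr_sum p t - Q * powr_sum q t"
proof -
  let ?R = "\<lambda>t. powr_gap (p - 1) t / powr_gap (q - 1) t" and ?c = "Q * q / (P * p)"
  have R: "?R x < ?R x'" if "0 \<le> x" "x < x'" "x' < 1/2" for x x'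
    using that pq by (intro powr_gap_ratio_less) auto
  have g: "powr_gap (q - 1) x > 0" if "0 \<le> x" "x < 1/2" for x using that pq by (intro powr_gap_pos) auto
  show ?thesis
  proof (cases "?R t \<le> ?c")
    case True
    have "P * powr_sum p 0 - Q * powr_sum q 0 < P * powr_sum p t - Q * powr_sum q t"
    proof (rule powr_sum_diff_less)
      fix x assume x: "0 < x" "x < t"
      then have "?R x < ?c" using R[of x t] t True by simp
      then show "P * p * powr_gap (p - 1) x < Q * q * powr_gap (q - 1) x"
        using g[of x] x t PQ pq by (simp add: field_simps)
    qed (use t pq in auto)
    then show ?thesis by simp
  next
    case False
    have "P * powr_sum p (1/2) - Q * powr_sum q (1/2) < P * powr_sum p t - Q * powr_sum q t"
    proof (rule powr_sum_diff_greater)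
      fix x assume x: "t < x" "x < 1/2"
      then have "?c < ?R x" using R[of t x] t False by simp
      then show "Q * q * powr_gap (q - 1) x < P * p * powr_gap (p - 1) x"
        using g[of x] x t PQ pq by (simp add: field_simps)
    qed (use t pq in auto)
    then show ?thesis by simp
  qed
qed

text \<open>The cubic case (dimension one) reduces to the quadratic one, as \<open>t\<^sup>3 + (1 - t)\<^sup>3\<close> is an affine
  function of \<open>t\<^sup>2 + (1 - t)\<^sup>2\<close>.\<close>
lemma powr_sum_diff_first_order:
  assumes pq: "1 < q" "q < p" "p \<le> 2 \<or> p = 3 \<and> q < 2" and PQ: "0 < P" "0 < Q" and t: "0 < t" "t < 1/2"
  shows "min (P * powr_sum p 0 - Q * powr_sum q 0) (P * powr_sum p (1/2) - Q * powr_sum q (1/2))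
     < P * powr_sum p t - Q * powr_sum q t"
proof (cases "p \<le> 2")
  case True then show ?thesis using assms by (intro powr_sum_diff_first_order_aux) auto
next
  case False
  then have p: "p = 3" "q < 2" using pq by auto
  have cubic: "powr_sum 3 x = (3 * powr_sum 2 x - 1) / 2" if "0 \<le> x" "x \<le> 1/2" for x :: real
  proof -
    have "powr_sum 3 x = x ^ 3 + (1 - x) ^ 3" "powr_sum 2 x = x ^ 2 + (1 - x) ^ 2"
      using that by (simp_all add: powr_sum_def powr_numeral)
    then show ?thesis by (simp add: power2_eq_square power3_eq_cube algebra_simps)
  qed
  have "P * powr_sum p x - Q * powr_sum q x = (3 / 2 * P) * powr_sum 2 x - Q * powr_sum q x - P / 2" if "0 \<le> x" "x \<le> 1/2" for x
    unfolding p(1) cubic[OF that] by (simp add: field_simps)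
  moreover have "min (3/2 * P * powr_sum 2 0 - Q * powr_sum q 0) (3/2 * P * powr_sum 2 (1/2) - Q * powr_sum q (1/2))
     < 3/2 * P * powr_sum 2 t - Q * powr_sum q t"
    using p pq PQ t by (intro powr_sum_diff_first_order_aux) auto
  ultimately show ?thesis using t by (simp add: min_def split: if_splits)
qed

text \<open>Both gaps vanish at \<open>1/2\<close>, so the limit is the quotient of their
  derivatives there. It is the source of \<open>rho_c_min\<close>.\<close>

lemma powr_gap_ratio_tendsto:
  assumes "0 < a" "0 < b"
  shows "((\<lambda>t. powr_gap b t / powr_gap a t) \<longlongrightarrow> b / a * 2 powr (a - b)) (at_left (1/2))"
proof -
  have d: "(powr_gap c has_real_derivative (- 2 * c * (1/2) powr (c - 1))) (at (1/2))" for c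
    unfolding powr_gap_def[abs_def] by (auto intro!: derivative_eq_intros)
  have l: "((\<lambda>t. powr_gap c t / (t - 1/2)) \<longlongrightarrow> - 2 * c * (1/2) powr (c - 1)) (at (1/2))" for c
    using d[of c] by (simp add: has_field_derivative_iff powr_gap_def)
  have "((\<lambda>t. (powr_gap b t / (t - 1/2)) / (powr_gap a t / (t - 1/2))) \<longlongrightarrow>
      (- 2 * b * (1/2) powr (b - 1)) / (- 2 * a * (1/2) powr (a - 1))) (at (1/2))"
    using assms by (intro tendsto_divide l) auto
  also have "(- 2 * b * (1/2) powr (b - 1)) / (- 2 * a * (1/2) powr (a - 1)) = b / a * ((1/2) powr (b - 1) / (1/2) powr (a - 1))"
    by simp
  also have "(1/2::real) powr (b - 1) / (1/2) powr (a - 1) = 2 powr (a - b)"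
    by (simp add: powr_diff[symmetric] powr_divide powr_minus_divide[symmetric] del: powr_minus_divide)
  finally have "((\<lambda>t. (powr_gap b t / (t - 1/2)) / (powr_gap a t / (t - 1/2))) \<longlongrightarrow> b / a * 2 powr (a - b)) (at_left (1/2))"
    by (rule tendsto_mono[OF at_le[OF subset_UNIV]])
  moreover have "\<forall>\<^sub>F t in at_left (1/2). (powr_gap b t / (t - 1/2)) / (powr_gap a t / (t - 1/2)) = powr_gap b t / powr_gap a t"
    by (auto simp: eventually_at_filter)
  ultimately show ?thesis by (rule Lim_transform_eventually)
qed

lemma powr_gap_ratio_upper:
  assumes ab: "0 < a" "a < b" "b \<le> 1" and t: "0 \<le> t" "t < 1/2"
  shows "powr_gap b t / powr_gap a t < b / a * 2 powr (a - b)"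
proof -
  let ?R = "\<lambda>t. powr_gap b t / powr_gap a t"
  \<comment> \<open>The intermediate point preserves strictness when the limit is taken.\<close>
  define t' where "t' = (t + 1/2) / 2"
  have t': "t < t'" "t' < 1/2" using t by (auto simp: t'_def)
  have "?R t < ?R t'" using t t' by (intro powr_gap_ratio_less ab) auto
  also have "?R t' \<le> b / a * 2 powr (a - b)"
  proof (rule tendsto_lowerbound)
    show "(?R \<longlongrightarrow> b / a * 2 powr (a - b)) (at_left (1/2))" using ab by (intro powr_gap_ratio_tendsto) auto
    have "\<forall>\<^sub>F x in at_left (1/2). x \<in> {t'<..<1/2}" using t' by (intro eventually_at_left_real) auto
    then show "\<forall>\<^sub>F x in at_left (1/2). ?R t' \<le> ?R x"
      by eventually_elim (use powr_gap_ratio_less[OF ab, of t'] t t' in \<open>auto intro: less_imp_le\<close>)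
  qed simp
  finally show ?thesis .
qed

text \<open>The gap ratio is 1 at 0 and increases, so \<open>P * p \<le> Q * q\<close> makes the
  derivative positive everywhere. This is the ferromagnetic regime.\<close>

lemma powr_sum_diff_min_left:
  assumes pq: "1 < p" "p < q" "q \<le> 2" and PQ: "0 < P" "P * p \<le> Q * q" and t: "0 < t" "t \<le> 1/2"
  shows "P * powr_sum p 0 - Q * powr_sum q 0 < P * powr_sum p t - Q * powr_sum q t"
proof (rule powr_sum_diff_less)
  fix x assume x: "0 < x" "x < t"
  have g: "powr_gap (p - 1) x > 0" using x t pq by (intro powr_gap_pos) auto
  have "powr_gap (q - 1) 0 / powr_gap (p - 1) 0 < powr_gap (q - 1) x / powr_gap (p - 1) x"
    using x t pq by (intro powr_gap_ratio_less) auto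
  then have "powr_gap (p - 1) x < powr_gap (q - 1) x" using g by (simp add: powr_gap_def)
  then have "P * p * powr_gap (p - 1) x < P * p * powr_gap (q - 1) x" using PQ pq by simp
  also have "\<dots> \<le> Q * q * powr_gap (q - 1) x"
    using PQ(2) g \<open>powr_gap (p - 1) x < powr_gap (q - 1) x\<close> by (intro mult_right_mono) auto
  finally show "P * p * powr_gap (p - 1) x < Q * q * powr_gap (q - 1) x" .
qed (use assms in auto)

text \<open>The gap ratio stays below its limit at \<open>1/2\<close>, so the assumption makes the
  derivative negative everywhere. This is the paramagnetic regime.\<close>

lemma powr_sum_diff_min_right:
  assumes pq: "1 < p" "p < q" "q \<le> 2" and PQ: "0 < Q" "Q * q * ((q - 1) / (p - 1) * 2 powr (p - q)) \<le> P * p"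
    and t: "0 \<le> t" "t < 1/2"
  shows "P * powr_sum p (1/2) - Q * powr_sum q (1/2) < P * powr_sum p t - Q * powr_sum q t"
proof (rule powr_sum_diff_greater)
  fix x assume x: "t < x" "x < 1/2"
  have g: "powr_gap (p - 1) x > 0" using x t pq by (intro powr_gap_pos) auto
  have "powr_gap (q - 1) x / powr_gap (p - 1) x < (q - 1) / (p - 1) * 2 powr ((p - 1) - (q - 1))"
    using x t pq by (intro powr_gap_ratio_upper) auto
  then have "powr_gap (q - 1) x < (q - 1) / (p - 1) * 2 powr (p - q) * powr_gap (p - 1) x"
    using g by (simp add: pos_divide_less_eq)
  then have "Q * q * powr_gap (q - 1) x < Q * q * ((q - 1) / (p - 1) * 2 powr (p - q) * powr_gap (p - 1) x)"
    by (rule mult_strict_left_mono) (use PQ pq in auto)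
  also have "\<dots> = Q * q * ((q - 1) / (p - 1) * 2 powr (p - q)) * powr_gap (p - 1) x" by simp
  also have "\<dots> \<le> P * p * powr_gap (p - 1) x" using PQ g by (intro mult_right_mono) auto
  finally show "Q * q * powr_gap (q - 1) x < P * p * powr_gap (p - 1) x" .
qed (use assms in auto)

text \<open>Between the two extreme values the gap ratio crosses \<open>?c\<close> exactly once. The
  derivative is negative before the crossing and positive after it.\<close>

lemma powr_sum_diff_min_middle:
  assumes pq: "1 < p" "p < q" "q \<le> 2" and PQ: "0 < Q" "Q * q < P * p" "P * p < Q * q * ((q - 1) / (p - 1) * 2 powr (p - q))"
  obtains t where "0 < t" "t < 1/2"
    "\<And>x. 0 \<le> x \<Longrightarrow> x \<le> 1/2 \<Longrightarrow> x \<noteq> t \<Longrightarrow> P * powr_sum p t - Q * powr_sum q t < P * powr_sum p x - Q * powr_sum q x"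
proof -
  let ?R = "\<lambda>t. powr_gap (q - 1) t / powr_gap (p - 1) t" and ?c = "P * p / (Q * q)"
  have R: "?R x < ?R x'" if "0 \<le> x" "x < x'" "x' < 1/2" for x x'
    using that pq by (intro powr_gap_ratio_less) auto
  have g: "powr_gap (p - 1) x > 0" if "0 \<le> x" "x < 1/2" for x using that pq by (intro powr_gap_pos) auto
  have Qq: "Q * q > 0" using PQ pq by simp
  have c: "1 < ?c" "?c < (q - 1) / (p - 1) * 2 powr ((p - 1) - (q - 1))"
    using PQ Qq by (simp_all add: field_simps)
  have "\<forall>\<^sub>F x in at_left (1/2). ?c < ?R x"
    using powr_gap_ratio_tendsto[of "p - 1" "q - 1"] pq c(2) by (intro order_tendstoD) auto
  moreover have "\<forall>\<^sub>F x in at_left (1/2::real). x \<in> {0<..<1/2}" by (intro eventually_at_left_real) auto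
  ultimately have "\<forall>\<^sub>F x in at_left (1/2). ?c < ?R x \<and> x \<in> {0<..<1/2}" by eventually_elim auto
  \<comment> \<open>The ratio is 0/0 at \<open>1/2\<close>, so the intermediate value theorem is
    applied only up to a point \<open>t1\<close> beyond the crossing.\<close>
  then obtain t1 where t1: "?c < ?R t1" "0 < t1" "t1 < 1/2"
    using eventually_happens'[OF trivial_limit_at_left_real] by force
  have "\<exists>t. 0 \<le> t \<and> t \<le> t1 \<and> ?R t = ?c"
  proof (rule IVT')
    show "?R 0 \<le> ?c" using c by (simp add: powr_gap_def)
    show "continuous_on {0..t1} ?R"
    proof (intro continuous_on_divide continuous_on_subset[OF continuous_on_powr_gap] ballI)
      fix x assume "x \<in> {0..t1}"
      then show "powr_gap (p - 1) x \<noteq> 0" using g[of x] t1 by auto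
    qed (use pq t1 in auto)
  qed (use t1 in auto)
  then obtain t where t: "0 \<le> t" "t \<le> t1" "?R t = ?c" by blast
  have "?R 0 = 1" by (simp add: powr_gap_def)
  then have "t \<noteq> 0" using t(3) c(1) by (metis less_irrefl)
  then have t0: "0 < t" using t(1) by simp
  have th: "t < 1/2" using t t1 by simp
  show thesis
  proof (rule that[OF t0 th])
    fix x :: real assume x: "0 \<le> x" "x \<le> 1/2" "x \<noteq> t"
    show "P * powr_sum p t - Q * powr_sum q t < P * powr_sum p x - Q * powr_sum q x"
    proof (cases "x < t")
      case True
      show ?thesis
      proof (rule powr_sum_diff_greater[OF x(1) True])
        fix z assume z: "x < z" "z < t"
        then have "?R z < ?c" using R[of z t] x th t by simp
        then show "Q * q * powr_gap (q - 1) z < P * p * powr_gap (p - 1) z"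
          using g[of z] z x th Qq by (simp add: field_simps)
      qed (use th pq in auto)
    next
      case False
      then have xt: "t < x" using x by simp
      show ?thesis
      proof (rule powr_sum_diff_less[OF t(1) xt])
        fix z assume z: "t < z" "z < x"
        then have "?c < ?R z" using R[of t z] x th t by simp
        then show "P * p * powr_gap (p - 1) z < Q * q * powr_gap (q - 1) z"
          using g[of z] z x t0 Qq by (simp add: field_simps)
      qed (use x pq in auto)
    qed
  qed
qed

text \<open>An envelope theorem for a unique minimiser over a compact set. The minimiser is
  continuous because its graph is closed; no differentiability of it is required, since the value
  function lies between competitors with frozen \<open>t\<close>.\<close>

lemma
  fixes A B A' B' u v \<tau> :: "real \<Rightarrow> real"
  assumes S: "open S" and T: "compact T" and u: "continuous_on T u" and v: "continuous_on T v"
    and A: "\<And>x. x \<in> S \<Longrightarrow> (A has_real_derivative A' x) (at x)"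
    and B: "\<And>x. x \<in> S \<Longrightarrow> (B has_real_derivative B' x) (at x)"
    and \<tau>: "\<And>x. x \<in> S \<Longrightarrow> \<tau> x \<in> T"
    and min: "\<And>x t. x \<in> S \<Longrightarrow> t \<in> T \<Longrightarrow> t \<noteq> \<tau> x \<Longrightarrow> A x * u (\<tau> x) - B x * v (\<tau> x) < A x * u t - B x * v t"
  shows envelope_argmin_continuous: "continuous_on S \<tau>"
    and envelope_derivative: "\<And>x. x \<in> S \<Longrightarrow>
      ((\<lambda>x. A x * u (\<tau> x) - B x * v (\<tau> x)) has_real_derivative (A' x * u (\<tau> x) - B' x * v (\<tau> x))) (at x)"
proof -
  let ?f = "\<lambda>x t. A x * u t - B x * v t"
  have cA: "continuous_on S A" and cB: "continuous_on S B"
    using A B S by (auto intro!: continuous_at_imp_continuous_on DERIV_isCont)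
  have min': "?f x (\<tau> x) \<le> ?f x t" if "x \<in> S" "t \<in> T" for x t
    using min[OF that] by (cases "t = \<tau> x") auto
  show c\<tau>: "continuous_on S \<tau>"
  proof -
    have fim: "\<tau> \<in> S \<rightarrow> T" using \<tau> by auto
    \<comment> \<open>Not losing against a fixed competitor \<open>t\<close> is a closed condition,
      and uniqueness identifies the graph with the intersection of these conditions. The outer
      factor only matters when \<open>T\<close> is empty.\<close>
    have eq2: "(\<lambda>x. (x, \<tau> x)) ` S = (\<Inter>t\<in>T. (S \<times> T) \<inter> (\<lambda>z. ?f (fst z) (snd z) - ?f (fst z) t) -` {..0}) \<inter> (S \<times> T)"
    proof (intro equalityI subsetI)
      fix z assume "z \<in> (\<lambda>x. (x, \<tau> x)) ` S"
      then show "z \<in> (\<Inter>t\<in>T. (S \<times> T) \<inter> (\<lambda>z. ?f (fst z) (snd z) - ?f (fst z) t) -` {..0}) \<inter> (S \<times> T)"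
        using \<tau> min' by auto
    next
      fix z assume z: "z \<in> (\<Inter>t\<in>T. (S \<times> T) \<inter> (\<lambda>z. ?f (fst z) (snd z) - ?f (fst z) t) -` {..0}) \<inter> (S \<times> T)"
      then have fz: "fst z \<in> S" "snd z \<in> T" by auto
      have "z \<in> (S \<times> T) \<inter> (\<lambda>y. ?f (fst y) (snd y) - ?f (fst y) (\<tau> (fst z))) -` {..0}"
        by (rule INT_D[OF IntD1[OF z] \<tau>[OF fz(1)]])
      then have "?f (fst z) (snd z) \<le> ?f (fst z) (\<tau> (fst z))" by simp
      then have "snd z = \<tau> (fst z)" using z min[of "fst z" "snd z"] by force
      then show "z \<in> (\<lambda>x. (x, \<tau> x)) ` S" using z by (cases z) auto
    qed
    have cf: "continuous_on (S \<times> T) (\<lambda>z. ?f (fst z) (snd z) - ?f (fst z) t)" for t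
      by (intro continuous_intros continuous_on_compose2[OF cA] continuous_on_compose2[OF cB]
          continuous_on_compose2[OF u] continuous_on_compose2[OF v]) auto
    have cl: "closedin (top_of_set (S \<times> T)) ((S \<times> T) \<inter> (\<lambda>z. ?f (fst z) (snd z) - ?f (fst z) t) -` {..0})" for t
      using cf by (rule continuous_closedin_preimage) simp
    have "closedin (top_of_set (S \<times> T)) ((\<lambda>x. (x, \<tau> x)) ` S)"
    proof (cases "T = {}")
      case True
      then have "S = {}" using \<tau> by auto
      then show ?thesis by simp
    next
      case False
      then have "(\<lambda>x. (x, \<tau> x)) ` S = (\<Inter>t\<in>T. (S \<times> T) \<inter> (\<lambda>z. ?f (fst z) (snd z) - ?f (fst z) t) -` {..0})"
        unfolding eq2 by auto
      then show ?thesis using False cl by (metis (no_types, lifting) closedin_INT)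
    qed
    then show ?thesis by (simp only: continuous_closed_graph_eq[OF T fim])
  qed
  fix x assume x: "x \<in> S"
  let ?D = "A' x * u (\<tau> x) - B' x * v (\<tau> x)"
  let ?qA = "\<lambda>y. (A y - A x) / (y - x)" and ?qB = "\<lambda>y. (B y - B x) / (y - x)"
  have qA: "(?qA \<longlongrightarrow> A' x) (at x)" and qB: "(?qB \<longlongrightarrow> B' x) (at x)"
    using A[OF x] B[OF x] by (simp_all add: has_field_derivative_iff)
  have ev: "\<forall>\<^sub>F y in at x. y \<in> S" using S x by (rule eventually_at_in_open')
  have t\<tau>: "(\<tau> \<longlongrightarrow> \<tau> x) (at x)" using c\<tau> x S by (simp add: continuous_on_eq_continuous_at isCont_def)
  have tu: "((\<lambda>y. u (\<tau> y)) \<longlongrightarrow> u (\<tau> x)) (at x)"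
    by (rule continuous_on_tendsto_compose[OF u t\<tau>]) (use \<tau> x ev in \<open>auto elim: eventually_mono\<close>)
  have tv: "((\<lambda>y. v (\<tau> y)) \<longlongrightarrow> v (\<tau> x)) (at x)"
    by (rule continuous_on_tendsto_compose[OF v t\<tau>]) (use \<tau> x ev in \<open>auto elim: eventually_mono\<close>)
  let ?l = "\<lambda>y. ?qA y * u (\<tau> x) - ?qB y * v (\<tau> x)" and ?r = "\<lambda>y. ?qA y * u (\<tau> y) - ?qB y * v (\<tau> y)"
  have lim: "(?l \<longlongrightarrow> ?D) (at x)" "(?r \<longlongrightarrow> ?D) (at x)"
    by (intro tendsto_intros qA qB tu tv)+
  let ?q = "\<lambda>y. (?f y (\<tau> y) - ?f x (\<tau> x)) / (y - x)"
  have l: "?l y = (?f y (\<tau> x) - ?f x (\<tau> x)) / (y - x)" "?r y = (?f y (\<tau> y) - ?f x (\<tau> y)) / (y - x)" for y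
    by (simp_all add: diff_divide_distrib add_divide_distrib algebra_simps)
  \<comment> \<open>Freezing the parameter at \<open>\<tau> x\<close> or at \<open>\<tau> y\<close>
    bounds the increment of the value function from above and below; which quotient is the larger
    depends on the sign of \<open>y - x\<close>.\<close>
  have sand: "\<forall>\<^sub>F y in at x. min (?l y) (?r y) \<le> ?q y \<and> ?q y \<le> max (?l y) (?r y)"
    using ev eventually_neq_at_within[of x x UNIV]
  proof eventually_elim
    case (elim y)
    have 1: "?f y (\<tau> y) - ?f x (\<tau> x) \<le> ?f y (\<tau> x) - ?f x (\<tau> x)" using min'[of y "\<tau> x"] elim x \<tau> by simp
    have 2: "?f y (\<tau> y) - ?f x (\<tau> y) \<le> ?f y (\<tau> y) - ?f x (\<tau> x)" using min'[of x "\<tau> y"] elim x \<tau> by simp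
    show ?case
    proof (cases "y > x")
      case True
      then have "?r y \<le> ?q y" "?q y \<le> ?l y" unfolding l using 1 2 by (intro divide_right_mono; simp)+
      then show ?thesis by simp
    next
      case False
      then have "?l y \<le> ?q y" "?q y \<le> ?r y" unfolding l using 1 2 by (intro divide_right_mono_neg; simp)+
      then show ?thesis by simp
    qed
  qed
  have "(?q \<longlongrightarrow> ?D) (at x)"
  proof (rule tendsto_sandwich)
    show "((\<lambda>y. min (?l y) (?r y)) \<longlongrightarrow> ?D) (at x)" using tendsto_min[OF lim] by simp
    show "((\<lambda>y. max (?l y) (?r y)) \<longlongrightarrow> ?D) (at x)" using tendsto_max[OF lim] by simp
  qed (use sand in \<open>auto elim: eventually_mono\<close>)
  then show "((\<lambda>x. A x * u (\<tau> x) - B x * v (\<tau> x)) has_real_derivative ?D) (at x)"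
    by (simp add: has_field_derivative_iff)
qed

section \<open>Integrals over balls\<close>

lemma unit_ball_vol_neq_0: "0 \<le> n \<Longrightarrow> unit_ball_vol n \<noteq> 0"
  using unit_ball_vol_pos[of n] by linarith

text \<open>Polar coordinates for radial functions. Only the volumes of balls enter: the two
  measures agree on all half-lines by the fundamental theorem of calculus.\<close>

lemma distr_norm_ball:
  fixes R :: real
  assumes "0 \<le> R"
  shows "distr (density lborel (indicator (ball (0::'a::euclidean_space) R))) borel norm =
    density lborel (\<lambda>r. ennreal (unit_ball_vol (real DIM('a)) * real DIM('a) * r ^ (DIM('a) - 1)) * indicator {0..R} r)"
    (is "?M = ?N")
proof (rule measure_eqI_lessThan)
  let ?\<omega> = "unit_ball_vol (real DIM('a))" and ?B = "ball (0::'a) R"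
  have [measurable]: "?B \<in> sets borel" by simp
  have M: "emeasure ?M {a<..} = emeasure lborel (?B - cball 0 a)" for a
  proof -
    have [measurable]: "?B - cball 0 a \<in> sets borel" by simp
    have "emeasure ?M {a<..} = emeasure (density lborel (indicator ?B)) (norm -` {a<..})"
      by (subst emeasure_distr) auto
    also have "\<dots> = (\<integral>\<^sup>+x. indicator ?B x * indicator (norm -` {a<..}) x \<partial>lborel)"
      by (subst emeasure_density) (auto intro!: borel_measurable_indicator measurable_sets[of norm borel borel, simplified])
    also have "\<dots> = (\<integral>\<^sup>+x. indicator (?B - cball 0 a) x \<partial>lborel)"
      by (intro nn_integral_cong) (auto simp: indicator_def)
    finally show ?thesis by simp
  qed
  have Bfin: "emeasure lborel ?B < \<infinity>" using emeasure_lborel_ball_finite[of "0::'a" R] by simp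
  show "emeasure ?M {x<..} < \<infinity>" for x
    unfolding M using emeasure_mono[of "?B - cball 0 x" ?B lborel] Bfin by (auto intro: le_less_trans)
  fix a :: real
  \<comment> \<open>Norms are nonnegative, so a negative threshold acts like 0; the difference is at
    most the null set containing the origin.\<close>
  define b where "b = max a 0"
  have b0: "0 \<le> b" by (simp add: b_def)
  have N: "emeasure ?N {a<..} = (\<integral>\<^sup>+r. ennreal (?\<omega> * real DIM('a) * r ^ (DIM('a) - 1)) * indicator {b..R} r \<partial>lborel)"
  proof -
    have "emeasure ?N {a<..} = (\<integral>\<^sup>+r. ennreal (?\<omega> * real DIM('a) * r ^ (DIM('a) - 1)) * indicator {0..R} r * indicator {a<..} r \<partial>lborel)"
      by (subst emeasure_density) auto
    also have "\<dots> = (\<integral>\<^sup>+r. ennreal (?\<omega> * real DIM('a) * r ^ (DIM('a) - 1)) * indicator {b..R} r \<partial>lborel)"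
    proof (rule nn_integral_cong_AE)
      show "AE r in lborel. ennreal (?\<omega> * real DIM('a) * r ^ (DIM('a) - 1)) * indicator {0..R} r * indicator {a<..} r =
         ennreal (?\<omega> * real DIM('a) * r ^ (DIM('a) - 1)) * indicator {b..R} r"
        using AE_lborel_singleton[of a] by eventually_elim (auto simp: indicator_def b_def)
    qed
    finally show ?thesis .
  qed
  show "emeasure ?M {a<..} = emeasure ?N {a<..}"
  proof (cases "b \<le> R")
    case True
    have "((\<lambda>r. ?\<omega> * real DIM('a) * r ^ (DIM('a) - 1)) has_integral (?\<omega> * R ^ DIM('a) - ?\<omega> * b ^ DIM('a))) {b..R}"
      using True by (intro fundamental_theorem_of_calculus)
        (auto intro!: derivative_eq_intros simp flip: has_real_derivative_iff_has_vector_derivative)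
    then have "emeasure ?N {a<..} = ennreal (?\<omega> * R ^ DIM('a) - ?\<omega> * b ^ DIM('a))"
      unfolding N using b0 by (intro nn_integral_has_integral_lebesgue') auto
    also have "\<dots> = emeasure lborel (?B - cball 0 b)"
    proof (cases "b = R")
      case True
      then have "?B - cball 0 b = {}" by auto
      then have "emeasure lborel (?B - cball 0 b) = 0" by (simp only: emeasure_empty)
      then show ?thesis using True by simp
    next
      case False
      then have "cball (0::'a) b \<subseteq> ?B" using \<open>b \<le> R\<close> by auto
      then show ?thesis using b0 assms emeasure_lborel_cball_finite[of "0::'a" b]
        by (subst emeasure_Diff) (auto simp: emeasure_ball emeasure_cball ennreal_minus)
    qed
    also have "\<dots> = emeasure lborel (?B - cball 0 a)"
    proof (cases "a < 0")
      case True
      have "emeasure lborel (?B - cball 0 b) = emeasure lborel (?B - {0})" using True by (simp add: b_def)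
      also have "\<dots> = emeasure lborel ?B" by (rule emeasure_Diff_null_set) auto
      finally show ?thesis using True by simp
    qed (simp add: b_def)
    finally show ?thesis by (simp add: M)
  next
    case False
    then have "?B - cball 0 a = {}" using assms by (auto simp: b_def max_def split: if_splits)
    then have "emeasure lborel (?B - cball 0 a) = 0" by (simp only: emeasure_empty)
    moreover have "emeasure ?N {a<..} = 0" unfolding N using False by simp
    ultimately show ?thesis by (simp add: M)
  qed
qed auto

lemma nn_integral_ball_norm_powr:
  fixes a R :: real
  assumes R: "0 \<le> R" and a: "0 < a + real DIM('a::euclidean_space)"
  shows "(\<integral>\<^sup>+x. indicator (ball (0::'a) R) x * ennreal (norm x powr a) \<partial>lborel) =
    ennreal (unit_ball_vol (real DIM('a)) * real DIM('a) * R powr (a + real DIM('a)) / (a + real DIM('a)))"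
proof -
  let ?\<omega> = "unit_ball_vol (real DIM('a))" and ?d = "DIM('a)"
  have [measurable]: "ball (0::'a) R \<in> sets borel" by simp
  have "(\<integral>\<^sup>+x. indicator (ball (0::'a) R) x * ennreal (norm x powr a) \<partial>lborel)
    = (\<integral>\<^sup>+x. ennreal (norm x powr a) \<partial>density lborel (indicator (ball (0::'a) R)))"
    by (subst nn_integral_density) auto
  also have "\<dots> = (\<integral>\<^sup>+r. ennreal (r powr a) \<partial>distr (density lborel (indicator (ball (0::'a) R))) borel norm)"
    by (subst nn_integral_distr) auto
  also have "\<dots> = (\<integral>\<^sup>+r. ennreal (?\<omega> * real ?d * r ^ (?d - 1)) * indicator {0..R} r * ennreal (r powr a) \<partial>lborel)"
    unfolding distr_norm_ball[OF R] by (subst nn_integral_density) auto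
  also have "\<dots> = (\<integral>\<^sup>+r. ennreal (?\<omega> * real ?d) * (ennreal (r powr (a + real ?d - 1)) * indicator {0..R} r) \<partial>lborel)"
  proof (rule nn_integral_cong_AE)
    show "AE r in lborel. ennreal (?\<omega> * real ?d * r ^ (?d - 1)) * indicator {0..R} r * ennreal (r powr a) =
        ennreal (?\<omega> * real ?d) * (ennreal (r powr (a + real ?d - 1)) * indicator {0..R} r)"
      using AE_lborel_singleton[of 0]
    proof eventually_elim
      case (elim r)
      show ?case
      proof (cases "r \<in> {0..R}")
        case True
        then have r: "r > 0" using elim by simp
        have "r ^ (?d - 1) * r powr a = r powr (a + real ?d - 1)"
          using r by (simp add: powr_realpow[symmetric] powr_add[symmetric] of_nat_diff algebra_simps)
        then have "?\<omega> * real ?d * r ^ (?d - 1) * r powr a = ?\<omega> * real ?d * r powr (a + real ?d - 1)"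
          by simp
        then show ?thesis using True r by (simp add: ennreal_mult[symmetric])
      qed simp
    qed
  qed
  also have "\<dots> = ennreal (?\<omega> * real ?d) * (\<integral>\<^sup>+r. ennreal (r powr (a + real ?d - 1)) * indicator {0..R} r \<partial>lborel)"
    by (rule nn_integral_cmult) simp
  also have "(\<integral>\<^sup>+r. ennreal (r powr (a + real ?d - 1)) * indicator {0..R} r \<partial>lborel) = ennreal (R powr (a + real ?d) / (a + real ?d))"
    using has_integral_powr_from_0[of "a + real ?d - 1" R] a R
    by (intro nn_integral_has_integral_lebesgue') auto
  finally show ?thesis using a by (simp add: ennreal_mult[symmetric])
qed

lemma kinetic_bathtub:
  fixes g :: "'a::euclidean_space \<Rightarrow> real"
  assumes R: "0 \<le> R" and gm[measurable]: "g \<in> borel_measurable borel" and g: "\<And>x. 0 \<le> g x" "\<And>x. g x \<le> 1"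
    and m: "(\<integral>\<^sup>+x. ennreal (g x) \<partial>lborel) = emeasure lborel (ball (0::'a) R)"
  shows "(\<integral>\<^sup>+x. indicator (ball (0::'a) R) x * ennreal ((norm x)\<^sup>2) \<partial>lborel) \<le> (\<integral>\<^sup>+x. ennreal ((norm x)\<^sup>2 * g x) \<partial>lborel)" (is "?K \<le> ?G")
    and "(\<integral>\<^sup>+x. ennreal ((norm x)\<^sup>2 * g x) \<partial>lborel) = (\<integral>\<^sup>+x. indicator (ball (0::'a) R) x * ennreal ((norm x)\<^sup>2) \<partial>lborel)
      \<Longrightarrow> AE x in lborel. g x = indicator (cball (0::'a) R) x"
proof -
  let ?B = "ball (0::'a) R"
  have [measurable]: "?B \<in> sets borel" by simp
  \<comment> \<open>Both factors have the same sign since \<open>g\<close> lies between 0 and 1. The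
    integral of \<open>h\<close> is exactly the excess kinetic energy, so equality forces
    \<open>h = 0\<close> almost everywhere, which fixes \<open>g\<close> off the sphere of radius
    \<open>R\<close>.\<close>
  define h where "h x = ((norm x)\<^sup>2 - R\<^sup>2) * (g x - indicator ?B x)" for x
  have [measurable]: "h \<in> borel_measurable borel" unfolding h_def by measurable
  have h0: "0 \<le> h x" for x
  proof (cases "norm x < R")
    case True
    then have "(norm x)\<^sup>2 \<le> R\<^sup>2" by (intro power_mono) auto
    then show ?thesis using True g[of x] by (auto simp: h_def intro!: mult_nonpos_nonpos)
  next
    case False
    then have "R\<^sup>2 \<le> (norm x)\<^sup>2" using R by (intro power_mono) auto
    then show ?thesis using False g[of x] by (auto simp: h_def intro!: mult_nonneg_nonneg)
  qed
  \<comment> \<open>The common finite term \<open>e\<close> is added to both sides in place of a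
    subtraction.\<close>
  define e where "e = ennreal (R\<^sup>2) * emeasure lborel ?B"
  have efin: "e \<noteq> \<infinity>" using emeasure_lborel_ball_finite[of "0::'a" R] by (auto simp: e_def ennreal_mult_eq_top_iff)
  have Kfin: "?K \<noteq> \<infinity>"
  proof -
    have "?K \<le> (\<integral>\<^sup>+x. ennreal (R\<^sup>2) * indicator ?B x \<partial>lborel)"
      by (intro nn_integral_mono) (auto simp: indicator_def intro!: ennreal_leI power_mono)
    also have "\<dots> = e" by (simp add: e_def nn_integral_cmult)
    finally show ?thesis using efin by (auto simp: top_unique)
  qed
  have "?G + e = (\<integral>\<^sup>+x. ennreal ((norm x)\<^sup>2 * g x) + ennreal (R\<^sup>2) * indicator ?B x \<partial>lborel)"
    by (simp add: nn_integral_add nn_integral_cmult e_def)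
  also have "\<dots> = (\<integral>\<^sup>+x. indicator ?B x * ennreal ((norm x)\<^sup>2) + (ennreal (R\<^sup>2) * ennreal (g x) + ennreal (h x)) \<partial>lborel)"
  proof (intro nn_integral_cong)
    fix x :: 'a
    have eq: "(norm x)\<^sup>2 * g x + R\<^sup>2 * indicator ?B x = indicator ?B x * (norm x)\<^sup>2 + (R\<^sup>2 * g x + h x)"
      by (simp add: h_def algebra_simps)
    show "ennreal ((norm x)\<^sup>2 * g x) + ennreal (R\<^sup>2) * indicator ?B x = indicator ?B x * ennreal ((norm x)\<^sup>2) + (ennreal (R\<^sup>2) * ennreal (g x) + ennreal (h x))"
      using eq h0[of x] g[of x]
      by (cases "x \<in> ?B") (simp_all add: ennreal_mult[symmetric] flip: ennreal_plus)
  qed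
  also have "\<dots> = ?K + (\<integral>\<^sup>+x. ennreal (R\<^sup>2) * ennreal (g x) + ennreal (h x) \<partial>lborel)"
    by (subst nn_integral_add) auto
  also have "(\<integral>\<^sup>+x. ennreal (R\<^sup>2) * ennreal (g x) + ennreal (h x) \<partial>lborel) = e + (\<integral>\<^sup>+x. ennreal (h x) \<partial>lborel)"
    by (subst nn_integral_add) (auto simp: nn_integral_cmult m e_def)
  finally have "e + ?G = e + (?K + (\<integral>\<^sup>+x. ennreal (h x) \<partial>lborel))" by (simp add: ac_simps)
  then have main: "?G = ?K + (\<integral>\<^sup>+x. ennreal (h x) \<partial>lborel)"
    using efin by (simp add: ennreal_add_left_cancel)
  show "?K \<le> ?G" unfolding main by simp
  assume "?G = ?K"
  then have "?K + (\<integral>\<^sup>+x. ennreal (h x) \<partial>lborel) = ?K + 0" using main by simp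
  then have "(\<integral>\<^sup>+x. ennreal (h x) \<partial>lborel) = 0" using Kfin by (simp only: ennreal_add_left_cancel) auto
  then have "AE x in lborel. ennreal (h x) = 0" by (subst (asm) nn_integral_0_iff_AE) auto
  moreover have "AE x in lborel. x \<notin> sphere (0::'a) R"
  proof (rule AE_not_in)
    have "sphere (0::'a) R \<in> null_sets lebesgue" using negligible_sphere[of "0::'a" R] by (simp add: negligible_iff_null_sets)
    then show "sphere (0::'a) R \<in> null_sets lborel" by (simp add: null_sets_completion_iff)
  qed
  ultimately show "AE x in lborel. g x = indicator (cball (0::'a) R) x"
  proof eventually_elim
    case (elim x)
    have "h x = 0" using elim(1) h0[of x] by simp
    then have "(norm x)\<^sup>2 = R\<^sup>2 \<or> g x = indicator ?B x" by (simp add: h_def)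
    moreover have "(norm x)\<^sup>2 \<noteq> R\<^sup>2" using elim(2) R by (auto simp: power2_eq_iff_nonneg)
    ultimately have "g x = indicator ?B x" by blast
    then show ?case using elim(2) by (auto simp: indicator_def)
  qed
qed

section \<open>The Riesz kernel\<close>

text \<open>On the diagonal the kernel is set to \<open>\<infinity>\<close> (instead of the junk value \<open>0 powr x = 0\<close>), which
  makes it a decreasing function of the distance.\<close>
definition riesz_ker :: "real \<Rightarrow> real \<Rightarrow> real \<Rightarrow> ennreal" where
  "riesz_ker c a r = (if r \<le> 0 then \<infinity> else ennreal (c * r powr a))"

lemma radial_kernel_riesz_ker:
  assumes "0 \<le> c" "a \<le> 0" shows "radial_kernel (riesz_ker c a)"
  unfolding radial_kernel_def
proof (intro conjI allI impI)
  show "riesz_ker c a \<in> borel_measurable borel" unfolding riesz_ker_def[abs_def] by measurable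
  fix x y :: real assume "0 \<le> x" "x \<le> y"
  then show "riesz_ker c a y \<le> riesz_ker c a x"
    using assms by (auto simp: riesz_ker_def intro!: ennreal_leI mult_left_mono powr_mono2')
qed

text \<open>For each \<open>x\<close> the modified value on the diagonal concerns only the point
  \<open>y = x\<close>.\<close>

lemma interact_riesz_ker:
  fixes f g :: "'a::euclidean_space \<Rightarrow> ennreal"
  assumes [measurable]: "f \<in> borel_measurable borel" "g \<in> borel_measurable borel"
  shows "interact (riesz_ker c a) f g = (\<integral>\<^sup>+x. (\<integral>\<^sup>+y. f x * g y * ennreal (c * norm (x - y) powr a) \<partial>lborel) \<partial>lborel)"
  unfolding interact_def
proof (rule nn_integral_cong, rule nn_integral_cong_AE)
  fix x :: 'a
  show "AE y in lborel. f x * g y * riesz_ker c a (norm (x - y)) = f x * g y * ennreal (c * norm (x - y) powr a)"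
    using AE_lborel_singleton[of x] by eventually_elim (auto simp: riesz_ker_def)
qed

lemma riesz_ker_locally_integrable:
  assumes "0 \<le> c" "0 < a + real DIM('a::euclidean_space)"
  shows "(\<integral>\<^sup>+z. indicator (ball (0::'a) 1) z * riesz_ker c a (norm z) \<partial>lborel) < \<infinity>"
proof -
  have [measurable]: "ball (0::'a) 1 \<in> sets borel" by simp
  have "(\<integral>\<^sup>+z. indicator (ball (0::'a) 1) z * riesz_ker c a (norm z) \<partial>lborel)
    = (\<integral>\<^sup>+z. ennreal c * (indicator (ball (0::'a) 1) z * ennreal (norm z powr a)) \<partial>lborel)"
  proof (rule nn_integral_cong_AE)
    show "AE z in lborel. indicator (ball (0::'a) 1) z * riesz_ker c a (norm z) = ennreal c * (indicator (ball (0::'a) 1) z * ennreal (norm z powr a))"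
      using AE_lborel_singleton[of "0::'a"] by eventually_elim (use assms in \<open>auto simp: riesz_ker_def indicator_def ennreal_mult\<close>)
  qed
  also have "\<dots> < \<infinity>"
    using assms by (simp add: nn_integral_cmult nn_integral_ball_norm_powr ennreal_mult_less_top)
  finally show ?thesis .
qed

lemma nn_integral_lborel_scale:
  fixes f :: "'a::euclidean_space \<Rightarrow> ennreal"
  assumes [measurable]: "f \<in> borel_measurable borel" and R: "0 < R"
  shows "(\<integral>\<^sup>+x. f x \<partial>lborel) = ennreal (R ^ DIM('a)) * (\<integral>\<^sup>+x. f (R *\<^sub>R x) \<partial>lborel)"
  using R by (subst lborel_affine[of R 0]) (simp_all add: nn_integral_density nn_integral_distr nn_integral_cmult)

lemma interact_ball_scale:
  fixes R :: real
  assumes R: "0 < R"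
  shows "interact (riesz_ker 1 a) (indicator (ball (0::'a::euclidean_space) R)) (indicator (ball 0 R)) =
    ennreal (R powr (2 * real DIM('a) + a)) * interact (riesz_ker 1 a) (indicator (ball (0::'a) 1)) (indicator (ball 0 1))"
proof -
  let ?d = "DIM('a)"
  have [measurable]: "ball (0::'a) r \<in> sets borel" for r by simp
  have bm: "indicator (ball (0::'a) r) \<in> borel_measurable borel" for r by (rule borel_measurable_indicator) simp
  let ?k = "\<lambda>R x y. indicator (ball (0::'a) R) x * indicator (ball (0::'a) R) y * ennreal (1 * norm (x - y) powr a)"
  have k: "?k R (R *\<^sub>R x) (R *\<^sub>R y) = ennreal (R powr a) * ?k 1 x y" for x y
  proof -
    have "norm (R *\<^sub>R x - R *\<^sub>R y) = R * norm (x - y)" using R by (simp flip: scaleR_diff_right)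
    then show ?thesis using R by (auto simp: indicator_def powr_mult ennreal_mult)
  qed
  have "interact (riesz_ker 1 a) (indicator (ball (0::'a) R)) (indicator (ball 0 R)) = (\<integral>\<^sup>+x. (\<integral>\<^sup>+y. ?k R x y \<partial>lborel) \<partial>lborel)"
    by (rule interact_riesz_ker[OF bm bm])
  also have "\<dots> = (\<integral>\<^sup>+x. ennreal (R ^ ?d) * (\<integral>\<^sup>+y. ?k R x (R *\<^sub>R y) \<partial>lborel) \<partial>lborel)"
    by (subst nn_integral_lborel_scale[OF _ R]) auto
  also have "\<dots> = ennreal (R ^ ?d) * (\<integral>\<^sup>+x. ennreal (R ^ ?d) * (\<integral>\<^sup>+y. ?k R (R *\<^sub>R x) (R *\<^sub>R y) \<partial>lborel) \<partial>lborel)"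
    by (subst nn_integral_lborel_scale[OF _ R]) auto
  also have "\<dots> = ennreal (R ^ ?d) * (ennreal (R ^ ?d) * (ennreal (R powr a) * (\<integral>\<^sup>+x. (\<integral>\<^sup>+y. ?k 1 x y \<partial>lborel) \<partial>lborel)))"
    unfolding k by (simp add: nn_integral_cmult)
  also have "(\<integral>\<^sup>+x. (\<integral>\<^sup>+y. ?k 1 x y \<partial>lborel) \<partial>lborel) = interact (riesz_ker 1 a) (indicator (ball (0::'a) 1)) (indicator (ball 0 1))"
    by (rule interact_riesz_ker[OF bm bm, symmetric])
  also have "ennreal (R ^ ?d) * (ennreal (R ^ ?d) * (ennreal (R powr a) * interact (riesz_ker 1 a) (indicator (ball (0::'a) 1)) (indicator (ball 0 1))))
    = ennreal (R powr (2 * real ?d + a)) * interact (riesz_ker 1 a) (indicator (ball (0::'a) 1)) (indicator (ball 0 1))"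
  proof -
    have "R ^ ?d * (R ^ ?d * R powr a) = R powr (2 * real ?d + a)"
      using R by (simp add: powr_realpow[symmetric] powr_add[symmetric])
    then have "ennreal (R ^ ?d) * (ennreal (R ^ ?d) * ennreal (R powr a)) = ennreal (R powr (2 * real ?d + a))"
      using R by (simp add: ennreal_mult[symmetric])
    then show ?thesis by (simp add: mult.assoc[symmetric])
  qed
  finally show ?thesis .
qed

lemma interact_riesz_ker_cmult:
  fixes f g :: "'a::euclidean_space \<Rightarrow> ennreal"
  assumes [measurable]: "f \<in> borel_measurable borel" "g \<in> borel_measurable borel" and c: "0 \<le> c"
  shows "interact (riesz_ker c a) f g = ennreal c * interact (riesz_ker 1 a) f g"
proof -
  have "f x * g y * ennreal (c * norm (x - y) powr a) = ennreal c * (f x * g y * ennreal (1 * norm (x - y) powr a))" for x y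
    using c by (simp add: ennreal_mult mult_ac)
  then show ?thesis by (simp add: interact_riesz_ker nn_integral_cmult)
qed

text \<open>The Bochner integral in \<open>c_D\<close> would be 0 if the integrand were not
  integrable, so finiteness is proved first, from the uniform bound on the potential.\<close>

lemma interact_unit_ball_c_D:
  fixes s :: real
  assumes s: "0 < s" "s < real CARD('n::finite)"
  shows "interact (riesz_ker 1 (s - real CARD('n))) (indicator (ball (0::real^'n) 1)) (indicator (ball 0 1)) = ennreal (c_D TYPE('n) s)"
    "0 < c_D TYPE('n) s"
proof -
  let ?a = "s - real CARD('n)" and ?B = "ball (0::real^'n) 1"
  let ?I = "interact (riesz_ker 1 ?a) (indicator ?B) (indicator ?B)"
  let ?f = "\<lambda>p. indicator ?B (fst p) * indicator ?B (snd p) / norm (fst p - snd p) powr (real CARD('n) - s) :: real"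
  have [measurable]: "?B \<in> sets borel" by simp
  have bm: "indicator ?B \<in> borel_measurable borel" by (rule borel_measurable_indicator) simp
  have W: "radial_kernel (riesz_ker 1 ?a)" using s by (intro radial_kernel_riesz_ker) auto
  have fm[measurable]: "?f \<in> borel_measurable borel"
  proof -
    have "?f \<in> borel_measurable (borel \<Otimes>\<^sub>M borel)" by measurable
    then show ?thesis by (simp add: borel_prod)
  qed
  have "?I = (\<integral>\<^sup>+x. (\<integral>\<^sup>+y. ennreal (?f (x, y)) \<partial>lborel) \<partial>lborel)"
    unfolding interact_riesz_ker[OF bm bm]
    by (intro nn_integral_cong) (auto simp: indicator_def powr_minus_divide[symmetric])
  also have "\<dots> = (\<integral>\<^sup>+p. ennreal (?f p) \<partial>(lborel \<Otimes>\<^sub>M lborel))"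
    by (rule lborel.nn_integral_fst) (simp add: lborel_prod)
  finally have I: "?I = (\<integral>\<^sup>+p. ennreal (?f p) \<partial>lborel)" by (simp add: lborel_prod)
  define K where "K = (\<integral>\<^sup>+z. indicator ?B z * riesz_ker 1 ?a (norm z) \<partial>lborel) + riesz_ker 1 ?a 1 * emeasure lborel ?B"
  have K: "K < \<infinity>"
    using riesz_ker_locally_integrable[where 'a="real^'n", of 1 ?a] s emeasure_lborel_ball_finite[of "0::real^'n" 1]
    by (auto simp: K_def riesz_ker_def ennreal_mult_less_top)
  have "?I \<le> (\<integral>\<^sup>+x. K * indicator ?B x \<partial>lborel)"
    unfolding interact_potential[OF W bm bm] using potential_indicator_le[OF W, of ?B]
    by (intro nn_integral_mono) (auto simp: indicator_def K_def)
  also have "\<dots> = K * emeasure lborel ?B" by (rule nn_integral_cmult_indicator) simp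
  also have "\<dots> < \<infinity>" using K emeasure_lborel_ball_finite[of "0::real^'n" 1] by (auto simp: ennreal_mult_less_top)
  finally have fin: "?I < \<infinity>" .
  have int: "integrable lborel ?f" using fin I by (intro integrableI_nonneg) auto
  show 1: "?I = ennreal (c_D TYPE('n) s)"
    unfolding I c_D_def using int by (intro nn_integral_eq_integral) auto
  have "0 < ?I"
  proof -
    have b: "emeasure lborel ?B = ennreal (unit_ball_vol (real CARD('n)))" by (simp add: emeasure_ball)
    \<comment> \<open>Two points of the unit ball are at distance at most 2, where the decreasing
      kernel is at least \<open>2 powr ?a\<close>.\<close>
    have "0 < ennreal (2 powr ?a) * (emeasure lborel ?B * emeasure lborel ?B)"
      unfolding b by (simp add: ennreal_mult[symmetric] ennreal_zero_less_mult_iff)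
    also have "\<dots> = (\<integral>\<^sup>+x. (\<integral>\<^sup>+y. ennreal (2 powr ?a) * (indicator ?B x * indicator ?B y) \<partial>lborel) \<partial>lborel)"
      by (simp add: nn_integral_cmult nn_integral_multc)
    also have "\<dots> \<le> ?I"
      unfolding interact_def
    proof (intro nn_integral_mono)
      fix x y :: "real^'n"
      have "ennreal (2 powr ?a) \<le> riesz_ker 1 ?a (norm (x - y))" if "x \<in> ?B" "y \<in> ?B"
      proof -
        have "norm (x - y) \<le> 2" using that norm_triangle_ineq4[of x y] by auto
        then have "riesz_ker 1 ?a 2 \<le> riesz_ker 1 ?a (norm (x - y))" by (intro radial_kernelD(2)[OF W]) auto
        then show ?thesis by (simp add: riesz_ker_def)
      qed
      then show "ennreal (2 powr ?a) * (indicator ?B x * indicator ?B y) \<le> indicator ?B x * indicator ?B y * riesz_ker 1 ?a (norm (x - y))"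
        by (auto simp: indicator_def)
    qed
    finally show ?thesis .
  qed
  then show "0 < c_D TYPE('n) s" unfolding 1 by simp
qed

section \<open>The spinless problem\<close>

text \<open>The radius of the momentum ball of volume \<open>(2 * pi) ^ d * m\<close>, which
  accommodates one spin component of density \<open>m\<close>.\<close>

definition Fermi_radius :: "'n::finite itself \<Rightarrow> real \<Rightarrow> real" where
  "Fermi_radius _ m = 2 * pi * (m / unit_ball_vol (real CARD('n))) powr (1 / real CARD('n))"

lemma Fermi_radius_nonneg [simp]: "0 \<le> Fermi_radius T m"
  by (simp add: Fermi_radius_def)

lemma Fermi_radius_pos: "0 < m \<Longrightarrow> 0 < Fermi_radius (T :: 'n::finite itself) m"
  by (simp add: Fermi_radius_def unit_ball_vol_neq_0)

lemma sphere_area_ratio: "d \<ge> 1 \<Longrightarrow> real d / sphere_area d = 1 / unit_ball_vol (real d)"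
  by (simp add: sphere_area_def)

lemma Fermi_radius_sq:
  assumes "0 \<le> m"
  shows "(Fermi_radius TYPE('n::finite) m)\<^sup>2 = c_TF CARD('n) * m powr (2 / real CARD('n))"
proof -
  let ?\<omega> = "unit_ball_vol (real CARD('n))" and ?d = "real CARD('n)"
  have \<omega>: "?\<omega> > 0" by simp
  have "((m / ?\<omega>) powr (1 / ?d))\<^sup>2 = (m / ?\<omega>) powr (2 / ?d)"
    by (simp add: power2_eq_square flip: powr_add)
  also have "\<dots> = (1 / ?\<omega>) powr (2 / ?d) * m powr (2 / ?d)"
    using \<omega> assms by (simp add: powr_divide)
  finally show ?thesis
    by (simp add: Fermi_radius_def c_TF_def sphere_area_ratio Suc_le_eq power_mult_distrib)
qed

lemma Fermi_ball_iff:
  assumes "0 \<le> m"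
  shows "(norm k)\<^sup>2 \<le> c_TF CARD('n) * m powr (2 / real CARD('n)) \<longleftrightarrow> (k :: real^'n) \<in> cball 0 (Fermi_radius TYPE('n) m)"
  unfolding Fermi_radius_sq[OF assms, symmetric] by (simp add: abs_le_square_iff[symmetric])

lemma emeasure_Fermi_ball:
  assumes "0 \<le> m"
  shows "emeasure lborel (ball (0::real^'n) (Fermi_radius TYPE('n) m)) = ennreal ((2 * pi) ^ CARD('n) * m)"
proof -
  let ?\<omega> = "unit_ball_vol (real CARD('n))" and ?d = "real CARD('n)"
  have \<omega>: "?\<omega> \<noteq> 0" using unit_ball_vol_pos[of ?d] by linarith
  have "((m / ?\<omega>) powr (1 / ?d)) ^ CARD('n) = m / ?\<omega>"
  proof (cases "m = 0")
    case False
    define q where "q = m / ?\<omega>"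
    have "0 < q" using False assms unit_ball_vol_pos[of ?d] by (simp add: q_def)
    then have "(q powr (1 / ?d)) ^ CARD('n) = q" by (simp add: powr_realpow[symmetric] powr_powr)
    then show ?thesis by (simp add: q_def)
  qed simp
  then have "?\<omega> * Fermi_radius TYPE('n) m ^ CARD('n) = (2 * pi) ^ CARD('n) * m"
    using \<omega> by (simp add: Fermi_radius_def power_mult_distrib)
  then show ?thesis by (simp add: emeasure_ball)
qed

text \<open>The energy of one spin component filling its Fermi ball; the normalisation
  \<open>1 / (2 * (2 * pi) ^ d)\<close> of \<open>HF_energy\<close> is absorbed in the
  constants.\<close>

definition spinless_energy :: "'n::finite itself \<Rightarrow> real \<Rightarrow> real \<Rightarrow> real" where
  "spinless_energy T s m = kappa CARD('n) * m powr (1 + 2 / real CARD('n)) - lambda_HF T s * m powr (1 + s / real CARD('n))"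

lemma kinetic_Fermi_ball:
  assumes m: "0 \<le> m"
  shows "(\<integral>\<^sup>+k. indicator (ball (0::real^'n) (Fermi_radius TYPE('n) m)) k * ennreal ((norm k)\<^sup>2) \<partial>lborel) =
    ennreal (2 * (2 * pi) ^ CARD('n) * (kappa CARD('n) * m powr (1 + 2 / real CARD('n))))"
proof -
  let ?\<omega> = "unit_ball_vol (real CARD('n))" and ?d = "real CARD('n)" and ?R = "Fermi_radius TYPE('n) m"
  have \<omega>: "?\<omega> > 0" by simp
  have "(\<integral>\<^sup>+k. indicator (ball (0::real^'n) ?R) k * ennreal ((norm k)\<^sup>2) \<partial>lborel)
     = (\<integral>\<^sup>+k. indicator (ball (0::real^'n) ?R) k * ennreal (norm k powr 2) \<partial>lborel)"
    by (intro nn_integral_cong) (simp add: powr_numeral)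
  also have "\<dots> = ennreal (?\<omega> * ?d * ?R powr (2 + ?d) / (2 + ?d))"
    by (subst nn_integral_ball_norm_powr) auto
  also have "?\<omega> * ?d * ?R powr (2 + ?d) / (2 + ?d) = 2 * (2 * pi) ^ CARD('n) * (kappa CARD('n) * m powr (1 + 2 / ?d))"
  proof (cases "m = 0")
    case True
    then show ?thesis by (simp add: Fermi_radius_def)
  next
    case False
    then have m: "m > 0" using m by simp
    have R: "?R > 0" by (rule Fermi_radius_pos[OF m])
    have "?\<omega> * ?R ^ CARD('n) = (2 * pi) ^ CARD('n) * m"
      using emeasure_Fermi_ball[where 'n='n, of m] m R by (simp add: emeasure_ball)
    moreover have "?R powr (2 + ?d) = ?R\<^sup>2 * ?R ^ CARD('n)"
      using R by (simp add: powr_add powr_realpow powr_numeral)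
    ultimately have "?\<omega> * ?R powr (2 + ?d) = (2 * pi) ^ CARD('n) * m * ?R\<^sup>2" by simp
    also have "\<dots> = (2 * pi) ^ CARD('n) * (c_TF CARD('n) * m powr (1 + 2 / ?d))"
      using m by (simp add: Fermi_radius_sq powr_add)
    finally have "?\<omega> * ?d * ?R powr (2 + ?d) / (2 + ?d) = ?d / (2 + ?d) * ((2 * pi) ^ CARD('n) * (c_TF CARD('n) * m powr (1 + 2 / ?d)))"
      by (simp add: field_simps)
    \<comment> \<open>Uses \<open>kappa d = d / (2 * (d + 2)) * c_TF d\<close>.\<close>
    also have "\<dots> = 2 * (2 * pi) ^ CARD('n) * (kappa CARD('n) * m powr (1 + 2 / ?d))"
      by (simp add: kappa_def c_TF_def field_simps)
    finally show ?thesis .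
  qed
  finally show ?thesis .
qed

lemma c_riesz_pos: "0 < s \<Longrightarrow> s < real d \<Longrightarrow> 0 < c_riesz d s"
  unfolding c_riesz_def by (intro mult_pos_pos divide_pos_pos Gamma_real_pos) auto

lemma kappa_pos: "d \<ge> 1 \<Longrightarrow> 0 < kappa d"
  unfolding kappa_def by (auto simp: sphere_area_def unit_ball_vol_neq_0 intro!: mult_pos_pos divide_pos_pos)

lemma lambda_HF_pos:
  assumes "0 < s" "s < real CARD('n::finite)" shows "0 < lambda_HF TYPE('n) s"
  unfolding lambda_HF_def Let_def sphere_area_def
  using assms interact_unit_ball_c_D(2)[OF assms]
  by (intro mult_pos_pos divide_pos_pos Gamma_real_pos) (auto simp: unit_ball_vol_neq_0)

lemma exchange_Fermi_ball:
  assumes s: "0 < s" "s < real CARD('n)" and m: "0 \<le> m"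
  shows "interact (riesz_ker (c_riesz CARD('n) s) (s - real CARD('n)))
      (indicator (ball (0::real^'n) (Fermi_radius TYPE('n) m))) (indicator (ball 0 (Fermi_radius TYPE('n) m))) =
    ennreal (2 * (2 * pi) ^ CARD('n) * (lambda_HF TYPE('n) s * m powr (1 + s / real CARD('n))))"
proof (cases "m = 0")
  case True
  then show ?thesis by (simp add: Fermi_radius_def interact_def)
next
  case False
  let ?\<omega> = "unit_ball_vol (real CARD('n))" and ?d = "real CARD('n)" and ?R = "Fermi_radius TYPE('n) m"
  let ?c = "c_riesz CARD('n) s" and ?a = "s - real CARD('n)"
  have m: "m > 0" using m False by simp
  have R: "?R > 0" by (rule Fermi_radius_pos[OF m])
  have \<omega>: "?\<omega> > 0" by simp
  have c0: "0 \<le> ?c" using c_riesz_pos[OF s] by simp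
  have bm: "indicator (ball (0::real^'n) ?R) \<in> borel_measurable borel" by (rule borel_measurable_indicator) simp
  have "interact (riesz_ker ?c ?a) (indicator (ball (0::real^'n) ?R)) (indicator (ball 0 ?R))
     = ennreal ?c * (ennreal (?R powr (2 * ?d + ?a)) * ennreal (c_D TYPE('n) s))"
    by (subst interact_riesz_ker_cmult[OF bm bm c0], subst interact_ball_scale[OF R]) (simp add: interact_unit_ball_c_D[OF s])
  also have "\<dots> = ennreal (?c * (?R powr (?d + s) * c_D TYPE('n) s))"
    using c0 interact_unit_ball_c_D(2)[OF s] by (simp add: ennreal_mult[symmetric] add.commute)
  also have "?c * (?R powr (?d + s) * c_D TYPE('n) s) = 2 * (2 * pi) ^ CARD('n) * (lambda_HF TYPE('n) s * m powr (1 + s / ?d))"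
  proof -
    have "?R powr (?d + s) = (2 * pi) powr (?d + s) * ((m / ?\<omega>) powr (1 / ?d)) powr (?d + s)"
      unfolding Fermi_radius_def by (rule powr_mult)
    also have "((m / ?\<omega>) powr (1 / ?d)) powr (?d + s) = (m / ?\<omega>) powr ((?d + s) / ?d)"
      by (simp add: powr_powr)
    also have "\<dots> = m powr ((?d + s) / ?d) * (1 / ?\<omega>) powr ((?d + s) / ?d)"
      using m \<omega> by (simp add: powr_divide)
    also have "(2 * pi) powr (?d + s) = (2 * pi) ^ CARD('n) * (2 * pi) powr s"
      by (simp add: powr_add powr_realpow)
    finally have Rp: "?R powr (?d + s) = (2 * pi) ^ CARD('n) * (2 * pi) powr s * (m powr ((?d + s) / ?d) * (1 / ?\<omega>) powr ((?d + s) / ?d))" .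
    have ex: "(?d + s) / ?d = 1 + s / ?d" by (simp add: field_simps)
    have cc: "?c * (2 * pi) powr s = 2 * (1 / (2 * pi powr (?d / 2 - s))) * (Gamma ((?d - s) / 2) / Gamma (s / 2))"
    proof -
      \<comment> \<open>The powers of 2 cancel:
        \<open>- d/2 + (d - s)/2 - s/2 + s = 0\<close>.\<close>
      have h: "1 / (2 * pi) powr (?d / 2) * (2 powr ((?d - s) / 2) / 2 powr (s / 2)) * (2 * pi) powr s = 1 / pi powr (?d / 2 - s)"
      proof -
        have e: "1 / (2 * pi) powr (?d / 2) = 2 powr (- (?d / 2)) * pi powr (- (?d / 2))"
          "1 / 2 powr (s / 2) = (2::real) powr (- (s / 2))" "(2 * pi) powr s = 2 powr s * pi powr s"
          by (simp_all add: powr_mult powr_minus_divide)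
        have "1 / (2 * pi) powr (?d / 2) * (2 powr ((?d - s) / 2) / 2 powr (s / 2)) * (2 * pi) powr s
          = 1 / (2 * pi) powr (?d / 2) * (2 powr ((?d - s) / 2) * (1 / 2 powr (s / 2))) * (2 * pi) powr s" by simp
        also have "\<dots> = (2 powr (- (?d / 2)) * 2 powr ((?d - s) / 2) * 2 powr (- (s / 2)) * 2 powr s) * (pi powr (- (?d / 2)) * pi powr s)"
          unfolding e by (simp only: mult_ac)
        also have "2 powr (- (?d / 2)) * 2 powr ((?d - s) / 2) * 2 powr (- (s / 2)) * 2 powr s = (1::real)"
          by (simp add: powr_add[symmetric] field_simps)
        also have "pi powr (- (?d / 2)) * pi powr s = 1 / pi powr (?d / 2 - s)"
          by (simp only: powr_add[symmetric] powr_minus_divide[symmetric]) (simp add: algebra_simps)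
        finally show ?thesis by simp
      qed
      have "?c * (2 * pi) powr s = (1 / (2 * pi) powr (?d / 2) * (2 powr ((?d - s) / 2) / 2 powr (s / 2)) * (2 * pi) powr s)
          * (Gamma ((?d - s) / 2) / Gamma (s / 2))"
        unfolding c_riesz_def by (simp only: mult_ac)
      then show ?thesis unfolding h by simp
    qed
    have card1: "1 \<le> CARD('n)" by (simp add: Suc_le_eq)
    have "?c * (?R powr (?d + s) * c_D TYPE('n) s) = (?c * (2 * pi) powr s) * (2 * pi) ^ CARD('n) * (m powr ((?d + s) / ?d) * (1 / ?\<omega>) powr ((?d + s) / ?d)) * c_D TYPE('n) s"
      unfolding Rp by (simp only: mult_ac)
    also have "\<dots> = 2 * (2 * pi) ^ CARD('n) * (lambda_HF TYPE('n) s * m powr (1 + s / ?d))"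
      unfolding cc lambda_HF_def Let_def sphere_area_ratio[OF card1] ex by (simp only: mult_ac)
    finally show ?thesis .
  qed
  finally show ?thesis .
qed

text \<open>Equality is characterised for the kinetic part alone: it already determines
  \<open>g\<close>, so the exchange bound needs no equality case.\<close>

lemma spinless_kinetic_exchange:
  fixes g :: "real^'n \<Rightarrow> real"
  assumes s: "0 < s" "s < real CARD('n)" and m: "0 \<le> m"
    and gm: "g \<in> borel_measurable borel" and g: "\<And>x. 0 \<le> g x" "\<And>x. g x \<le> 1"
    and mass: "(\<integral>\<^sup>+x. ennreal (g x) \<partial>lborel) = ennreal ((2 * pi) ^ CARD('n) * m)"
  shows "ennreal (2 * (2 * pi) ^ CARD('n) * (kappa CARD('n) * m powr (1 + 2 / real CARD('n)))) \<le> (\<integral>\<^sup>+k. ennreal ((norm k)\<^sup>2 * g k) \<partial>lborel)"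
    and "interact (riesz_ker (c_riesz CARD('n) s) (s - real CARD('n))) (\<lambda>x. ennreal (g x)) (\<lambda>x. ennreal (g x))
      \<le> ennreal (2 * (2 * pi) ^ CARD('n) * (lambda_HF TYPE('n) s * m powr (1 + s / real CARD('n))))"
    and "(\<integral>\<^sup>+k. ennreal ((norm k)\<^sup>2 * g k) \<partial>lborel) = ennreal (2 * (2 * pi) ^ CARD('n) * (kappa CARD('n) * m powr (1 + 2 / real CARD('n))))
      \<Longrightarrow> AE k in lborel. g k = indicator (cball 0 (Fermi_radius TYPE('n) m)) k"
proof -
  have mass': "(\<integral>\<^sup>+x. ennreal (g x) \<partial>lborel) = emeasure lborel (ball (0::real^'n) (Fermi_radius TYPE('n) m))"
    by (simp only: mass emeasure_Fermi_ball[OF m])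
  note bath = kinetic_bathtub[OF Fermi_radius_nonneg gm g mass', unfolded kinetic_Fermi_ball[OF m]]
  show "ennreal (2 * (2 * pi) ^ CARD('n) * (kappa CARD('n) * m powr (1 + 2 / real CARD('n)))) \<le> (\<integral>\<^sup>+k. ennreal ((norm k)\<^sup>2 * g k) \<partial>lborel)"
    by (rule bath(1))
  show "(\<integral>\<^sup>+k. ennreal ((norm k)\<^sup>2 * g k) \<partial>lborel) = ennreal (2 * (2 * pi) ^ CARD('n) * (kappa CARD('n) * m powr (1 + 2 / real CARD('n))))
      \<Longrightarrow> AE k in lborel. g k = indicator (cball 0 (Fermi_radius TYPE('n) m)) k"
    by (rule bath(2))
  have c0: "0 \<le> c_riesz CARD('n) s" using c_riesz_pos[OF s] by simp
  show "interact (riesz_ker (c_riesz CARD('n) s) (s - real CARD('n))) (\<lambda>x. ennreal (g x)) (\<lambda>x. ennreal (g x))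
      \<le> ennreal (2 * (2 * pi) ^ CARD('n) * (lambda_HF TYPE('n) s * m powr (1 + s / real CARD('n))))"
    unfolding exchange_Fermi_ball[OF s m, symmetric]
    using s c0 by (intro riesz_rearrangement_bathtub radial_kernel_riesz_ker riesz_ker_locally_integrable gm g mass') auto
qed

section \<open>Spin matrices\<close>

text \<open>The coordinates of a hermitian matrix in the Pauli basis: it is
  \<open>(tr2 A + pauli A \<cdot> \<sigma>) / 2\<close>, with eigenvalues \<open>(tr2 A \<plusminus> norm (pauli A)) / 2\<close>.\<close>
definition tr2 :: "complex^2^2 \<Rightarrow> real" where
  "tr2 A = Re (A $ 1 $ 1) + Re (A $ 2 $ 2)"

definition pauli :: "complex^2^2 \<Rightarrow> complex \<times> real" where
  "pauli A = (2 * A $ 1 $ 2, Re (A $ 1 $ 1) - Re (A $ 2 $ 2))"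

lemma hermitian_2:
  "hermitian A \<longleftrightarrow> Im (A $ 1 $ 1) = 0 \<and> Im (A $ 2 $ 2) = 0 \<and> A $ 2 $ 1 = cnj (A $ 1 $ 2)" for A :: "complex^2^2"
  unfolding hermitian_def conj_transpose_def vec_eq_iff forall_2 by (auto simp: complex_eq_iff)

lemma Re_trace_2: "Re (trace A) = tr2 A"
  by (simp add: trace_def sum_2 tr2_def)

lemma Re_trace_mult_2:
  assumes "hermitian A" "hermitian B"
  shows "Re (trace (A ** B)) = (tr2 A * tr2 B + pauli A \<bullet> pauli B) / 2"
  using assms unfolding hermitian_2
  by (simp add: trace_def matrix_matrix_mult_def sum_2 tr2_def pauli_def inner_prod_def inner_complex_def field_simps)

lemma hermitian_2_eqI:
  assumes "hermitian A" "hermitian B" "tr2 A = tr2 B" "pauli A = pauli B"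
  shows "A = B"
proof -
  have "A $ 1 $ 1 = B $ 1 $ 1" "A $ 2 $ 2 = B $ 2 $ 2" "A $ 1 $ 2 = B $ 1 $ 2" "A $ 2 $ 1 = B $ 2 $ 1"
    using assms unfolding hermitian_2 tr2_def pauli_def by (auto simp: complex_eq_iff)
  then show ?thesis by (simp add: vec_eq_iff forall_2)
qed

lemma hermitian_ket_bra: "hermitian (ket_bra \<nu>)"
  by (simp add: hermitian_def conj_transpose_def ket_bra_def vec_eq_iff mult.commute)

lemma cmod_sq: "(cmod z)\<^sup>2 = Re z * Re z + Im z * Im z"
  unfolding cmod_power2 by (simp add: power2_eq_square)

lemma norm_sq_complex2: "(norm \<nu>)\<^sup>2 = (cmod (\<nu> $ 1))\<^sup>2 + (cmod (\<nu> $ 2))\<^sup>2" for \<nu> :: "complex^2"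
  by (simp add: norm_vec_def L2_set_def sum_2)

lemma tr2_ket_bra: "tr2 (ket_bra \<nu>) = (norm \<nu>)\<^sup>2"
  unfolding norm_sq_complex2 by (simp add: tr2_def ket_bra_def cmod_sq)

lemma pauli_ket_bra: "pauli (ket_bra \<nu>) = (2 * (\<nu> $ 1 * cnj (\<nu> $ 2)), (cmod (\<nu> $ 1))\<^sup>2 - (cmod (\<nu> $ 2))\<^sup>2)"
  by (simp add: pauli_def ket_bra_def cmod_sq)

lemma norm_pauli_ket_bra: "norm (pauli (ket_bra \<nu>)) = (norm \<nu>)\<^sup>2"
proof -
  have "(norm (pauli (ket_bra \<nu>)))\<^sup>2 = (2 * (cmod (\<nu> $ 1) * cmod (\<nu> $ 2)))\<^sup>2 + ((cmod (\<nu> $ 1))\<^sup>2 - (cmod (\<nu> $ 2))\<^sup>2)\<^sup>2"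
    by (simp add: pauli_ket_bra norm_Pair norm_mult)
  also have "\<dots> = ((norm \<nu>)\<^sup>2)\<^sup>2"
    unfolding norm_sq_complex2 by (simp add: power2_eq_square algebra_simps)
  finally show ?thesis by (rule power2_eq_imp_eq) simp_all
qed

text \<open>Surjectivity of the Hopf map. The south pole is treated separately because the formula
  for the other points divides by the first spinor component.\<close>

lemma bloch_sphere:
  fixes n :: "complex \<times> real"
  assumes "norm n = 1"
  obtains \<nu> :: "complex^2" where "norm \<nu> = 1" "pauli (ket_bra \<nu>) = n"
proof -
  obtain z r where n: "n = (z, r)" by fastforce
  have zr: "(cmod z)\<^sup>2 + r\<^sup>2 = 1" using assms by (simp add: n norm_Pair)
  have "\<exists>\<nu> :: complex^2. pauli (ket_bra \<nu>) = n"
  proof (cases "r = -1")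
    case True
    then have "z = 0" using zr by simp
    then show ?thesis using True by (intro exI[of _ "vector [0, 1]"]) (simp add: n pauli_ket_bra)
  next
    case False
    have "r\<^sup>2 \<le> 1" using zr zero_le_power2[of "cmod z"] by linarith
    then have "\<bar>r\<bar> \<le> 1" by (simp add: abs_square_le_1)
    then have r: "1 + r > 0" using False by linarith
    \<comment> \<open>Phase freedom makes the first component real and positive. If \<open>r\<close>
      is the cosine of the polar angle, \<open>a\<close> is the cosine of half that angle.\<close>
    define a where "a = sqrt ((1 + r) / 2)"
    have a: "a > 0" "a\<^sup>2 = (1 + r) / 2" using r by (simp_all add: a_def)
    have "(cmod z)\<^sup>2 = (1 + r) * (1 - r)" using zr by (simp add: power2_eq_square algebra_simps)
    then have "(cmod z)\<^sup>2 / (4 * a\<^sup>2) = (1 - r) / 2" using r by (simp add: a(2) field_simps)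
    moreover have "(cmod (cnj z / (2 * complex_of_real a)))\<^sup>2 = (cmod z)\<^sup>2 / (4 * a\<^sup>2)"
      by (simp add: norm_divide norm_mult power_divide power_mult_distrib)
    ultimately have "(cmod (complex_of_real a))\<^sup>2 - (cmod (cnj z / (2 * complex_of_real a)))\<^sup>2 = r"
      using a(2) by (simp add: field_simps)
    moreover have "2 * (complex_of_real a * cnj (cnj z / (2 * complex_of_real a))) = z" using a by simp
    ultimately show ?thesis
      by (intro exI[of _ "vector [complex_of_real a, cnj z / (2 * complex_of_real a)]"]) (simp add: n pauli_ket_bra)
  qed
  then obtain \<nu> :: "complex^2" where \<nu>: "pauli (ket_bra \<nu>) = n" by blast
  have "(norm \<nu>)\<^sup>2 = 1" using norm_pauli_ket_bra[of \<nu>] assms \<nu> by simp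
  then have "norm \<nu> = 1" by (metis norm_ge_zero one_power2 power2_eq_imp_eq zero_le_one)
  then show thesis using \<nu> that by blast
qed

lemma quadratic_form_trace:
  fixes A :: "complex^2^2"
  assumes "hermitian A"
  shows "Re (\<Sum>i\<in>UNIV. \<Sum>j\<in>UNIV. cnj (v $ i) * A $ i $ j * v $ j) =
    (tr2 A * (norm v)\<^sup>2 + pauli A \<bullet> pauli (ket_bra v)) / 2"
proof -
  have "(\<Sum>i\<in>UNIV. \<Sum>j\<in>UNIV. cnj (v $ i) * A $ i $ j * v $ j) = trace (A ** ket_bra v)"
    by (simp add: trace_def matrix_matrix_mult_def ket_bra_def mult_ac)
  then show ?thesis by (simp add: Re_trace_mult_2[OF assms hermitian_ket_bra] tr2_ket_bra)
qed

lemma pos_semidef_2_iff: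
  fixes A :: "complex^2^2"
  shows "pos_semidef A \<longleftrightarrow> hermitian A \<and> norm (pauli A) \<le> tr2 A"
proof
  assume A: "pos_semidef A"
  then have h: "hermitian A" by (simp add: pos_semidef_def)
  have "norm (pauli A) \<le> tr2 A"
  proof -
    \<comment> \<open>The critical test vector is an eigenvector for the smaller eigenvalue, whose
      Bloch vector is opposite to \<open>pauli A\<close>.\<close>
    obtain n :: "complex \<times> real" where n: "norm n = 1" "pauli A \<bullet> n = - norm (pauli A)"
    proof (cases "pauli A = 0")
      case True
      show thesis by (rule that[of "(1, 0)"]) (simp_all add: True norm_Pair)
    next
      case False
      show thesis
        by (rule that[of "- sgn (pauli A)"])
           (use False in \<open>simp_all add: norm_sgn sgn_div_norm power2_norm_eq_inner[symmetric] power2_eq_square\<close>)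
    qed
    obtain \<nu> :: "complex^2" where \<nu>: "norm \<nu> = 1" "pauli (ket_bra \<nu>) = n" by (rule bloch_sphere[OF n(1)])
    have "0 \<le> Re (\<Sum>i\<in>UNIV. \<Sum>j\<in>UNIV. cnj (\<nu> $ i) * A $ i $ j * \<nu> $ j)" using A by (simp add: pos_semidef_def)
    then show ?thesis unfolding quadratic_form_trace[OF h] using \<nu> n by simp
  qed
  then show "hermitian A \<and> norm (pauli A) \<le> tr2 A" using h by simp
next
  assume A: "hermitian A \<and> norm (pauli A) \<le> tr2 A"
  show "pos_semidef A" unfolding pos_semidef_def
  proof (intro conjI allI)
    fix v :: "complex^2"
    have "- (pauli A \<bullet> pauli (ket_bra v)) \<le> norm (pauli A) * (norm v)\<^sup>2"
      using Cauchy_Schwarz_ineq2[of "pauli A" "pauli (ket_bra v)"] by (simp add: norm_pauli_ket_bra)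
    also have "\<dots> \<le> tr2 A * (norm v)\<^sup>2" using A by (intro mult_right_mono) auto
    finally show "0 \<le> Re (\<Sum>i\<in>UNIV. \<Sum>j\<in>UNIV. cnj (v $ i) * A $ i $ j * v $ j)"
      using A by (subst quadratic_form_trace) auto
  qed (use A in simp)
qed

lemma hermitian_one_minus: "hermitian (mat 1 - A) \<longleftrightarrow> hermitian A" for A :: "complex^2^2"
  unfolding hermitian_2 by (auto simp: mat_def complex_eq_iff)

lemma pauli_one_minus: "pauli (mat 1 - A) = - pauli A" "tr2 (mat 1 - A) = 2 - tr2 A"
  by (simp_all add: pauli_def tr2_def mat_def)

lemma spin_density_iff:
  "pos_semidef A \<and> pos_semidef (mat 1 - A) \<longleftrightarrow> hermitian A \<and> norm (pauli A) \<le> tr2 A \<and> norm (pauli A) \<le> 2 - tr2 A"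
  for A :: "complex^2^2"
  by (auto simp: pos_semidef_2_iff hermitian_one_minus pauli_one_minus)

text \<open>For a unit vector \<nu>, the hermitian matrix with eigenvalue \<open>a\<close> along
  \<nu> and \<open>b\<close> on the orthogonal complement.\<close>

definition spin_state :: "real \<Rightarrow> real \<Rightarrow> complex^2 \<Rightarrow> complex^2^2" where
  "spin_state a b \<nu> = b *\<^sub>R mat 1 + (a - b) *\<^sub>R ket_bra \<nu>"

lemma spin_state_nth: "spin_state a b \<nu> $ i $ j = of_real b * of_bool (i = j) + of_real (a - b) * (\<nu> $ i * cnj (\<nu> $ j))"
  by (simp add: spin_state_def mat_def ket_bra_def) (simp add: scaleR_conv_of_real)

lemma hermitian_spin_state: "hermitian (spin_state a b \<nu>)"
  unfolding hermitian_2 spin_state_nth by (simp add: mult.commute)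

lemma tr2_spin_state:
  assumes "norm \<nu> = 1" shows "tr2 (spin_state a b \<nu>) = a + b"
proof -
  have "tr2 (spin_state a b \<nu>) = 2 * b + (a - b) * ((cmod (\<nu> $ 1))\<^sup>2 + (cmod (\<nu> $ 2))\<^sup>2)"
    by (simp add: tr2_def spin_state_nth cmod_sq algebra_simps)
  then show ?thesis using assms by (simp flip: norm_sq_complex2)
qed

lemma pauli_spin_state: "pauli (spin_state a b \<nu>) = (a - b) *\<^sub>R pauli (ket_bra \<nu>)"
  unfolding pauli_ket_bra
  by (simp add: pauli_def spin_state_nth cmod_sq scaleR_conv_of_real algebra_simps)

lemma norm_pauli_spin_state: "norm \<nu> = 1 \<Longrightarrow> norm (pauli (spin_state a b \<nu>)) = \<bar>a - b\<bar>"
  by (simp add: pauli_spin_state norm_pauli_ket_bra)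

text \<open>The second column is the relevant one: \<open>gamma_mixed\<close> puts the share
  \<open>1 - t\<close>, the larger one for \<open>t < 1/2\<close>, in the second diagonal
  entry.\<close>

lemma SU2_column:
  assumes "U \<in> SU2" shows "norm (column 2 U) = 1"
proof -
  have "(conj_transpose U ** U) $ 2 $ 2 = 1" using assms by (simp add: SU2_def mat_def)
  then have "Re (cnj (U $ 1 $ 2) * U $ 1 $ 2 + cnj (U $ 2 $ 2) * U $ 2 $ 2) = 1"
    by (simp only: matrix_matrix_mult_def conj_transpose_def sum_2 vec_lambda_beta) simp
  then have "(norm (column 2 U))\<^sup>2 = 1"
    unfolding norm_sq_complex2 by (simp add: column_def cmod_sq)
  then show ?thesis by (metis norm_ge_zero one_power2 power2_eq_imp_eq zero_le_one)
qed

lemma SU2_with_column: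
  fixes \<nu> :: "complex^2"
  assumes "norm \<nu> = 1" obtains U where "U \<in> SU2" "column 2 U = \<nu>"
proof -
  \<comment> \<open>The first column is orthogonal to \<nu>, with its phase fixed by the
    determinant.\<close>
  define U :: "complex^2^2" where "U = vector [vector [cnj (\<nu> $ 2), \<nu> $ 1], vector [- cnj (\<nu> $ 1), \<nu> $ 2]]"
  have e: "U $ 1 $ 1 = cnj (\<nu> $ 2)" "U $ 1 $ 2 = \<nu> $ 1" "U $ 2 $ 1 = - cnj (\<nu> $ 1)" "U $ 2 $ 2 = \<nu> $ 2"
    by (simp_all add: U_def)
  have n: "\<nu> $ 1 * cnj (\<nu> $ 1) + \<nu> $ 2 * cnj (\<nu> $ 2) = 1"
  proof -
    have "complex_of_real ((cmod (\<nu> $ 1))\<^sup>2 + (cmod (\<nu> $ 2))\<^sup>2) = 1"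
      using norm_sq_complex2[of \<nu>] assms by (simp only: one_power2 of_real_1 flip: norm_sq_complex2) 
    then show ?thesis by (simp only: of_real_add complex_norm_square)
  qed
  have "U ** conj_transpose U = mat 1" "conj_transpose U ** U = mat 1"
    unfolding vec_eq_iff forall_2 matrix_matrix_mult_def conj_transpose_def mat_def
    using n by (simp_all add: sum_2 e algebra_simps)
  moreover have "det U = 1" using n by (simp add: det_2 e algebra_simps)
  ultimately have "U \<in> SU2" by (simp add: SU2_def)
  moreover have "column 2 U = \<nu>" by (simp add: column_def vec_eq_iff forall_2 e)
  ultimately show thesis by (rule that)
qed

section \<open>States built from two concentric balls\<close>

definition ball_state :: "real \<Rightarrow> real \<Rightarrow> complex^2 \<Rightarrow> real^'n \<Rightarrow> complex^2^2" where
  "ball_state a b \<nu> k = spin_state (indicator (cball 0 (Fermi_radius TYPE('n) a)) k) (indicator (cball 0 (Fermi_radius TYPE('n) b)) k) \<nu>"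

lemma gamma_mixed_ball_state:
  assumes U: "U \<in> SU2" and "0 \<le> t * \<rho>" "0 \<le> (1 - t) * \<rho>"
  shows "gamma_mixed t \<rho> U k = ball_state ((1 - t) * \<rho>) (t * \<rho>) (column 2 U) (k :: real^'n)"
proof -
  define a b where "a = (indicator (cball 0 (Fermi_radius TYPE('n) ((1 - t) * \<rho>))) k :: real)"
    and "b = (indicator (cball 0 (Fermi_radius TYPE('n) (t * \<rho>))) k :: real)"
  have D: "gamma_mixed t \<rho> U k = U ** vector [vector [of_real b, 0], vector [0, of_real a]] ** conj_transpose U"
    unfolding gamma_mixed_def Fermi_ball_iff[OF assms(2)] Fermi_ball_iff[OF assms(3)] a_def b_def
    by (simp add: indicator_def of_bool_def)
  have one: "U $ i $ 1 * cnj (U $ j $ 1) + U $ i $ 2 * cnj (U $ j $ 2) = of_bool (i = j)" for i j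
  proof -
    have "(U ** conj_transpose U) $ i $ j = of_bool (i = j)" using U by (simp add: SU2_def mat_def)
    then show ?thesis by (simp add: matrix_matrix_mult_def conj_transpose_def sum_2)
  qed
  have "gamma_mixed t \<rho> U k $ i $ j = spin_state a b (column 2 U) $ i $ j" for i j
  proof -
    have "gamma_mixed t \<rho> U k $ i $ j = of_real b * (U $ i $ 1 * cnj (U $ j $ 1)) + of_real a * (U $ i $ 2 * cnj (U $ j $ 2))"
      unfolding D by (simp add: matrix_matrix_mult_def conj_transpose_def sum_2 mult_ac)
    \<comment> \<open>Completeness of the columns eliminates the first one, so only the projection
      onto the second survives.\<close>
    also have "U $ i $ 1 * cnj (U $ j $ 1) = of_bool (i = j) - U $ i $ 2 * cnj (U $ j $ 2)"
      using one[of i j] by (simp add: algebra_simps)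
    finally show ?thesis by (simp add: spin_state_nth column_def algebra_simps)
  qed
  then show ?thesis by (simp add: vec_eq_iff ball_state_def a_def b_def)
qed

text \<open>Reduces the SU(2) orbit to a choice of unit vector. The ferromagnetic and paramagnetic
  states then appear as the endpoints \<open>t = 0\<close> and \<open>t = 1/2\<close> of one
  family.\<close>

lemma is_mixed_iff:
  assumes "0 \<le> t" "t \<le> 1" "0 \<le> \<rho>"
  shows "is_mixed t \<rho> \<gamma> \<longleftrightarrow>
    (\<exists>\<nu>. norm \<nu> = 1 \<and> (AE k in lebesgue. \<gamma> k = ball_state ((1 - t) * \<rho>) (t * \<rho>) \<nu> (k :: real^'n)))"
proof -
  have p: "0 \<le> t * \<rho>" "0 \<le> (1 - t) * \<rho>" using assms by auto
  show ?thesis unfolding is_mixed_def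
  proof safe
    fix U assume U: "U \<in> SU2" "AE k in lebesgue. \<gamma> k = gamma_mixed t \<rho> U k"
    then show "\<exists>\<nu>. norm \<nu> = 1 \<and> (AE k in lebesgue. \<gamma> k = ball_state ((1 - t) * \<rho>) (t * \<rho>) \<nu> k)"
      using SU2_column[OF U(1)] gamma_mixed_ball_state[OF U(1) p, where 'n='n] by (intro exI[of _ "column 2 U"]) auto
  next
    fix \<nu> :: "complex^2" assume \<nu>: "norm \<nu> = 1" "AE k in lebesgue. \<gamma> k = ball_state ((1 - t) * \<rho>) (t * \<rho>) \<nu> k"
    obtain U where "U \<in> SU2" "column 2 U = \<nu>" by (rule SU2_with_column[OF \<nu>(1)])
    then show "\<exists>U\<in>SU2. AE k in lebesgue. \<gamma> k = gamma_mixed t \<rho> U k"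
      using \<nu>(2) gamma_mixed_ball_state[OF _ p, where 'n='n] by (intro bexI[of _ U]) auto
  qed
qed

text \<open>A closed Fermi ball of density 0 is the single point 0 and not empty, so the identity
  holds only almost everywhere.\<close>

lemma ball_state_0:
  "AE k in lebesgue. ball_state \<rho> 0 \<nu> (k :: real^'n) = indicator (cball 0 (Fermi_radius TYPE('n) \<rho>)) k *\<^sub>R ket_bra \<nu>"
proof -
  have "AE k in (lborel :: (real^'n) measure). k \<noteq> 0" by (rule AE_lborel_singleton)
  then have "AE k in (lebesgue :: (real^'n) measure). k \<noteq> 0" by (rule AE_completion)
  then show ?thesis
    by eventually_elim (simp add: ball_state_def spin_state_def Fermi_radius_def indicator_def)
qed

lemma is_ferro_iff:
  assumes "0 \<le> \<rho>"
  shows "is_ferro \<rho> (\<gamma> :: real^'n \<Rightarrow> complex^2^2) \<longleftrightarrow> is_mixed 0 \<rho> \<gamma>"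
proof -
  have g: "gamma_ferro \<rho> \<nu> (k :: real^'n) = indicator (cball 0 (Fermi_radius TYPE('n) \<rho>)) k *\<^sub>R ket_bra \<nu>" for \<nu> k
    unfolding gamma_ferro_def Fermi_ball_iff[OF assms] by (simp add: indicator_def of_bool_def)
  have "(AE k in lebesgue. \<gamma> k = gamma_ferro \<rho> \<nu> k) \<longleftrightarrow> (AE k in lebesgue. \<gamma> k = ball_state \<rho> 0 \<nu> k)" for \<nu>
  proof
    assume "AE k in lebesgue. \<gamma> k = gamma_ferro \<rho> \<nu> k"
    then show "AE k in lebesgue. \<gamma> k = ball_state \<rho> 0 \<nu> k"
      using ball_state_0[of \<rho> \<nu>, where 'n='n] unfolding g by eventually_elim simp
  next
    assume "AE k in lebesgue. \<gamma> k = ball_state \<rho> 0 \<nu> k"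
    then show "AE k in lebesgue. \<gamma> k = gamma_ferro \<rho> \<nu> k"
      using ball_state_0[of \<rho> \<nu>, where 'n='n] unfolding g by eventually_elim simp
  qed
  then show ?thesis using assms by (simp add: is_ferro_def is_mixed_iff)
qed

lemma is_para_iff:
  assumes "0 \<le> \<rho>"
  shows "is_para \<rho> (\<gamma> :: real^'n \<Rightarrow> complex^2^2) \<longleftrightarrow> is_mixed (1/2) \<rho> \<gamma>"
proof -
  have h: "0 \<le> \<rho> / 2" using assms by simp
  \<comment> \<open>With equal radii the matrix is scalar and \<nu> drops out.\<close>
  have g: "gamma_para \<rho> (k :: real^'n) = ball_state (\<rho> / 2) (\<rho> / 2) \<nu> k" for \<nu> k
    unfolding gamma_para_def Fermi_ball_iff[OF h] by (simp add: ball_state_def spin_state_def indicator_def of_bool_def)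
  obtain \<nu> :: "complex^2" where "norm \<nu> = 1" by (rule bloch_sphere[of "(1, 0)"]) (auto simp: norm_Pair)
  then show ?thesis using assms by (auto simp: is_para_def is_mixed_iff g[symmetric])
qed

section \<open>Reduction of the energy to the spinless problem\<close>

text \<open>Lebesgue measure on the product is the completion of \<open>lborel\<close> and not a
  product of completions, so the exceptional set is first enlarged to a Borel null set.\<close>

lemma AE_lebesgue_fst_snd:
  fixes P :: "'a::euclidean_space \<Rightarrow> bool"
  assumes "AE k in lebesgue. P k"
  shows "AE p in (lebesgue :: ('a \<times> 'a) measure). P (fst p) \<and> P (snd p)"
proof -
  have "AE k in lborel. P k" using assms by (simp add: AE_completion_iff)
  then obtain N where N: "{k. \<not> P k} \<subseteq> N" "N \<in> null_sets lborel"
    by (auto simp: eventually_ae_filter)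
  have Ns: "N \<in> sets borel" "emeasure lborel N = 0" using N(2) by (auto simp: null_sets_def)
  have "N \<times> UNIV \<in> null_sets (lborel :: ('a \<times> 'a) measure)" "UNIV \<times> N \<in> null_sets (lborel :: ('a \<times> 'a) measure)"
    using Ns by (auto simp: null_sets_def lborel.emeasure_pair_measure_Times simp flip: lborel_prod)
  then have "N \<times> UNIV \<union> UNIV \<times> N \<in> null_sets (lborel :: ('a \<times> 'a) measure)" by auto
  then have "AE p in (lborel :: ('a \<times> 'a) measure). p \<notin> N \<times> UNIV \<union> UNIV \<times> N" by (rule AE_not_in)
  then have "AE p in (lborel :: ('a \<times> 'a) measure). P (fst p) \<and> P (snd p)"
    by eventually_elim (use N(1) in auto)
  then show ?thesis by (simp add: AE_completion_iff)
qed

lemma HF_energy_cong_AE: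
  assumes "AE k in lebesgue. \<gamma> k = \<gamma>' k"
  shows "HF_energy w \<gamma> = HF_energy w \<gamma>'"
proof -
  have "(\<integral>\<^sup>+k. ennreal ((norm k)\<^sup>2 * Re (trace (\<gamma> k))) \<partial>lebesgue) = (\<integral>\<^sup>+k. ennreal ((norm k)\<^sup>2 * Re (trace (\<gamma>' k))) \<partial>lebesgue)"
    using assms by (intro nn_integral_cong_AE) (auto elim: eventually_mono)
  moreover have "(\<integral>\<^sup>+p. ennreal (w (fst p - snd p) * Re (trace (\<gamma> (fst p) ** \<gamma> (snd p)))) \<partial>lebesgue) =
     (\<integral>\<^sup>+p. ennreal (w (fst p - snd p) * Re (trace (\<gamma>' (fst p) ** \<gamma>' (snd p)))) \<partial>lebesgue)"
    using AE_lebesgue_fst_snd[OF assms] by (intro nn_integral_cong_AE) (auto elim: eventually_mono)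
  ultimately show ?thesis by (simp add: HF_energy_def)
qed

lemma lebesgue_measurable_cong_AE:
  fixes f g :: "'a::euclidean_space \<Rightarrow> 'b::topological_space"
  assumes f: "f \<in> borel_measurable lebesgue" and ae: "AE x in lebesgue. f x = g x"
  shows "g \<in> borel_measurable lebesgue"
proof (rule measurableI)
  fix A :: "'b set" assume A: "A \<in> sets borel"
  have "f -` A \<inter> space lebesgue \<in> sets lebesgue" using f A by (rule measurable_sets)
  then show "g -` A \<inter> space lebesgue \<in> sets lebesgue"
    by (rule completion.in_sets_AE[rotated]) (use ae in \<open>auto elim: eventually_mono\<close>)
qed simp

text \<open>Tonelli is applied to \<open>lborel\<close>, so the Pauli coordinates have to be Borel.
  Requiring the bounds everywhere keeps all integrands nonnegative without exceptional sets.\<close>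

definition borel_state :: "(real^'n \<Rightarrow> complex^2^2) \<Rightarrow> bool" where
  "borel_state \<gamma> \<longleftrightarrow> (\<lambda>k. tr2 (\<gamma> k)) \<in> borel_measurable borel \<and> (\<lambda>k. pauli (\<gamma> k)) \<in> borel_measurable borel \<and>
     (\<forall>k. hermitian (\<gamma> k) \<and> norm (pauli (\<gamma> k)) \<le> tr2 (\<gamma> k) \<and> norm (pauli (\<gamma> k)) \<le> 2 - tr2 (\<gamma> k))"

definition spin_matrix :: "real \<Rightarrow> complex \<times> real \<Rightarrow> complex^2^2" where
  "spin_matrix a v = vector [vector [of_real ((a + snd v) / 2), fst v / 2], vector [cnj (fst v) / 2, of_real ((a - snd v) / 2)]]"

lemma spin_matrix: "hermitian (spin_matrix a v)" "tr2 (spin_matrix a v) = a" "pauli (spin_matrix a v) = v"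
  unfolding hermitian_2 tr2_def pauli_def spin_matrix_def by (simp_all add: field_simps prod_eq_iff)

lemma admissible_borel_state:
  fixes \<gamma> :: "real^'n \<Rightarrow> complex^2^2"
  assumes "admissible \<rho> \<gamma>"
  obtains \<gamma>' where "borel_state \<gamma>'" "AE k in lebesgue. \<gamma> k = \<gamma>' k"
    "(\<integral>\<^sup>+k. ennreal (tr2 (\<gamma>' k)) \<partial>lborel) = ennreal ((2 * pi) ^ CARD('n) * \<rho>)"
proof -
  have gm: "\<gamma> \<in> borel_measurable lebesgue" and ae: "AE k in lebesgue. pos_semidef (\<gamma> k) \<and> pos_semidef (mat 1 - \<gamma> k)"
    and int: "integrable lebesgue (\<lambda>k. Re (trace (\<gamma> k)))" "1 / (2 * pi) ^ CARD('n) * (\<integral>k. Re (trace (\<gamma> k)) \<partial>lebesgue) = \<rho>"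
    using assms by (auto simp: admissible_def)
  have cont: "continuous_on UNIV tr2" "continuous_on UNIV (\<lambda>A. Re (fst (pauli A)))"
     "continuous_on UNIV (\<lambda>A. Im (fst (pauli A)))" "continuous_on UNIV (\<lambda>A. snd (pauli A))"
    unfolding tr2_def pauli_def by (auto intro!: continuous_intros)
  have meas: "(\<lambda>k. f (\<gamma> k)) \<in> borel_measurable lebesgue" if "continuous_on UNIV f" for f :: "complex^2^2 \<Rightarrow> real"
    using gm borel_measurable_continuous_onI[OF that] by (rule measurable_compose)
  obtain a x y z where b: "a \<in> borel_measurable lborel" "x \<in> borel_measurable lborel" "y \<in> borel_measurable lborel" "z \<in> borel_measurable lborel"
    and e: "AE k in lborel. tr2 (\<gamma> k) = a k" "AE k in lborel. Re (fst (pauli (\<gamma> k))) = x k"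
      "AE k in lborel. Im (fst (pauli (\<gamma> k))) = y k" "AE k in lborel. snd (pauli (\<gamma> k)) = z k"
    using cont[THEN meas, THEN completion_ex_borel_measurable_real] by blast
  define v where "v k = (Complex (x k) (y k), z k)" for k
  have [measurable]: "a \<in> borel_measurable borel" "x \<in> borel_measurable borel" "y \<in> borel_measurable borel" "z \<in> borel_measurable borel"
    using b by simp_all
  have [measurable]: "v \<in> borel_measurable borel"
  proof -
    have "v = (\<lambda>k. (of_real (x k) + \<i> * of_real (y k), z k))" by (auto simp: v_def complex_eq_iff)
    moreover have "\<dots> \<in> borel_measurable borel" unfolding borel_prod[symmetric] by measurable
    ultimately show ?thesis by simp
  qed
  \<comment> \<open>Where the Borel versions of the coordinates violate the constraint, a null set,
    the state is replaced by the zero matrix.\<close>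
  define c where "c k \<longleftrightarrow> norm (v k) \<le> a k \<and> norm (v k) \<le> 2 - a k" for k
  have [measurable]: "Measurable.pred borel c" unfolding c_def[abs_def] by measurable
  define \<gamma>' where "\<gamma>' k = spin_matrix (if c k then a k else 0) (if c k then v k else 0)" for k
  show thesis
  proof (rule that)
    show "borel_state \<gamma>'" unfolding borel_state_def \<gamma>'_def spin_matrix
    proof (intro conjI allI)
      show "(\<lambda>k. if c k then a k else 0) \<in> borel_measurable borel" by measurable
      show "(\<lambda>k. if c k then v k else 0) \<in> borel_measurable borel" by measurable
    qed (auto simp: c_def spin_matrix(1))
    have "AE k in lborel. \<gamma> k = \<gamma>' k"
      using e ae[unfolded AE_completion_iff]
    proof eventually_elim
      case (elim k)
      have "hermitian (\<gamma> k)" "norm (pauli (\<gamma> k)) \<le> tr2 (\<gamma> k)" "norm (pauli (\<gamma> k)) \<le> 2 - tr2 (\<gamma> k)"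
        using elim(5) unfolding spin_density_iff by auto
      moreover have "pauli (\<gamma> k) = v k" using elim by (auto simp: v_def prod_eq_iff complex_eq_iff)
      ultimately show ?case using elim(1)
        by (intro hermitian_2_eqI) (auto simp: \<gamma>'_def spin_matrix c_def)
    qed
    then show ae': "AE k in lebesgue. \<gamma> k = \<gamma>' k" by (rule AE_completion)
    have "(\<integral>\<^sup>+k. ennreal (tr2 (\<gamma>' k)) \<partial>lborel) = (\<integral>\<^sup>+k. ennreal (Re (trace (\<gamma> k))) \<partial>lebesgue)"
      unfolding nn_integral_completion[symmetric, of lborel]
      using ae' by (intro nn_integral_cong_AE) (auto simp: Re_trace_2 elim: eventually_mono)
    also have "\<dots> = ennreal (\<integral>k. Re (trace (\<gamma> k)) \<partial>lebesgue)"
    proof (rule nn_integral_eq_integral[OF int(1)])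
      show "AE k in lebesgue. 0 \<le> Re (trace (\<gamma> k))"
        using ae
      proof eventually_elim
        case (elim k)
        then have "norm (pauli (\<gamma> k)) \<le> tr2 (\<gamma> k)" unfolding spin_density_iff by simp
        then show ?case using norm_ge_zero[of "pauli (\<gamma> k)"] unfolding Re_trace_2 by linarith
      qed
    qed
    also have "(\<integral>k. Re (trace (\<gamma> k)) \<partial>lebesgue) = (2 * pi) ^ CARD('n) * \<rho>"
      using int(2) by (simp add: field_simps)
    finally show "(\<integral>\<^sup>+k. ennreal (tr2 (\<gamma>' k)) \<partial>lborel) = ennreal ((2 * pi) ^ CARD('n) * \<rho>)" .
  qed
qed

definition upper_eig :: "(real^'n \<Rightarrow> complex^2^2) \<Rightarrow> real^'n \<Rightarrow> real" where
  "upper_eig \<gamma> k = (tr2 (\<gamma> k) + norm (pauli (\<gamma> k))) / 2"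

definition lower_eig :: "(real^'n \<Rightarrow> complex^2^2) \<Rightarrow> real^'n \<Rightarrow> real" where
  "lower_eig \<gamma> k = (tr2 (\<gamma> k) - norm (pauli (\<gamma> k))) / 2"

abbreviation self_interact :: "real \<Rightarrow> (real^'n \<Rightarrow> real) \<Rightarrow> ennreal" where
  "self_interact s f \<equiv> interact (riesz_ker (c_riesz CARD('n) s) (s - real CARD('n))) (\<lambda>x. ennreal (f x)) (\<lambda>x. ennreal (f x))"

text \<open>The Cauchy-Schwarz defect of two Pauli vectors, weighted by the kernel: the exchange
  energy lost by not aligning the spins.\<close>

definition misalignment :: "(real^'n \<Rightarrow> complex^2^2) \<Rightarrow> real \<Rightarrow> real^'n \<Rightarrow> real^'n \<Rightarrow> real" where
  "misalignment \<gamma> s x y = riesz s (x - y) * ((norm (pauli (\<gamma> x)) * norm (pauli (\<gamma> y)) - pauli (\<gamma> x) \<bullet> pauli (\<gamma> y)) / 2)"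

lemma riesz_nonneg: "0 < s \<Longrightarrow> s < real CARD('n::finite) \<Longrightarrow> 0 \<le> riesz s (x :: real^'n)"
  using c_riesz_pos[of s "CARD('n)"] by (simp add: riesz_def)

lemma misalignment_nonneg: "0 < s \<Longrightarrow> s < real CARD('n) \<Longrightarrow> 0 \<le> misalignment \<gamma> s (x :: real^'n) y"
  unfolding misalignment_def by (intro mult_nonneg_nonneg riesz_nonneg) (auto simp: norm_cauchy_schwarz)

context
  fixes \<gamma> :: "real^'n \<Rightarrow> complex^2^2"
  assumes \<gamma>: "borel_state \<gamma>"
begin

lemma borel_state_measurable [measurable]:
  "(\<lambda>k. tr2 (\<gamma> k)) \<in> borel_measurable borel" "(\<lambda>k. pauli (\<gamma> k)) \<in> borel_measurable borel"
  "upper_eig \<gamma> \<in> borel_measurable borel" "lower_eig \<gamma> \<in> borel_measurable borel"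
proof -
  show [measurable]: "(\<lambda>k. tr2 (\<gamma> k)) \<in> borel_measurable borel" "(\<lambda>k. pauli (\<gamma> k)) \<in> borel_measurable borel"
    using \<gamma> by (auto simp: borel_state_def)
  show "upper_eig \<gamma> \<in> borel_measurable borel" "lower_eig \<gamma> \<in> borel_measurable borel"
    unfolding upper_eig_def[abs_def] lower_eig_def[abs_def] by measurable
qed

lemma eig_bounds: "0 \<le> upper_eig \<gamma> k" "upper_eig \<gamma> k \<le> 1" "0 \<le> lower_eig \<gamma> k" "lower_eig \<gamma> k \<le> 1" "lower_eig \<gamma> k \<le> upper_eig \<gamma> k"
proof -
  have h: "norm (pauli (\<gamma> k)) \<le> tr2 (\<gamma> k)" "norm (pauli (\<gamma> k)) \<le> 2 - tr2 (\<gamma> k)" "0 \<le> norm (pauli (\<gamma> k))"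
    using \<gamma> by (auto simp: borel_state_def)
  have "0 \<le> (T + P) / 2 \<and> (T + P) / 2 \<le> 1 \<and> 0 \<le> (T - P) / 2 \<and> (T - P) / 2 \<le> 1 \<and> (T - P) / 2 \<le> (T + P) / 2"
    if "P \<le> T" "P \<le> 2 - T" "0 \<le> P" for T P :: real
    using that by (auto simp: field_simps)
  from this[OF h] show "0 \<le> upper_eig \<gamma> k" "upper_eig \<gamma> k \<le> 1" "0 \<le> lower_eig \<gamma> k" "lower_eig \<gamma> k \<le> 1" "lower_eig \<gamma> k \<le> upper_eig \<gamma> k"
    by (auto simp: upper_eig_def lower_eig_def)
qed

lemma eig_sum: "upper_eig \<gamma> k + lower_eig \<gamma> k = tr2 (\<gamma> k)" "upper_eig \<gamma> k - lower_eig \<gamma> k = norm (pauli (\<gamma> k))"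
  by (simp_all add: upper_eig_def lower_eig_def field_simps)

lemma kinetic_borel_state:
  "(\<integral>\<^sup>+k. ennreal ((norm k)\<^sup>2 * Re (trace (\<gamma> k))) \<partial>lebesgue) =
    (\<integral>\<^sup>+k. ennreal ((norm k)\<^sup>2 * upper_eig \<gamma> k) \<partial>lborel) + (\<integral>\<^sup>+k. ennreal ((norm k)\<^sup>2 * lower_eig \<gamma> k) \<partial>lborel)"
proof -
  have "(\<integral>\<^sup>+k. ennreal ((norm k)\<^sup>2 * Re (trace (\<gamma> k))) \<partial>lebesgue) =
     (\<integral>\<^sup>+k. ennreal ((norm k)\<^sup>2 * upper_eig \<gamma> k) + ennreal ((norm k)\<^sup>2 * lower_eig \<gamma> k) \<partial>lborel)"
    unfolding nn_integral_completion Re_trace_2 eig_sum(1)[symmetric]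
    by (intro nn_integral_cong) (simp add: eig_bounds distrib_left)
  then show ?thesis by (simp add: nn_integral_add)
qed

lemma misalignment_measurable: "(\<lambda>(x, y). misalignment \<gamma> s x y) \<in> borel_measurable (borel \<Otimes>\<^sub>M borel)"
  unfolding misalignment_def riesz_def case_prod_beta by measurable

text \<open>In Pauli coordinates \<open>tr (\<gamma> \<gamma>')\<close> differs from \<open>\<lambda>\<^sub>1 \<lambda>\<^sub>1' + \<lambda>\<^sub>2 \<lambda>\<^sub>2'\<close> by \<open>(|v| |v'| - v \<cdot> v') / 2\<close>.\<close>
lemma exchange_borel_state:
  assumes s: "0 < s" "s < real CARD('n)"
  shows "(\<integral>\<^sup>+p. ennreal (riesz s (fst p - snd p) * Re (trace (\<gamma> (fst p) ** \<gamma> (snd p)))) \<partial>lebesgue) +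
      (\<integral>\<^sup>+x. (\<integral>\<^sup>+y. ennreal (misalignment \<gamma> s x y) \<partial>lborel) \<partial>lborel)
    = self_interact s (upper_eig \<gamma>) + self_interact s (lower_eig \<gamma>)"
proof -
  note [measurable] = misalignment_measurable
  have c0: "0 \<le> c_riesz CARD('n) s" using c_riesz_pos[OF s] by simp
  have h: "hermitian (\<gamma> k)" for k using \<gamma> by (simp add: borel_state_def)
  define f where "f x y = riesz s (x - y) * ((tr2 (\<gamma> x) * tr2 (\<gamma> y) + pauli (\<gamma> x) \<bullet> pauli (\<gamma> y)) / 2)" for x y
  have f0: "0 \<le> f x y" for x y
  proof -
    have b: "norm (pauli (\<gamma> k)) \<le> tr2 (\<gamma> k)" for k using \<gamma> by (simp add: borel_state_def)
    have b0: "0 \<le> tr2 (\<gamma> k)" for k by (rule order_trans[OF norm_ge_zero b])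
    have "- (pauli (\<gamma> x) \<bullet> pauli (\<gamma> y)) \<le> norm (pauli (\<gamma> x)) * norm (pauli (\<gamma> y))"
      using Cauchy_Schwarz_ineq2[of "pauli (\<gamma> x)" "pauli (\<gamma> y)"] by simp
    also have "\<dots> \<le> tr2 (\<gamma> x) * tr2 (\<gamma> y)" by (intro mult_mono b b0) simp
    finally show ?thesis unfolding f_def using riesz_nonneg[OF s, of "x - y"] by (intro mult_nonneg_nonneg) auto
  qed
  have fm[measurable]: "(\<lambda>(x, y). f x y) \<in> borel_measurable (borel \<Otimes>\<^sub>M borel)"
    unfolding f_def riesz_def case_prod_beta by measurable
  have "(\<integral>\<^sup>+p. ennreal (riesz s (fst p - snd p) * Re (trace (\<gamma> (fst p) ** \<gamma> (snd p)))) \<partial>lebesgue) = (\<integral>\<^sup>+p. ennreal (f (fst p) (snd p)) \<partial>lborel)"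
    unfolding nn_integral_completion Re_trace_mult_2[OF h h] by (simp add: f_def)
  also have "\<dots> = (\<integral>\<^sup>+p. ennreal (f (fst p) (snd p)) \<partial>(lborel \<Otimes>\<^sub>M lborel))" by (simp add: lborel_prod)
  also have "\<dots> = (\<integral>\<^sup>+x. (\<integral>\<^sup>+y. ennreal (f x y) \<partial>lborel) \<partial>lborel)"
    by (subst lborel.nn_integral_fst[symmetric]) (use fm in \<open>auto simp: case_prod_beta\<close>)
  finally have X: "(\<integral>\<^sup>+p. ennreal (riesz s (fst p - snd p) * Re (trace (\<gamma> (fst p) ** \<gamma> (snd p)))) \<partial>lebesgue)
     = (\<integral>\<^sup>+x. (\<integral>\<^sup>+y. ennreal (f x y) \<partial>lborel) \<partial>lborel)" .
  have sum: "(\<integral>\<^sup>+x. (\<integral>\<^sup>+y. F x y \<partial>lborel) \<partial>lborel) + (\<integral>\<^sup>+x. (\<integral>\<^sup>+y. G x y \<partial>lborel) \<partial>lborel)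
     = (\<integral>\<^sup>+x. (\<integral>\<^sup>+y. F x y + G x y \<partial>lborel) \<partial>lborel)"
    if [measurable]: "(\<lambda>(x, y). F x y) \<in> borel_measurable (borel \<Otimes>\<^sub>M borel)" "(\<lambda>(x, y). G x y) \<in> borel_measurable (borel \<Otimes>\<^sub>M borel)"
    for F G :: "real^'n \<Rightarrow> real^'n \<Rightarrow> ennreal"
  proof -
    have [measurable]: "F x \<in> borel_measurable borel" "G x \<in> borel_measurable borel" for x
      using measurable_Pair2[OF that(1), of x] measurable_Pair2[OF that(2), of x] by simp_all
    show ?thesis by (simp add: nn_integral_add)
  qed
  have I: "self_interact s l = (\<integral>\<^sup>+x. (\<integral>\<^sup>+y. ennreal (riesz s (x - y) * (l x * l y)) \<partial>lborel) \<partial>lborel)"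
    if [measurable]: "l \<in> borel_measurable borel" and l: "\<And>k. 0 \<le> l k" for l :: "real^'n \<Rightarrow> real"
    unfolding interact_riesz_ker[OF measurable_compose[OF that(1) measurable_ennreal] measurable_compose[OF that(1) measurable_ennreal]]
    using l c0 by (intro nn_integral_cong) (simp add: riesz_def ennreal_mult[symmetric] mult_ac)
  have [measurable]: "(\<lambda>(x, y). ennreal (riesz s (x - y) * (l x * l y))) \<in> borel_measurable (borel \<Otimes>\<^sub>M borel)"
    if [measurable]: "l \<in> borel_measurable borel" for l :: "real^'n \<Rightarrow> real"
    unfolding riesz_def case_prod_beta by measurable
  have "(\<integral>\<^sup>+x. (\<integral>\<^sup>+y. ennreal (f x y) \<partial>lborel) \<partial>lborel) + (\<integral>\<^sup>+x. (\<integral>\<^sup>+y. ennreal (misalignment \<gamma> s x y) \<partial>lborel) \<partial>lborel)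
     = (\<integral>\<^sup>+x. (\<integral>\<^sup>+y. ennreal (f x y) + ennreal (misalignment \<gamma> s x y) \<partial>lborel) \<partial>lborel)"
    by (rule sum) measurable
  also have "\<dots> = (\<integral>\<^sup>+x. (\<integral>\<^sup>+y. ennreal (riesz s (x - y) * (upper_eig \<gamma> x * upper_eig \<gamma> y)) + ennreal (riesz s (x - y) * (lower_eig \<gamma> x * lower_eig \<gamma> y)) \<partial>lborel) \<partial>lborel)"
  proof (intro nn_integral_cong)
    fix x y :: "real^'n"
    have "f x y + misalignment \<gamma> s x y = riesz s (x - y) * (upper_eig \<gamma> x * upper_eig \<gamma> y) + riesz s (x - y) * (lower_eig \<gamma> x * lower_eig \<gamma> y)"
      unfolding f_def misalignment_def upper_eig_def lower_eig_def by (simp add: field_simps)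
    then show "ennreal (f x y) + ennreal (misalignment \<gamma> s x y) = ennreal (riesz s (x - y) * (upper_eig \<gamma> x * upper_eig \<gamma> y)) + ennreal (riesz s (x - y) * (lower_eig \<gamma> x * lower_eig \<gamma> y))"
      using f0[of x y] misalignment_nonneg[OF s, of \<gamma> x y] riesz_nonneg[OF s, of "x - y"] eig_bounds[of x] eig_bounds[of y]
      by (simp flip: ennreal_plus)
  qed
  also have "\<dots> = self_interact s (upper_eig \<gamma>) + self_interact s (lower_eig \<gamma>)"
    unfolding I[OF borel_state_measurable(3) eig_bounds(1)] I[OF borel_state_measurable(4) eig_bounds(3)]
    by (rule sum[symmetric]) measurable
  finally show ?thesis by (simp only: X)
qed

end

lemma interact_cong_AE:
  assumes "AE x in lborel. f x = f' x" "AE x in lborel. g x = g' x"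
  shows "interact W f g = interact W f' g'"
proof -
  have "(\<integral>\<^sup>+y. f x * g y * W (norm (x - y)) \<partial>lborel) = (\<integral>\<^sup>+y. f x * g' y * W (norm (x - y)) \<partial>lborel)" for x
    using assms(2) by (intro nn_integral_cong_AE) (auto elim: eventually_mono)
  then have "interact W f g = (\<integral>\<^sup>+x. \<integral>\<^sup>+y. f x * g' y * W (norm (x - y)) \<partial>lborel \<partial>lborel)"
    by (simp add: interact_def)
  also have "\<dots> = interact W f' g'"
    unfolding interact_def using assms(1) by (intro nn_integral_cong_AE) (auto elim: eventually_mono)
  finally show ?thesis .
qed

section \<open>The two-ball energy as lower bound and as attained value\<close>

definition split_energy :: "'n::finite itself \<Rightarrow> real \<Rightarrow> real \<Rightarrow> real \<Rightarrow> real" where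
  "split_energy T s \<rho> t = spinless_energy T s ((1 - t) * \<rho>) + spinless_energy T s (t * \<rho>)"

lemma HF_energy_real:
  fixes \<gamma> :: "real^'n \<Rightarrow> complex^2^2"
  assumes "(\<integral>\<^sup>+k. ennreal ((norm k)\<^sup>2 * Re (trace (\<gamma> k))) \<partial>lebesgue) = ennreal (2 * (2 * pi) ^ CARD('n) * a)"
    and "(\<integral>\<^sup>+p. ennreal (w (fst p - snd p) * Re (trace (\<gamma> (fst p) ** \<gamma> (snd p)))) \<partial>lebesgue) = ennreal (2 * (2 * pi) ^ CARD('n) * b)"
    and "0 \<le> a" "0 \<le> b"
  shows "HF_energy w \<gamma> = ereal (a - b)"
  using assms(3,4) unfolding HF_energy_def assms(1,2) by (simp add: enn2ereal_ennreal)

lemma HF_energy_infinite: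
  fixes \<gamma> :: "real^'n \<Rightarrow> complex^2^2"
  assumes "(\<integral>\<^sup>+k. ennreal ((norm k)\<^sup>2 * Re (trace (\<gamma> k))) \<partial>lebesgue) = \<infinity>"
    and "(\<integral>\<^sup>+p. ennreal (w (fst p - snd p) * Re (trace (\<gamma> (fst p) ** \<gamma> (snd p)))) \<partial>lebesgue) = ennreal b" "0 \<le> b"
  shows "HF_energy w \<gamma> = \<infinity>"
  using assms(3) unfolding HF_energy_def assms(1,2) by (simp add: enn2ereal_ennreal)

text \<open>One point \<open>x\<close> with nonzero Pauli vector and vanishing inner integral serves
  as reference. Positivity of the kernel and the equality case of Cauchy-Schwarz align almost every
  other Pauli vector with it.\<close>

lemma aligned_spin_state:
  fixes \<gamma> :: "real^'n \<Rightarrow> complex^2^2"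
  assumes \<gamma>: "borel_state \<gamma>" and s: "0 < s" "s < real CARD('n)"
    and D: "(\<integral>\<^sup>+x. (\<integral>\<^sup>+y. ennreal (misalignment \<gamma> s x y) \<partial>lborel) \<partial>lborel) = 0"
  shows "\<exists>\<nu>. norm \<nu> = 1 \<and> (AE k in lborel. \<gamma> k = spin_state (upper_eig \<gamma> k) (lower_eig \<gamma> k) \<nu>)"
proof -
  note [measurable] = misalignment_measurable[OF \<gamma>]
  have h: "hermitian (\<gamma> k)" for k using \<gamma> unfolding borel_state_def by blast
  have eqI: "\<gamma> k = spin_state (upper_eig \<gamma> k) (lower_eig \<gamma> k) \<nu>"
    if "norm \<nu> = 1" "pauli (\<gamma> k) = norm (pauli (\<gamma> k)) *\<^sub>R pauli (ket_bra \<nu>)" for k \<nu>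
  proof (intro hermitian_2_eqI h hermitian_spin_state)
    show "tr2 (\<gamma> k) = tr2 (spin_state (upper_eig \<gamma> k) (lower_eig \<gamma> k) \<nu>)"
      unfolding tr2_spin_state[OF that(1)] eig_sum(1)[OF \<gamma>] ..
    show "pauli (\<gamma> k) = pauli (spin_state (upper_eig \<gamma> k) (lower_eig \<gamma> k) \<nu>)"
      unfolding pauli_spin_state eig_sum(2)[OF \<gamma>] by (rule that(2))
  qed
  show ?thesis
  \<comment> \<open>Without any polarization the direction is arbitrary.\<close>
  proof (cases "AE k in lborel. pauli (\<gamma> k) = 0")
    case True
    obtain \<nu> :: "complex^2" where \<nu>: "norm \<nu> = 1" by (rule bloch_sphere[of "(1, 0)"]) (auto simp: norm_Pair)
    have "AE k in lborel. \<gamma> k = spin_state (upper_eig \<gamma> k) (lower_eig \<gamma> k) \<nu>"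
      using True by eventually_elim (rule eqI[OF \<nu>], simp)
    then show ?thesis using \<nu> by blast
  next
    case False
    have "AE x in lborel. (\<integral>\<^sup>+y. ennreal (misalignment \<gamma> s x y) \<partial>lborel) = 0"
      using D by (subst (asm) nn_integral_0_iff_AE) auto
    then have "\<exists>x. (\<integral>\<^sup>+y. ennreal (misalignment \<gamma> s x y) \<partial>lborel) = 0 \<and> pauli (\<gamma> x) \<noteq> 0"
      using False by (metis (mono_tags, lifting) eventually_mono)
    then obtain x where x: "(\<integral>\<^sup>+y. ennreal (misalignment \<gamma> s x y) \<partial>lborel) = 0" "pauli (\<gamma> x) \<noteq> 0" by blast
    define n where "n = sgn (pauli (\<gamma> x))"
    have n: "norm n = 1" using x(2) by (simp add: n_def norm_sgn)
    have "(\<lambda>y. misalignment \<gamma> s x y) \<in> borel_measurable borel" by measurable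
    then have "AE y in lborel. ennreal (misalignment \<gamma> s x y) = 0"
      using x(1) by (subst (asm) nn_integral_0_iff_AE) auto
    \<comment> \<open>On the diagonal \<open>riesz s 0\<close> takes the default value 0, so that
      point carries no information.\<close>
    moreover have "AE y in lborel. y \<noteq> x" by (rule AE_lborel_singleton)
    ultimately have ae: "AE y in lborel. pauli (\<gamma> y) = norm (pauli (\<gamma> y)) *\<^sub>R n"
    proof eventually_elim
      case (elim y)
      have "misalignment \<gamma> s x y = 0" using elim(1) misalignment_nonneg[OF s, of \<gamma> x y] by simp
      moreover have "0 < riesz s (x - y)" using elim(2) c_riesz_pos[OF s] by (simp add: riesz_def)
      ultimately have "norm (pauli (\<gamma> x)) * norm (pauli (\<gamma> y)) = pauli (\<gamma> x) \<bullet> pauli (\<gamma> y)"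
        by (simp add: misalignment_def)
      then have "norm (pauli (\<gamma> x)) *\<^sub>R pauli (\<gamma> y) = norm (pauli (\<gamma> y)) *\<^sub>R pauli (\<gamma> x)"
        using norm_cauchy_schwarz_eq[of "pauli (\<gamma> x)" "pauli (\<gamma> y)"] by metis
      then have "inverse (norm (pauli (\<gamma> x))) *\<^sub>R (norm (pauli (\<gamma> x)) *\<^sub>R pauli (\<gamma> y)) =
          inverse (norm (pauli (\<gamma> x))) *\<^sub>R (norm (pauli (\<gamma> y)) *\<^sub>R pauli (\<gamma> x))" by (rule arg_cong)
      moreover have "inverse (norm (pauli (\<gamma> x))) * norm (pauli (\<gamma> x)) = 1" using x(2) by simp
      ultimately show ?case by (simp add: n_def sgn_div_norm mult.commute)
    qed
    obtain \<nu> :: "complex^2" where \<nu>: "norm \<nu> = 1" "pauli (ket_bra \<nu>) = n" by (rule bloch_sphere[OF n])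
    have "AE k in lborel. \<gamma> k = spin_state (upper_eig \<gamma> k) (lower_eig \<gamma> k) \<nu>"
      using ae by eventually_elim (rule eqI[OF \<nu>(1)], simp only: \<nu>(2))
    then show ?thesis using \<nu>(1) by blast
  qed
qed

text \<open>The energy exceeds the two-ball energy by three nonnegative slacks: the kinetic excess
  of each eigenvalue profile, and an exchange deficit that contains the misalignment. Equality makes
  each of them vanish, which yields the radii and a constant spin direction.\<close>

lemma HF_energy_lower_bound:
  fixes \<gamma> :: "real^'n \<Rightarrow> complex^2^2"
  assumes s: "0 < s" "s < real CARD('n)" and \<rho>: "0 < \<rho>" and \<gamma>: "borel_state \<gamma>"
    and mass: "(\<integral>\<^sup>+k. ennreal (tr2 (\<gamma> k)) \<partial>lborel) = ennreal ((2 * pi) ^ CARD('n) * \<rho>)"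
  shows "\<exists>t\<in>{0..1/2}. ereal (split_energy TYPE('n) s \<rho> t) \<le> HF_energy (riesz s) \<gamma> \<and>
    (HF_energy (riesz s) \<gamma> = ereal (split_energy TYPE('n) s \<rho> t) \<longrightarrow>
      (\<exists>\<nu>. norm \<nu> = 1 \<and> (AE k in lebesgue. \<gamma> k = ball_state ((1 - t) * \<rho>) (t * \<rho>) \<nu> k)))"
proof -
  note [measurable] = borel_state_measurable[OF \<gamma>]
  note eb = eig_bounds[OF \<gamma>]
  define N where "N = (2 * pi) ^ CARD('n)"
  have N: "N > 0" by (simp add: N_def)
  define M1 M2 where "M1 = (\<integral>\<^sup>+k. ennreal (upper_eig \<gamma> k) \<partial>lborel)" and "M2 = (\<integral>\<^sup>+k. ennreal (lower_eig \<gamma> k) \<partial>lborel)"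
  have "M1 + M2 = (\<integral>\<^sup>+k. ennreal (upper_eig \<gamma> k) + ennreal (lower_eig \<gamma> k) \<partial>lborel)"
    unfolding M1_def M2_def by (rule nn_integral_add[symmetric]) auto
  also have "\<dots> = (\<integral>\<^sup>+k. ennreal (tr2 (\<gamma> k)) \<partial>lborel)"
    unfolding eig_sum(1)[OF \<gamma>, symmetric] using eb by (intro nn_integral_cong) simp
  finally have Msum: "M1 + M2 = ennreal (N * \<rho>)" using mass by (simp add: N_def)
  have Mle: "M2 \<le> M1" unfolding M1_def M2_def using eb by (intro nn_integral_mono ennreal_leI)
  have "M1 \<noteq> \<infinity>" "M2 \<noteq> \<infinity>" using Msum by (auto simp: ennreal_add_eq_top[symmetric])
  then obtain u1 u2 where u: "M1 = ennreal u1" "0 \<le> u1" "M2 = ennreal u2" "0 \<le> u2"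
    by (metis ennreal_cases infinity_ennreal_def)
  have us: "u1 + u2 = N * \<rho>" using Msum u N \<rho> by (simp flip: ennreal_plus)
  have ul: "u2 \<le> u1" using Mle u by simp
  \<comment> \<open>The parameter \<open>t\<close> is the share of the mass carried by the smaller
    eigenvalue, hence at most \<open>1/2\<close>.\<close>
  define m1 m2 t where "m1 = u1 / N" and "m2 = u2 / N" and "t = m2 / \<rho>"
  have m: "0 \<le> m1" "0 \<le> m2" "m2 \<le> m1" "m1 + m2 = \<rho>"
    using u N us ul by (simp_all add: m1_def m2_def divide_right_mono field_simps)
  have t: "t \<in> {0..1/2}" "t * \<rho> = m2" "(1 - t) * \<rho> = m1"
    using m \<rho> by (auto simp: t_def field_simps)
  have mass1: "(\<integral>\<^sup>+k. ennreal (upper_eig \<gamma> k) \<partial>lborel) = ennreal ((2 * pi) ^ CARD('n) * m1)"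
    and mass2: "(\<integral>\<^sup>+k. ennreal (lower_eig \<gamma> k) \<partial>lborel) = ennreal ((2 * pi) ^ CARD('n) * m2)"
    unfolding M1_def[symmetric] M2_def[symmetric] N_def[symmetric] m1_def m2_def using u N by simp_all
  define K L where "K m = kappa CARD('n) * m powr (1 + 2 / real CARD('n))" and "L m = lambda_HF TYPE('n) s * m powr (1 + s / real CARD('n))" for m
  have L0: "0 \<le> L m" for m unfolding L_def using lambda_HF_pos[OF s] by simp
  have G: "split_energy TYPE('n) s \<rho> t = (K m1 + K m2) - (L m1 + L m2)"
    unfolding split_energy_def t spinless_energy_def K_def L_def by simp
  note b1 = spinless_kinetic_exchange[OF s m(1) borel_state_measurable(3)[OF \<gamma>] eb(1,2) mass1, folded K_def L_def N_def]
  note b2 = spinless_kinetic_exchange[OF s m(2) borel_state_measurable(4)[OF \<gamma>] eb(3,4) mass2, folded K_def L_def N_def]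
  define T1 T2 where "T1 = (\<integral>\<^sup>+k. ennreal ((norm k)\<^sup>2 * upper_eig \<gamma> k) \<partial>lborel)" and "T2 = (\<integral>\<^sup>+k. ennreal ((norm k)\<^sup>2 * lower_eig \<gamma> k) \<partial>lborel)"
  define X where "X = (\<integral>\<^sup>+p. ennreal (riesz s (fst p - snd p) * Re (trace (\<gamma> (fst p) ** \<gamma> (snd p)))) \<partial>lebesgue)"
  define D where "D = (\<integral>\<^sup>+x. (\<integral>\<^sup>+y. ennreal (misalignment \<gamma> s x y) \<partial>lborel) \<partial>lborel)"
  have T: "(\<integral>\<^sup>+k. ennreal ((norm k)\<^sup>2 * Re (trace (\<gamma> k))) \<partial>lebesgue) = T1 + T2"
    unfolding T1_def T2_def by (rule kinetic_borel_state[OF \<gamma>])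
  have XD: "X + D \<le> ennreal (2 * N * (L m1 + L m2))"
  proof -
    have "X + D = self_interact s (upper_eig \<gamma>) + self_interact s (lower_eig \<gamma>)"
      unfolding X_def D_def by (rule exchange_borel_state[OF \<gamma> s])
    also have "\<dots> \<le> ennreal (2 * N * L m1) + ennreal (2 * N * L m2)" by (intro add_mono b1(2) b2(2))
    also have "\<dots> = ennreal (2 * N * (L m1 + L m2))" using N L0 by (simp add: distrib_left)
    finally show ?thesis .
  qed
  have "X \<le> X + D" by simp
  then have Xle: "X \<le> ennreal (2 * N * (L m1 + L m2))" using XD by (rule order_trans)
  then have "X \<noteq> \<infinity>" by (auto simp: top_unique)
  then obtain \<xi> where \<xi>: "X = ennreal \<xi>" "0 \<le> \<xi>" by (metis ennreal_cases infinity_ennreal_def)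
  define b where "b = \<xi> / (2 * N)"
  have b: "X = ennreal (2 * N * b)" "0 \<le> b" using \<xi> N by (simp_all add: b_def)
  have bL: "b \<le> L m1 + L m2" using Xle N b L0 by (simp add: ennreal_le_iff add_nonneg_nonneg)
  show ?thesis
  proof (cases "T1 + T2 = \<infinity>")
    \<comment> \<open>Infinite kinetic energy makes the energy infinite, because the exchange energy
      is finite; the equality clause is then vacuous.\<close>
    case True
    have "HF_energy (riesz s) \<gamma> = \<infinity>"
      by (rule HF_energy_infinite[OF _ _ \<xi>(2)]) (use T True \<xi>(1) in \<open>simp_all add: X_def\<close>)
    then show ?thesis using t(1) by (intro bexI[of _ t]) auto
  next
    case False
    then have "T1 \<noteq> \<infinity>" "T2 \<noteq> \<infinity>" by auto
    then obtain \<tau>1 \<tau>2 where \<tau>: "T1 = ennreal \<tau>1" "0 \<le> \<tau>1" "T2 = ennreal \<tau>2" "0 \<le> \<tau>2" by (metis ennreal_cases infinity_ennreal_def)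
    define a1 a2 where "a1 = \<tau>1 / (2 * N)" and "a2 = \<tau>2 / (2 * N)"
    have a: "T1 = ennreal (2 * N * a1)" "T2 = ennreal (2 * N * a2)" "0 \<le> a1" "0 \<le> a2"
      using \<tau> N by (simp_all add: a1_def a2_def)
    have aK: "K m1 \<le> a1" "K m2 \<le> a2"
      using b1(1) b2(1) a N by (simp_all add: T1_def[symmetric] T2_def[symmetric] ennreal_le_iff)
    have E: "HF_energy (riesz s) \<gamma> = ereal ((a1 + a2) - b)"
    proof (rule HF_energy_real)
      show "(\<integral>\<^sup>+k. ennreal ((norm k)\<^sup>2 * Re (trace (\<gamma> k))) \<partial>lebesgue) = ennreal (2 * (2 * pi) ^ CARD('n) * (a1 + a2))"
        unfolding T a(1,2) N_def[symmetric] using a(3,4) N by (simp add: distrib_left)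
      show "(\<integral>\<^sup>+p. ennreal (riesz s (fst p - snd p) * Re (trace (\<gamma> (fst p) ** \<gamma> (snd p)))) \<partial>lebesgue) = ennreal (2 * (2 * pi) ^ CARD('n) * b)"
        unfolding X_def[symmetric] N_def[symmetric] by (rule b(1))
    qed (use a b in auto)
    have "(\<exists>\<nu>. norm \<nu> = 1 \<and> (AE k in lebesgue. \<gamma> k = ball_state ((1 - t) * \<rho>) (t * \<rho>) \<nu> k))"
      if eq: "HF_energy (riesz s) \<gamma> = ereal (split_energy TYPE('n) s \<rho> t)"
    proof -
      have "(a1 + a2) - b = (K m1 + K m2) - (L m1 + L m2)" using eq unfolding E G by simp
      \<comment> \<open>Three one-sided bounds whose sum is an equality are all equalities.\<close>
      then have e: "a1 = K m1" "a2 = K m2" "b = L m1 + L m2" using aK bL by linarith+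
      have k1: "AE k in lborel. upper_eig \<gamma> k = indicator (cball 0 (Fermi_radius TYPE('n) m1)) k"
        by (rule b1(3)) (use a e in \<open>simp add: T1_def[symmetric]\<close>)
      have k2: "AE k in lborel. lower_eig \<gamma> k = indicator (cball 0 (Fermi_radius TYPE('n) m2)) k"
        by (rule b2(3)) (use a e in \<open>simp add: T2_def[symmetric]\<close>)
      have "X + D \<le> X + 0" using XD b e by simp
      then have "D = 0" using \<open>X \<noteq> \<infinity>\<close> by (simp only: ennreal_add_left_cancel_le) auto
      then obtain \<nu> where \<nu>: "norm \<nu> = 1" "AE k in lborel. \<gamma> k = spin_state (upper_eig \<gamma> k) (lower_eig \<gamma> k) \<nu>"
        using aligned_spin_state[OF \<gamma> s] unfolding D_def by blast
      have "AE k in lborel. \<gamma> k = ball_state ((1 - t) * \<rho>) (t * \<rho>) \<nu> k"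
        using \<nu>(2) k1 k2 by eventually_elim (simp add: ball_state_def t)
      then show ?thesis using \<nu>(1) AE_completion by blast
    qed
    moreover have "ereal (split_energy TYPE('n) s \<rho> t) \<le> HF_energy (riesz s) \<gamma>"
      unfolding E G using aK bL by simp
    ultimately show ?thesis using t(1) by (intro bexI[of _ t]) blast+
  qed
qed

lemma AE_ball_cball: "AE k in lborel. (indicator (cball (0::'a::euclidean_space) R) k :: real) = indicator (ball 0 R) k"
proof -
  have "sphere (0::'a) R \<in> null_sets lebesgue" using negligible_sphere[of "0::'a" R] by (simp add: negligible_iff_null_sets)
  then have "sphere (0::'a) R \<in> null_sets lborel" by (simp add: null_sets_completion_iff)
  then have "AE x in lborel. x \<notin> sphere (0::'a) R" by (rule AE_not_in)
  then show ?thesis by eventually_elim (auto simp: indicator_def)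
qed

lemma Fermi_radius_mono: "0 \<le> a \<Longrightarrow> a \<le> b \<Longrightarrow> Fermi_radius T a \<le> Fermi_radius (T :: 'n::finite itself) b"
  unfolding Fermi_radius_def using unit_ball_vol_pos[of "real CARD('n)"]
  by (intro mult_left_mono powr_mono2 divide_right_mono divide_nonneg_pos) auto

text \<open>The balls are nested, so the two indicators are already the ordered eigenvalues, and the
  common spin direction makes the misalignment vanish: every bound is attained.\<close>

lemma ball_state_energy:
  fixes \<nu> :: "complex^2"
  assumes s: "0 < s" "s < real CARD('n)" and m: "0 \<le> b" "b \<le> a" and \<nu>: "norm \<nu> = 1"
  shows "borel_state (ball_state a b \<nu> :: real^'n \<Rightarrow> _)"
    "(\<integral>\<^sup>+k. ennreal (tr2 (ball_state a b \<nu> (k :: real^'n))) \<partial>lborel) = ennreal ((2 * pi) ^ CARD('n) * (a + b))"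
    "HF_energy (riesz s) (ball_state a b \<nu> :: real^'n \<Rightarrow> _) = ereal (spinless_energy TYPE('n) s a + spinless_energy TYPE('n) s b)"
proof -
  define N where "N = (2 * pi) ^ CARD('n)"
  have N: "N > 0" by (simp add: N_def)
  let ?R = "Fermi_radius TYPE('n)"
  let ?\<gamma> = "ball_state a b \<nu> :: real^'n \<Rightarrow> _"
  define f where "f c k = (indicator (cball 0 (?R c)) k :: real)" for c and k :: "real^'n"
  have [measurable]: "f c \<in> borel_measurable borel" for c
    unfolding f_def[abs_def] by (rule borel_measurable_indicator) simp
  have \<gamma>eq: "?\<gamma> k = spin_state (f a k) (f b k) \<nu>" for k by (simp add: ball_state_def f_def)
  have f01: "0 \<le> f c k" "f c k \<le> 1" for c k by (simp_all add: f_def)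
  have fba: "f b k \<le> f a k" for k
    using Fermi_radius_mono[OF m, of "TYPE('n)"] by (auto simp: f_def indicator_def)
  have tr: "tr2 (?\<gamma> k) = f a k + f b k" for k by (simp add: \<gamma>eq tr2_spin_state \<nu>)
  have pa: "pauli (?\<gamma> k) = (f a k - f b k) *\<^sub>R pauli (ket_bra \<nu>)" for k by (simp add: \<gamma>eq pauli_spin_state)
  have np: "norm (pauli (?\<gamma> k)) = f a k - f b k" for k using fba[of k] by (simp add: \<gamma>eq norm_pauli_spin_state \<nu>)
  show bs: "borel_state ?\<gamma>" unfolding borel_state_def
  proof (intro conjI allI)
    show "(\<lambda>k. tr2 (?\<gamma> k)) \<in> borel_measurable borel" unfolding tr by measurable
    show "(\<lambda>k. pauli (?\<gamma> k)) \<in> borel_measurable borel" unfolding pa by measurable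
    show "hermitian (?\<gamma> k)" for k unfolding \<gamma>eq by (rule hermitian_spin_state)
    show "norm (pauli (?\<gamma> k)) \<le> tr2 (?\<gamma> k)" "norm (pauli (?\<gamma> k)) \<le> 2 - tr2 (?\<gamma> k)" for k
      unfolding np tr using f01[of a k] f01[of b k] by linarith+
  qed
  have eig: "upper_eig ?\<gamma> = f a" "lower_eig ?\<gamma> = f b"
    unfolding upper_eig_def[abs_def] lower_eig_def[abs_def] np tr by (auto simp: fun_eq_iff)
  have fae: "AE k in lborel. ennreal (f c k) = indicator (ball 0 (?R c)) k" for c
    using AE_ball_cball[of "?R c", where 'a="real^'n"] by eventually_elim (simp add: f_def ennreal_indicator)
  have fm: "(\<integral>\<^sup>+k. ennreal (f c k) \<partial>lborel) = ennreal (N * c)" if "0 \<le> c" for c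
  proof -
    have "(\<integral>\<^sup>+k. ennreal (f c k) \<partial>lborel) = (\<integral>\<^sup>+k. indicator (ball (0::real^'n) (?R c)) k \<partial>lborel)"
      by (rule nn_integral_cong_AE[OF fae])
    then show ?thesis using emeasure_Fermi_ball[OF that, where 'n='n] by (simp add: N_def)
  qed
  show "(\<integral>\<^sup>+k. ennreal (tr2 (?\<gamma> k)) \<partial>lborel) = ennreal ((2 * pi) ^ CARD('n) * (a + b))"
  proof -
    have "(\<integral>\<^sup>+k. ennreal (tr2 (?\<gamma> k)) \<partial>lborel) = (\<integral>\<^sup>+k. ennreal (f a k) + ennreal (f b k) \<partial>lborel)"
      unfolding tr using f01 by (intro nn_integral_cong) simp
    also have "\<dots> = ennreal (N * a) + ennreal (N * b)" using m by (subst nn_integral_add) (auto simp: fm)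
    also have "\<dots> = ennreal (N * (a + b))" using m N by (simp add: distrib_left)
    finally show ?thesis by (simp add: N_def)
  qed
  define K L where "K m = kappa CARD('n) * m powr (1 + 2 / real CARD('n))" and "L m = lambda_HF TYPE('n) s * m powr (1 + s / real CARD('n))" for m
  have K0: "0 \<le> K m" for m unfolding K_def using kappa_pos[of "CARD('n)"] by (simp add: Suc_le_eq)
  have L0: "0 \<le> L m" for m unfolding L_def using lambda_HF_pos[OF s] by simp
  have kin: "(\<integral>\<^sup>+k. ennreal ((norm k)\<^sup>2 * f c k) \<partial>lborel) = ennreal (2 * N * K c)" if "0 \<le> c" for c
  proof -
    have "(\<integral>\<^sup>+k. ennreal ((norm k)\<^sup>2 * f c k) \<partial>lborel) = (\<integral>\<^sup>+k. indicator (ball (0::real^'n) (?R c)) k * ennreal ((norm k)\<^sup>2) \<partial>lborel)"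
    proof (rule nn_integral_cong_AE)
      show "AE k in lborel. ennreal ((norm k)\<^sup>2 * f c k) = indicator (ball (0::real^'n) (?R c)) k * ennreal ((norm k)\<^sup>2)"
        using fae[of c] by eventually_elim (simp add: ennreal_mult f01 mult.commute)
    qed
    then show ?thesis using kinetic_Fermi_ball[OF that, where 'n='n] by (simp add: K_def N_def)
  qed
  have ex: "self_interact s (f c) = ennreal (2 * N * L c)" if "0 \<le> c" for c
    using interact_cong_AE[OF fae[of c] fae[of c]] exchange_Fermi_ball[OF s that] by (simp add: L_def N_def)
  have mis: "misalignment ?\<gamma> s x y = 0" for x y
    unfolding misalignment_def np unfolding pa by (simp add: power2_norm_eq_inner[symmetric] norm_pauli_ket_bra \<nu>)
  have a0: "0 \<le> a" using m by simp
  have "HF_energy (riesz s) ?\<gamma> = ereal ((K a + K b) - (L a + L b))"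
  proof (rule HF_energy_real)
    show "(\<integral>\<^sup>+k. ennreal ((norm k)\<^sup>2 * Re (trace (?\<gamma> k))) \<partial>lebesgue) = ennreal (2 * (2 * pi) ^ CARD('n) * (K a + K b))"
      unfolding kinetic_borel_state[OF bs] eig kin[OF a0] kin[OF m(1)] N_def[symmetric] using N K0 by (simp add: distrib_left)
    have "(\<integral>\<^sup>+p. ennreal (riesz s (fst p - snd p) * Re (trace (?\<gamma> (fst p) ** ?\<gamma> (snd p)))) \<partial>lebesgue)
       = ennreal (2 * N * L a) + ennreal (2 * N * L b)"
      using exchange_borel_state[OF bs s] unfolding mis eig ex[OF a0] ex[OF m(1)] by simp
    then show "(\<integral>\<^sup>+p. ennreal (riesz s (fst p - snd p) * Re (trace (?\<gamma> (fst p) ** ?\<gamma> (snd p)))) \<partial>lebesgue) = ennreal (2 * (2 * pi) ^ CARD('n) * (L a + L b))"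
      unfolding N_def[symmetric] using N L0 by (simp add: distrib_left)
  qed (auto simp: K0 L0 add_nonneg_nonneg)
  then show "HF_energy (riesz s) ?\<gamma> = ereal (spinless_energy TYPE('n) s a + spinless_energy TYPE('n) s b)"
    by (simp add: spinless_energy_def K_def L_def)
qed

lemma admissible_ball_state:
  fixes \<gamma> :: "real^'n \<Rightarrow> complex^2^2"
  assumes m: "0 \<le> b" "b \<le> a" and \<nu>: "norm \<nu> = 1" and ae: "AE k in lebesgue. \<gamma> k = ball_state a b \<nu> k"
  shows "admissible (a + b) \<gamma>"
proof -
  \<comment> \<open>Admissibility does not involve \<open>s\<close>; any exponent in range gives
    access to the measurability and mass statements of \<open>ball_state_energy\<close>.\<close>
  obtain s where s: "0 < s" "s < real CARD('n)" using dense[of 0 "real CARD('n)"] by auto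
  note bs = ball_state_energy[OF s m \<nu>]
  have "(\<lambda>k. ball_state a b \<nu> k :: complex^2^2) \<in> borel_measurable (borel :: (real^'n) measure)"
  proof -
    have [measurable]: "cball (0::real^'n) R \<in> sets borel" for R by simp
    show ?thesis unfolding ball_state_def spin_state_def by measurable
  qed
  then have "(\<lambda>k. ball_state a b \<nu> k :: complex^2^2) \<in> borel_measurable (lebesgue :: (real^'n) measure)"
    by (intro measurable_completion) simp
  then have m1: "\<gamma> \<in> borel_measurable lebesgue"
    by (rule lebesgue_measurable_cong_AE) (use ae in \<open>auto elim: eventually_mono\<close>)
  have "pos_semidef (ball_state a b \<nu> k) \<and> pos_semidef (mat 1 - ball_state a b \<nu> (k :: real^'n))" for k
    using bs(1) unfolding spin_density_iff borel_state_def by blast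
  then have m2: "AE k in lebesgue. pos_semidef (\<gamma> k) \<and> pos_semidef (mat 1 - \<gamma> k)"
    using ae by (auto elim: eventually_mono)
  have "continuous_on UNIV tr2" unfolding tr2_def by (auto intro!: continuous_intros)
  from measurable_compose[OF m1 borel_measurable_continuous_onI[OF this]]
  have m3: "(\<lambda>k. Re (trace (\<gamma> k))) \<in> borel_measurable lebesgue" by (simp add: Re_trace_2)
  have pos: "AE k in lebesgue. 0 \<le> Re (trace (\<gamma> k))"
    using m2
  proof eventually_elim
    case (elim k)
    then have "norm (pauli (\<gamma> k)) \<le> tr2 (\<gamma> k)" unfolding spin_density_iff by simp
    then show ?case using norm_ge_zero[of "pauli (\<gamma> k)"] unfolding Re_trace_2 by linarith
  qed
  have "(\<integral>\<^sup>+k. ennreal (Re (trace (\<gamma> k))) \<partial>lebesgue) = (\<integral>\<^sup>+k. ennreal (tr2 (ball_state a b \<nu> (k :: real^'n))) \<partial>lebesgue)"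
    using ae by (intro nn_integral_cong_AE) (auto simp: Re_trace_2 elim: eventually_mono)
  also have "\<dots> = ennreal ((2 * pi) ^ CARD('n) * (a + b))" using bs(2) by (simp add: nn_integral_completion)
  finally have nn: "(\<integral>\<^sup>+k. ennreal (Re (trace (\<gamma> k))) \<partial>lebesgue) = ennreal ((2 * pi) ^ CARD('n) * (a + b))" .
  have "integrable lebesgue (\<lambda>k. Re (trace (\<gamma> k)))" by (rule integrableI_nonneg[OF m3 pos]) (simp add: nn)
  moreover have "(\<integral>k. Re (trace (\<gamma> k)) \<partial>lebesgue) = (2 * pi) ^ CARD('n) * (a + b)"
    using integral_eq_nn_integral[OF m3 pos] m by (simp add: nn)
  ultimately show ?thesis using m1 m2 by (simp add: admissible_def)
qed

lemma is_mixed_energy: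
  fixes \<gamma> :: "real^'n \<Rightarrow> complex^2^2"
  assumes s: "0 < s" "s < real CARD('n)" and \<rho>: "0 < \<rho>" and t: "t \<in> {0..1/2}" and mx: "is_mixed t \<rho> \<gamma>"
  shows "admissible \<rho> \<gamma> \<and> HF_energy (riesz s) \<gamma> = ereal (split_energy TYPE('n) s \<rho> t)"
proof -
  have "0 \<le> t" "t \<le> 1" using t by auto
  then obtain \<nu> where \<nu>: "norm \<nu> = 1" "AE k in lebesgue. \<gamma> k = ball_state ((1 - t) * \<rho>) (t * \<rho>) \<nu> k"
    using mx \<rho> by (auto simp: is_mixed_iff)
  have m: "0 \<le> t * \<rho>" "t * \<rho> \<le> (1 - t) * \<rho>" using t \<rho> by auto
  have "admissible ((1 - t) * \<rho> + t * \<rho>) \<gamma>" by (rule admissible_ball_state[OF m \<nu>])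
  moreover have "HF_energy (riesz s) \<gamma> = ereal (split_energy TYPE('n) s \<rho> t)"
    unfolding HF_energy_cong_AE[OF \<nu>(2)] ball_state_energy(3)[OF s m \<nu>(1)] by (simp add: split_energy_def)
  ultimately show ?thesis by (simp add: algebra_simps)
qed

lemma ex_is_mixed:
  assumes "0 \<le> t" "t \<le> 1" "0 \<le> \<rho>"
  shows "\<exists>\<gamma> :: real^'n \<Rightarrow> complex^2^2. is_mixed t \<rho> \<gamma>"
proof -
  obtain \<nu> :: "complex^2" where "norm \<nu> = 1" by (rule bloch_sphere[of "(1, 0)"]) (auto simp: norm_Pair)
  then have "is_mixed t \<rho> (ball_state ((1 - t) * \<rho>) (t * \<rho>) \<nu> :: real^'n \<Rightarrow> _)"
    using assms by (subst is_mixed_iff) auto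
  then show ?thesis by blast
qed

text \<open>The reduced minimiser \<open>t0\<close> need not be unique: this is what allows the
  coexistence of two phases at \<open>rho_c\<close>.\<close>

theorem HF_minimiser_iff:
  fixes \<gamma> :: "real^'n \<Rightarrow> complex^2^2"
  assumes s: "0 < s" "s < real CARD('n)" and \<rho>: "0 < \<rho>"
    and t0: "t0 \<in> {0..1/2}" "\<And>t. t \<in> {0..1/2} \<Longrightarrow> split_energy TYPE('n) s \<rho> t0 \<le> split_energy TYPE('n) s \<rho> t"
  shows "HF_minimum (riesz s :: real^'n \<Rightarrow> real) \<rho> = ereal (split_energy TYPE('n) s \<rho> t0)"
    and "HF_minimiser (riesz s) \<rho> \<gamma> \<longleftrightarrow>
      (\<exists>t\<in>{0..1/2}. split_energy TYPE('n) s \<rho> t = split_energy TYPE('n) s \<rho> t0 \<and> is_mixed t \<rho> \<gamma>)"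
proof -
  let ?G = "split_energy TYPE('n) s \<rho>"
  note mixed = is_mixed_energy[OF s \<rho>]
  have lower: "\<exists>t\<in>{0..1/2}. ereal (?G t) \<le> HF_energy (riesz s) \<gamma> \<and> (HF_energy (riesz s) \<gamma> = ereal (?G t) \<longrightarrow> is_mixed t \<rho> \<gamma>)"
    if adm: "admissible \<rho> \<gamma>" for \<gamma> :: "real^'n \<Rightarrow> complex^2^2"
  proof -
    obtain \<gamma>' where g: "borel_state \<gamma>'" "AE k in lebesgue. \<gamma> k = \<gamma>' k"
      "(\<integral>\<^sup>+k. ennreal (tr2 (\<gamma>' k)) \<partial>lborel) = ennreal ((2 * pi) ^ CARD('n) * \<rho>)"
      by (rule admissible_borel_state[OF adm])
    obtain t where t: "t \<in> {0..1/2}" "ereal (?G t) \<le> HF_energy (riesz s) \<gamma>'"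
      "HF_energy (riesz s) \<gamma>' = ereal (?G t) \<longrightarrow> (\<exists>\<nu>. norm \<nu> = 1 \<and> (AE k in lebesgue. \<gamma>' k = ball_state ((1 - t) * \<rho>) (t * \<rho>) \<nu> k))"
      using HF_energy_lower_bound[OF s \<rho> g(1,3)] by blast
    have "is_mixed t \<rho> \<gamma>" if "HF_energy (riesz s) \<gamma> = ereal (?G t)"
    proof -
      have "HF_energy (riesz s) \<gamma>' = ereal (?G t)" using that HF_energy_cong_AE[OF g(2)] by metis
      then obtain \<nu> where \<nu>: "norm \<nu> = 1" "AE k in lebesgue. \<gamma>' k = ball_state ((1 - t) * \<rho>) (t * \<rho>) \<nu> k" using t(3) by blast
      have "AE k in lebesgue. \<gamma> k = ball_state ((1 - t) * \<rho>) (t * \<rho>) \<nu> k"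
        using g(2) \<nu>(2) by eventually_elim simp
      then show ?thesis using t(1) \<rho> \<nu>(1) by (auto simp: is_mixed_iff)
    qed
    then show ?thesis using t HF_energy_cong_AE[OF g(2), of "riesz s"] by (intro bexI[of _ t]) auto
  qed
  obtain \<gamma>0 :: "real^'n \<Rightarrow> complex^2^2" where ex: "is_mixed t0 \<rho> \<gamma>0"
    using ex_is_mixed[of t0 \<rho>, where 'n='n] t0(1) \<rho> by auto
  show min: "HF_minimum (riesz s :: real^'n \<Rightarrow> real) \<rho> = ereal (?G t0)"
    unfolding HF_minimum_def
  proof (rule antisym)
    show "(INF \<gamma>\<in>{\<gamma> :: real^'n \<Rightarrow> _. admissible \<rho> \<gamma>}. HF_energy (riesz s) \<gamma>) \<le> ereal (?G t0)"
      using mixed[OF t0(1) ex] by (intro INF_lower2) auto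
    show "ereal (?G t0) \<le> (INF \<gamma>\<in>{\<gamma> :: real^'n \<Rightarrow> _. admissible \<rho> \<gamma>}. HF_energy (riesz s) \<gamma>)"
    proof (rule INF_greatest)
      fix \<gamma> :: "real^'n \<Rightarrow> complex^2^2" assume "\<gamma> \<in> {\<gamma>. admissible \<rho> \<gamma>}"
      then obtain t where "t \<in> {0..1/2}" "ereal (?G t) \<le> HF_energy (riesz s) \<gamma>" using lower by blast
      then show "ereal (?G t0) \<le> HF_energy (riesz s) \<gamma>" using t0(2)[of t] by (metis ereal_less_eq(3) order_trans)
    qed
  qed
  show "HF_minimiser (riesz s) \<rho> \<gamma> \<longleftrightarrow> (\<exists>t\<in>{0..1/2}. ?G t = ?G t0 \<and> is_mixed t \<rho> \<gamma>)"
  proof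
    assume "HF_minimiser (riesz s) \<rho> \<gamma>"
    then have h: "admissible \<rho> \<gamma>" "HF_energy (riesz s) \<gamma> = ereal (?G t0)" by (auto simp: HF_minimiser_def min)
    obtain t where t: "t \<in> {0..1/2}" "ereal (?G t) \<le> HF_energy (riesz s) \<gamma>" "HF_energy (riesz s) \<gamma> = ereal (?G t) \<longrightarrow> is_mixed t \<rho> \<gamma>"
      using lower[OF h(1)] by blast
    have "?G t = ?G t0" using t(2) t0(2)[OF t(1)] h(2) by simp
    then show "\<exists>t\<in>{0..1/2}. ?G t = ?G t0 \<and> is_mixed t \<rho> \<gamma>" using t h by auto
  next
    assume "\<exists>t\<in>{0..1/2}. ?G t = ?G t0 \<and> is_mixed t \<rho> \<gamma>"
    then show "HF_minimiser (riesz s) \<rho> \<gamma>" using mixed by (auto simp: HF_minimiser_def min)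
  qed
qed

section \<open>The phase diagram\<close>

lemma split_energy_powr_sum:
  assumes "0 < \<rho>" "t \<in> {0..1/2}"
  shows "split_energy TYPE('n::finite) s \<rho> t =
    (kappa CARD('n) * \<rho> powr (1 + 2 / real CARD('n))) * powr_sum (1 + 2 / real CARD('n)) t -
    (lambda_HF TYPE('n) s * \<rho> powr (1 + s / real CARD('n))) * powr_sum (1 + s / real CARD('n)) t"
  unfolding split_energy_def spinless_energy_def powr_sum_def powr_mult by (simp add: algebra_simps)

lemma split_energy_0: "0 < \<rho> \<Longrightarrow> split_energy T s \<rho> 0 = spinless_energy T s \<rho>"
  by (simp add: split_energy_def spinless_energy_def)

lemma split_energy_half: "split_energy T s \<rho> (1/2) = 2 * spinless_energy T s (\<rho> / 2)"
  by (simp add: split_energy_def)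

lemma HF_unique_minimiser:
  fixes \<gamma> :: "real^'n \<Rightarrow> complex^2^2"
  assumes s: "0 < s" "s < real CARD('n)" and \<rho>: "0 < \<rho>" and t0: "t0 \<in> {0..1/2}"
    and less: "\<And>t. t \<in> {0..1/2} \<Longrightarrow> t \<noteq> t0 \<Longrightarrow> split_energy TYPE('n) s \<rho> t0 < split_energy TYPE('n) s \<rho> t"
  shows "HF_minimum (riesz s :: real^'n \<Rightarrow> real) \<rho> = ereal (split_energy TYPE('n) s \<rho> t0)"
    and "HF_minimiser (riesz s) \<rho> \<gamma> \<longleftrightarrow> is_mixed t0 \<rho> \<gamma>"
proof -
  have le: "split_energy TYPE('n) s \<rho> t0 \<le> split_energy TYPE('n) s \<rho> t" if "t \<in> {0..1/2}" for t
    using less[OF that] by (cases "t = t0") auto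
  show "HF_minimum (riesz s :: real^'n \<Rightarrow> real) \<rho> = ereal (split_energy TYPE('n) s \<rho> t0)"
    by (rule HF_minimiser_iff(1)[OF s \<rho> t0 le])
  show "HF_minimiser (riesz s) \<rho> \<gamma> \<longleftrightarrow> is_mixed t0 \<rho> \<gamma>"
  proof
    assume "HF_minimiser (riesz s) \<rho> \<gamma>"
    then obtain t where t: "t \<in> {0..1/2}" "split_energy TYPE('n) s \<rho> t = split_energy TYPE('n) s \<rho> t0" "is_mixed t \<rho> \<gamma>"
      using HF_minimiser_iff(2)[OF s \<rho> t0 le] by blast
    then have "t = t0" using less[OF t(1)] by force
    then show "is_mixed t0 \<rho> \<gamma>" using t(3) by simp
  next
    assume "is_mixed t0 \<rho> \<gamma>"
    then show "HF_minimiser (riesz s) \<rho> \<gamma>" using HF_minimiser_iff(2)[OF s \<rho> t0 le] t0 by blast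
  qed
qed

lemma spinless_energy_deriv:
  assumes "0 < m"
  shows "(spinless_energy TYPE('n::finite) s has_real_derivative
    (kappa CARD('n) * (1 + 2 / real CARD('n)) * m powr (2 / real CARD('n)) - lambda_HF TYPE('n) s * (1 + s / real CARD('n)) * m powr (s / real CARD('n)))) (at m)"
  unfolding spinless_energy_def[abs_def] using assms by (auto intro!: derivative_eq_intros)

lemma derivative_jumpI:
  fixes E f g f' g' :: "real \<Rightarrow> real"
  assumes c: "0 < c" and f: "\<And>x. 0 < x \<Longrightarrow> (f has_real_derivative f' x) (at x)" and g: "\<And>x. 0 < x \<Longrightarrow> (g has_real_derivative g' x) (at x)"
    and cont: "isCont f' c" "isCont g' c"
    and left: "\<And>x. 0 < x \<Longrightarrow> x \<le> c \<Longrightarrow> E x = f x" and right: "\<And>x. c \<le> x \<Longrightarrow> E x = g x" and ne: "f' c \<noteq> g' c"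
  shows "derivative_jump E c"
proof -
  have dl: "(E has_real_derivative f' x) (at x)" if "x \<in> {0<..<c}" for x
  proof (rule has_field_derivative_transform_within_open[OF f])
    show "open {0<..<c}" by simp
  qed (use that left in auto)
  have dr: "(E has_real_derivative g' x) (at x)" if "x \<in> {c<..}" for x
  proof (rule has_field_derivative_transform_within_open[OF g])
    show "open {c<..}" by simp
  qed (use that right c in auto)
  have evl: "\<forall>\<^sub>F x in at_left c. x \<in> {0<..<c}" using c by (rule eventually_at_left_real)
  have evr: "\<forall>\<^sub>F x in at_right c. x \<in> {c<..}" by (simp add: eventually_at_right_less)
  have "\<forall>\<^sub>F y in at_left c. E differentiable (at y)" using evl by eventually_elim (use dl in \<open>auto simp: real_differentiable_def\<close>)
  moreover have "\<forall>\<^sub>F y in at_right c. E differentiable (at y)" using evr by eventually_elim (use dr in \<open>auto simp: real_differentiable_def\<close>)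
  ultimately have ev: "\<forall>\<^sub>F y in at c. E differentiable (at y)" by (simp add: eventually_at_split)
  have "(E has_real_derivative f' c) (at c within {..c})"
  proof (rule has_field_derivative_transform_within[OF has_field_derivative_at_within[OF f[OF c]] c])
    fix x assume "x \<in> {..c}" "dist x c < c"
    then show "f x = E x" using left[of x] by (auto simp: dist_real_def)
  qed simp
  then have El: "(E has_real_derivative f' c) (at_left c)" by (rule has_field_derivative_subset) auto
  have "(E has_real_derivative g' c) (at c within {c..})"
  proof (rule has_field_derivative_transform_within[OF has_field_derivative_at_within[OF g[OF c]] c])
    fix x assume "x \<in> {c..}" "dist x c < c"
    then show "g x = E x" using right[of x] by auto
  qed simp
  then have Er: "(E has_real_derivative g' c) (at_right c)" by (rule has_field_derivative_subset) auto
  have "(f' \<longlongrightarrow> f' c) (at_left c)" using cont(1) unfolding isCont_def by (rule tendsto_mono[OF at_le[OF subset_UNIV]])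
  moreover have "\<forall>\<^sub>F x in at_left c. f' x = deriv E x" using evl by eventually_elim (rule DERIV_imp_deriv[OF dl, symmetric])
  ultimately have Dl: "(deriv E \<longlongrightarrow> f' c) (at_left c)" by (rule Lim_transform_eventually)
  have "(g' \<longlongrightarrow> g' c) (at_right c)" using cont(2) unfolding isCont_def by (rule tendsto_mono[OF at_le[OF subset_UNIV]])
  moreover have "\<forall>\<^sub>F x in at_right c. g' x = deriv E x" using evr by eventually_elim (rule DERIV_imp_deriv[OF dr, symmetric])
  ultimately have Dr: "(deriv E \<longlongrightarrow> g' c) (at_right c)" by (rule Lim_transform_eventually)
  show ?thesis unfolding derivative_jump_def using ev El Er Dl Dr ne by blast
qed

section \<open>Phases in terms of the exponents \<open>p\<close> and \<open>q\<close>\<close>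

context
  fixes s :: real and d \<kappa> \<Lambda> p q :: real
  assumes s: "0 < s" "s < real CARD('n::finite)"
  defines "d \<equiv> real CARD('n)" and "\<kappa> \<equiv> kappa CARD('n)" and "\<Lambda> \<equiv> lambda_HF TYPE('n) s"
    and "p \<equiv> 1 + 2 / real CARD('n)" and "q \<equiv> 1 + s / real CARD('n)"
begin

lemma consts_pos: "0 < \<kappa>" "0 < \<Lambda>" "0 < d" "1 < p" "1 < q"
  using kappa_pos[of "CARD('n)"] lambda_HF_pos[OF s] s by (auto simp: \<kappa>_def \<Lambda>_def d_def p_def q_def Suc_le_eq)

lemma split_energy_eq:
  assumes "0 < \<rho>" "t \<in> {0..1/2}"
  shows "split_energy TYPE('n) s \<rho> t = \<kappa> * \<rho> powr p * powr_sum p t - \<Lambda> * \<rho> powr q * powr_sum q t"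
  using split_energy_powr_sum[OF assms, where 'n='n] by (simp add: \<kappa>_def \<Lambda>_def p_def q_def)

text \<open>\<open>rho_c\<close> is the density at which the fully polarized energy
  (\<open>t = 0\<close>) and the unpolarized one (\<open>t = 1/2\<close>) coincide. The second
  statement is this coincidence after division by the density.\<close>

lemma rho_c_props:
  assumes "s < 2"
  shows "0 < rho_c TYPE('n) s"
    and "\<kappa> * (1 - 2 powr (- (2 / d))) * rho_c TYPE('n) s powr (2 / d) = \<Lambda> * (1 - 2 powr (- (s / d))) * rho_c TYPE('n) s powr (s / d)"
    and "0 < \<rho> \<Longrightarrow> \<rho> < rho_c TYPE('n) s \<Longrightarrow> split_energy TYPE('n) s \<rho> 0 < split_energy TYPE('n) s \<rho> (1/2)"
    and "rho_c TYPE('n) s < \<rho> \<Longrightarrow> split_energy TYPE('n) s \<rho> (1/2) < split_energy TYPE('n) s \<rho> 0"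
    and "split_energy TYPE('n) s (rho_c TYPE('n) s) (1/2) = split_energy TYPE('n) s (rho_c TYPE('n) s) 0"
proof -
  note cp = consts_pos
  define a b where "a = 1 - 2 powr (- (2 / d))" and "b = 1 - 2 powr (- (s / d))"
  have ab: "0 < a" "0 < b" using cp s by (simp_all add: a_def b_def powr_less_one)
  define X where "X = \<Lambda> / \<kappa> * (b / a)"
  have X: "0 < X" using ab cp by (simp add: X_def)
  have \<rho>c: "rho_c TYPE('n) s = X powr (d / (2 - s))"
    by (simp add: rho_c_def X_def a_def b_def d_def \<kappa>_def \<Lambda>_def Let_def)
  show pos: "0 < rho_c TYPE('n) s" using X by (simp add: \<rho>c)
  define e where "e = (2 - s) / d"
  have e: "0 < e" using assms cp by (simp add: e_def)
  have \<rho>ce: "rho_c TYPE('n) s powr e = X" using X assms cp by (simp add: \<rho>c powr_powr e_def)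
  have pe: "\<rho> powr (2 / d) = \<rho> powr (s / d) * \<rho> powr e" if "0 < \<rho>" for \<rho>
    by (simp add: powr_add[symmetric] e_def add_divide_distrib[symmetric])
  \<comment> \<open>In this factorisation the sign is that of
    \<open>\<rho> powr e - rho_c powr e\<close>, with \<open>e > 0\<close> because
    \<open>s < 2\<close>.\<close>
  have diff: "split_energy TYPE('n) s \<rho> 0 - split_energy TYPE('n) s \<rho> (1/2) = \<kappa> * a * \<rho> powr q * (\<rho> powr e - rho_c TYPE('n) s powr e)"
    if "0 < \<rho>" for \<rho>
  proof -
    have h: "powr_sum r (1/2) = 2 powr (- (r - 1))" if "1 < r" for r
    proof -
      have "powr_sum r (1/2) = 2 * (1/2) powr r" by (simp add: powr_sum_def)
      also have "\<dots> = 2 powr (- (r - 1))" by (simp add: powr_divide powr_diff powr_minus field_simps)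
      finally show ?thesis .
    qed
    have z: "powr_sum r 0 = 1" if "1 < r" for r using that by (simp add: powr_sum_def)
    have hp: "powr_sum p (1/2) = 1 - a" "powr_sum q (1/2) = 1 - b"
      using h[OF cp(4)] h[OF cp(5)] by (simp_all add: a_def b_def p_def q_def d_def)
    have "\<rho> powr p = \<rho> powr q * \<rho> powr e"
      by (simp add: powr_add[symmetric] e_def p_def q_def d_def diff_divide_distrib)
    moreover have "\<Lambda> * b = \<kappa> * a * X" using cp ab by (simp add: X_def)
    moreover have "split_energy TYPE('n) s \<rho> 0 - split_energy TYPE('n) s \<rho> (1/2) = \<kappa> * \<rho> powr p * a - \<Lambda> * b * \<rho> powr q"
      using that by (simp add: split_energy_eq z[OF cp(4)] z[OF cp(5)] hp algebra_simps)
    ultimately show ?thesis unfolding \<rho>ce by (simp add: algebra_simps)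
  qed
  show "\<kappa> * (1 - 2 powr (- (2 / d))) * rho_c TYPE('n) s powr (2 / d) = \<Lambda> * (1 - 2 powr (- (s / d))) * rho_c TYPE('n) s powr (s / d)"
    unfolding pe[OF pos] \<rho>ce a_def[symmetric] b_def[symmetric] using cp ab by (simp add: X_def)
  have c: "0 < \<kappa> * a * \<rho> powr q" if "0 < \<rho>" for \<rho> using cp ab that by simp
  show "split_energy TYPE('n) s \<rho> 0 < split_energy TYPE('n) s \<rho> (1/2)" if "0 < \<rho>" "\<rho> < rho_c TYPE('n) s"
  proof -
    have "\<rho> powr e < rho_c TYPE('n) s powr e" using that e by (intro powr_less_mono2) auto
    then have "\<kappa> * a * \<rho> powr q * (\<rho> powr e - rho_c TYPE('n) s powr e) < 0" using c[OF that(1)] by (intro mult_pos_neg) auto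
    then show ?thesis using diff[OF that(1)] by linarith
  qed
  show "split_energy TYPE('n) s \<rho> (1/2) < split_energy TYPE('n) s \<rho> 0" if "rho_c TYPE('n) s < \<rho>"
  proof -
    have r: "0 < \<rho>" using that pos by simp
    have "rho_c TYPE('n) s powr e < \<rho> powr e" using that e pos by (intro powr_less_mono2) auto
    then have "0 < \<kappa> * a * \<rho> powr q * (\<rho> powr e - rho_c TYPE('n) s powr e)" by (intro mult_pos_pos[OF c[OF r]]) simp
    then show ?thesis using diff[OF r] by linarith
  qed
  show "split_energy TYPE('n) s (rho_c TYPE('n) s) (1/2) = split_energy TYPE('n) s (rho_c TYPE('n) s) 0"
    using diff[OF pos] by simp
qed

lemma first_order_interior:
  assumes "s < 2" "0 < \<rho>" "0 < t" "t < 1/2"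
  shows "min (split_energy TYPE('n) s \<rho> 0) (split_energy TYPE('n) s \<rho> (1/2)) < split_energy TYPE('n) s \<rho> t"
proof -
  note cp = consts_pos
  have pq: "q < p" using assms(1) cp by (simp add: p_def q_def d_def[symmetric] divide_strict_right_mono)
  \<comment> \<open>In dimension one \<open>p = 3\<close>, and \<open>s < 1\<close> gives
    \<open>q < 2\<close>; in higher dimensions \<open>p \<le> 2\<close>.\<close>
  have "p \<le> 2 \<or> p = 3 \<and> q < 2"
  proof (cases "CARD('n) = 1")
    case True
    then show ?thesis using s by (simp add: p_def q_def)
  next
    case False
    then have "CARD('n) \<ge> 2" using zero_less_card_finite[where 'a='n] by linarith
    then have "2 \<le> real CARD('n)" by simp
    then show ?thesis by (simp add: p_def)
  qed
  then show ?thesis using assms cp pq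
    unfolding split_energy_eq[OF assms(2), of 0, simplified] split_energy_eq[OF assms(2), of "1/2", simplified] split_energy_eq[OF assms(2), of t, simplified]
    by (subst split_energy_eq; simp?)+ (intro powr_sum_diff_first_order; simp)
qed

lemma first_order_phase:
  fixes w :: "real^'n \<Rightarrow> real"
  assumes "s < 2" and w: "w = riesz s"
  shows "0 < \<rho> \<Longrightarrow> \<rho> < rho_c TYPE('n) s \<Longrightarrow> pure_ferromagnetic w \<rho>"
    and "rho_c TYPE('n) s < \<rho> \<Longrightarrow> paramagnetic w \<rho>"
    and "HF_minimiser w (rho_c TYPE('n) s) \<gamma> \<longleftrightarrow> is_ferro (rho_c TYPE('n) s) \<gamma> \<or> is_para (rho_c TYPE('n) s) \<gamma>"
    and "derivative_jump (\<lambda>\<rho>. real_of_ereal (HF_minimum w \<rho>)) (rho_c TYPE('n) s)"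
proof -
  let ?G = "split_energy TYPE('n) s" and ?c = "rho_c TYPE('n) s"
  note rc = rho_c_props[OF assms(1)]
  note inner = first_order_interior[OF assms(1)]
  have low: "?G \<rho> 0 < ?G \<rho> t" if "0 < \<rho>" "\<rho> < ?c" "t \<in> {0..1/2}" "t \<noteq> 0" for \<rho> t
  proof (cases "t = 1/2")
    case True show ?thesis unfolding True by (rule rc(3)[OF that(1,2)])
  next
    case False
    then have "0 < t" "t < 1/2" using that by auto
    then show ?thesis using rc(3)[OF that(1,2)] inner[OF that(1), of t] by simp
  qed
  have high: "?G \<rho> (1/2) < ?G \<rho> t" if "?c < \<rho>" "t \<in> {0..1/2}" "t \<noteq> 1/2" for \<rho> t
  proof (cases "t = 0")
    case True show ?thesis unfolding True by (rule rc(4)[OF that(1)])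
  next
    case False
    then have "0 < t" "t < 1/2" "0 < \<rho>" using that rc(1) by auto
    then show ?thesis using rc(4)[OF that(1)] inner[of \<rho> t] by simp
  qed
  have crit: "?G ?c 0 < ?G ?c t" if "t \<in> {0..1/2}" "t \<noteq> 0" "t \<noteq> 1/2" for t
  proof -
    have "0 < t" "t < 1/2" using that by auto
    then show ?thesis using rc(5) inner[OF rc(1), of t] by simp
  qed
  have crit': "?G ?c 0 \<le> ?G ?c t" if "t \<in> {0..1/2}" for t
  proof (cases "t = 0 \<or> t = 1/2")
    case True then show ?thesis using rc(5) by (elim disjE) (simp_all only: order_refl)
  next
    case False then show ?thesis using crit[OF that] by auto
  qed
  show "pure_ferromagnetic w \<rho>" if "0 < \<rho>" "\<rho> < ?c"
    unfolding pure_ferromagnetic_def w using that low HF_unique_minimiser(2)[OF s, of \<rho> 0] by (simp add: is_ferro_iff)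
  show "paramagnetic w \<rho>" if "?c < \<rho>"
    unfolding paramagnetic_def w using that rc(1) high HF_unique_minimiser(2)[OF s, of \<rho> "1/2"] by (simp add: is_para_iff)
  have "HF_minimiser w ?c \<gamma> \<longleftrightarrow> (\<exists>t\<in>{0..1/2}. ?G ?c t = ?G ?c 0 \<and> is_mixed t ?c \<gamma>)"
    unfolding w by (rule HF_minimiser_iff(2)[OF s rc(1) _ crit']) auto
  also have "\<dots> \<longleftrightarrow> is_mixed 0 ?c \<gamma> \<or> is_mixed (1/2) ?c \<gamma>"
  proof
    assume "\<exists>t\<in>{0..1/2}. ?G ?c t = ?G ?c 0 \<and> is_mixed t ?c \<gamma>"
    then obtain t where t: "t \<in> {0..1/2}" "?G ?c t = ?G ?c 0" "is_mixed t ?c \<gamma>" by blast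
    then have "t = 0 \<or> t = 1/2" using crit[OF t(1)] by force
    then show "is_mixed 0 ?c \<gamma> \<or> is_mixed (1/2) ?c \<gamma>" using t(3) by metis
  next
    assume "is_mixed 0 ?c \<gamma> \<or> is_mixed (1/2) ?c \<gamma>"
    then show "\<exists>t\<in>{0..1/2}. ?G ?c t = ?G ?c 0 \<and> is_mixed t ?c \<gamma>"
      using rc(5) by (auto intro: bexI[of _ 0] bexI[of _ "1/2"])
  qed
  finally show "HF_minimiser w ?c \<gamma> \<longleftrightarrow> is_ferro ?c \<gamma> \<or> is_para ?c \<gamma>"
    using rc(1) by (simp add: is_ferro_iff is_para_iff)
  let ?E = "\<lambda>\<rho>. real_of_ereal (HF_minimum w \<rho>)" and ?F = "spinless_energy TYPE('n) s"
  let ?F' = "\<lambda>m. \<kappa> * p * m powr (2 / d) - \<Lambda> * q * m powr (s / d)"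
  have F: "(?F has_real_derivative ?F' m) (at m)" if "0 < m" for m
    using spinless_energy_deriv[OF that, where 'n='n, of s] by (simp add: \<kappa>_def \<Lambda>_def p_def q_def d_def)
  have Ec: "?E ?c = ?G ?c 0" unfolding w by (subst HF_minimiser_iff(1)[OF s rc(1) _ crit']) auto
  show "derivative_jump ?E ?c"
  proof (rule derivative_jumpI[OF rc(1) F])
    show "((\<lambda>m. 2 * ?F (m / 2)) has_real_derivative ?F' (x / 2)) (at x)" if "0 < x" for x
      using that by (auto intro!: derivative_eq_intros DERIV_chain2[of ?F, OF F])
    show "isCont ?F' ?c" "isCont (\<lambda>x. ?F' (x / 2)) ?c" using rc(1) by (auto intro!: continuous_intros)
    show "?E x = ?F x" if "0 < x" "x \<le> ?c" for x
    proof (cases "x = ?c")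
      case True then show ?thesis using Ec rc(1) by (simp add: split_energy_0)
    next
      case False
      then show ?thesis unfolding w using that low HF_unique_minimiser(1)[OF s, of x 0] by (simp add: split_energy_0)
    qed
    show "?E x = 2 * ?F (x / 2)" if "?c \<le> x" for x
    proof (cases "x = ?c")
      case True then show ?thesis using Ec rc(5) by (simp add: split_energy_half)
    next
      case False
      then show ?thesis unfolding w using that rc(1) high HF_unique_minimiser(1)[OF s, of x "1/2"] by (simp add: split_energy_half)
    qed
    show "?F' ?c \<noteq> ?F' (?c / 2)"
    proof -
      note cp = consts_pos
      define Z where "Z = \<kappa> * (1 - 2 powr (- (2 / d))) * ?c powr (2 / d)"
      have Z: "0 < Z" using cp rc(1) by (simp add: Z_def powr_less_one)
      have h: "(?c / 2) powr r = 2 powr (- r) * ?c powr r" for r by (simp add: powr_divide powr_minus_divide)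
      \<comment> \<open>The difference of the left and right derivatives. At coexistence the kinetic
        and exchange brackets have the same value \<open>Z\<close>, so only the difference of the
        exponents is left.\<close>
      have "?F' ?c - ?F' (?c / 2) = p * (\<kappa> * (1 - 2 powr (- (2 / d))) * ?c powr (2 / d)) - q * (\<Lambda> * (1 - 2 powr (- (s / d))) * ?c powr (s / d))"
        unfolding h by (simp add: algebra_simps)
      also have "\<dots> = (p - q) * Z" unfolding rc(2)[symmetric] Z_def[symmetric] by (simp add: algebra_simps)
      also have "\<dots> > 0" using Z assms(1) cp by (simp add: p_def q_def d_def[symmetric] divide_strict_right_mono)
      finally show ?thesis by simp
    qed
  qed
qed

text \<open>Translates the thresholds into the conditions of \<open>powr_sum_diff_min_right\<close>
  and \<open>powr_sum_diff_min_left\<close>. The leading factor 2 in \<open>rho_c_min\<close> comes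
  from \<open>2 powr (p - q)\<close> in the limiting gap ratio, absorbed by passing to
  \<open>\<rho> / 2\<close>.\<close>

lemma second_order_thresholds:
  assumes "2 < s" and \<rho>: "0 < \<rho>"
  shows "\<rho> \<le> rho_c_min TYPE('n) s \<longleftrightarrow> \<Lambda> * \<rho> powr q * q * ((q - 1) / (p - 1) * 2 powr (p - q)) \<le> \<kappa> * \<rho> powr p * p"
    and "rho_c_max TYPE('n) s \<le> \<rho> \<longleftrightarrow> \<kappa> * \<rho> powr p * p \<le> \<Lambda> * \<rho> powr q * q"
proof -
  note cp = consts_pos
  define e where "e = (s - 2) / d"
  have e: "0 < e" using assms cp by (simp add: e_def)
  have qe: "q = p + e" by (simp add: e_def p_def q_def d_def diff_divide_distrib)
  have root: "x \<le> Y powr (d / (s - 2)) \<longleftrightarrow> x powr e \<le> Y" "Y powr (d / (s - 2)) \<le> x \<longleftrightarrow> Y \<le> x powr e"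
    if "0 < x" "0 < Y" for x Y
  proof -
    have Y: "(Y powr (d / (s - 2))) powr e = Y" using that assms cp by (simp add: powr_powr e_def)
    have mono: "x \<le> y \<longleftrightarrow> x powr e \<le> y powr e" if "0 \<le> x" "0 \<le> y" for x y :: real
      using powr_mono2[of e x y] powr_less_mono2[of e y x] that e by (metis less_imp_le not_le)
    show "x \<le> Y powr (d / (s - 2)) \<longleftrightarrow> x powr e \<le> Y"
      using mono[of x "Y powr (d / (s - 2))"] that unfolding Y by simp
    show "Y powr (d / (s - 2)) \<le> x \<longleftrightarrow> Y \<le> x powr e"
      using mono[of "Y powr (d / (s - 2))" x] that unfolding Y by simp
  qed
  have pqd: "p = (d + 2) / d" "q = (d + s) / d" "p - 1 = 2 / d" "q - 1 = s / d"
    using cp by (simp_all add: p_def q_def d_def add_divide_distrib)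
  have rp: "0 < \<rho> powr p" using \<rho> by simp
  have "rho_c_max TYPE('n) s \<le> \<rho> \<longleftrightarrow> \<kappa> / \<Lambda> * ((d + 2) / (d + s)) \<le> \<rho> powr e"
    unfolding rho_c_max_def Let_def \<kappa>_def[symmetric] \<Lambda>_def[symmetric] d_def[symmetric]
    using cp s \<rho> by (intro root(2)) auto
  also have "\<dots> \<longleftrightarrow> \<kappa> * p \<le> \<Lambda> * \<rho> powr e * q"
  proof -
    have "\<kappa> / \<Lambda> * (u / v) \<le> r \<longleftrightarrow> \<kappa> * (u / d) \<le> \<Lambda> * r * (v / d)" if "0 < u" "0 < v" for u v r
      using that cp by (simp add: field_simps)
    then show ?thesis unfolding pqd(1,2) using cp s by simp
  qed
  also have "\<dots> \<longleftrightarrow> \<kappa> * p * \<rho> powr p \<le> \<Lambda> * \<rho> powr e * q * \<rho> powr p" by (rule mult_le_cancel_right_pos[OF rp, symmetric])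
  also have "\<dots> \<longleftrightarrow> \<kappa> * \<rho> powr p * p \<le> \<Lambda> * \<rho> powr q * q"
  proof -
    have "\<Lambda> * \<rho> powr e * q * \<rho> powr p = \<Lambda> * \<rho> powr q * q"
      unfolding arg_cong[OF qe, of "\<lambda>x. \<rho> powr x"] powr_add by (simp only: mult_ac)
    moreover have "\<kappa> * p * \<rho> powr p = \<kappa> * \<rho> powr p * p" by (simp only: mult_ac)
    ultimately show ?thesis by (simp only:)
  qed
  finally show "rho_c_max TYPE('n) s \<le> \<rho> \<longleftrightarrow> \<kappa> * \<rho> powr p * p \<le> \<Lambda> * \<rho> powr q * q" .
  have "\<rho> \<le> rho_c_min TYPE('n) s \<longleftrightarrow> \<rho> / 2 \<le> (\<kappa> / \<Lambda> * (2 * (d + 2) / (s * (d + s)))) powr (d / (s - 2))"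
    unfolding rho_c_min_def Let_def \<kappa>_def[symmetric] \<Lambda>_def[symmetric] d_def[symmetric] by (auto simp: field_simps)
  also have "\<dots> \<longleftrightarrow> (\<rho> / 2) powr e \<le> \<kappa> / \<Lambda> * (2 * (d + 2) / (s * (d + s)))"
    using cp s \<rho> by (intro root(1)) auto
  also have "(\<rho> / 2) powr e = \<rho> powr e * 2 powr (p - q)"
  proof -
    have "p - q = - e" using qe by simp
    then show ?thesis by (simp add: powr_divide powr_minus_divide)
  qed
  also have "\<rho> powr e * 2 powr (p - q) \<le> \<kappa> / \<Lambda> * (2 * (d + 2) / (s * (d + s))) \<longleftrightarrow>
      \<Lambda> * \<rho> powr e * q * ((q - 1) / (p - 1) * 2 powr (p - q)) \<le> \<kappa> * p"
  proof -
    have "r * z \<le> \<kappa> / \<Lambda> * (2 * u / (s * v)) \<longleftrightarrow> \<Lambda> * r * (v / d) * (s / d / (2 / d) * z) \<le> \<kappa> * (u / d)"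
      if "0 < u" "0 < v" for u v r z
      using that cp s by (simp add: field_simps)
    from this[of "d + 2" "d + s" "\<rho> powr e" "2 powr (p - q)"] show ?thesis
      using cp s by (simp only: pqd(3,4)) (simp only: pqd(1,2) add_pos_pos zero_less_numeral)
  qed
  also have "\<dots> \<longleftrightarrow> \<Lambda> * \<rho> powr e * q * ((q - 1) / (p - 1) * 2 powr (p - q)) * \<rho> powr p \<le> \<kappa> * p * \<rho> powr p" by (rule mult_le_cancel_right_pos[OF rp, symmetric])
  also have "\<dots> \<longleftrightarrow> \<Lambda> * \<rho> powr q * q * ((q - 1) / (p - 1) * 2 powr (p - q)) \<le> \<kappa> * \<rho> powr p * p"
  proof -
    have "\<Lambda> * \<rho> powr e * q * ((q - 1) / (p - 1) * 2 powr (p - q)) * \<rho> powr p = \<Lambda> * \<rho> powr q * q * ((q - 1) / (p - 1) * 2 powr (p - q))"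
      unfolding arg_cong[OF qe, of "\<lambda>x. \<rho> powr x"] powr_add by (simp only: mult_ac)
    moreover have "\<kappa> * p * \<rho> powr p = \<kappa> * \<rho> powr p * p" by (simp only: mult_ac)
    ultimately show ?thesis by (simp only:)
  qed
  finally show "\<rho> \<le> rho_c_min TYPE('n) s \<longleftrightarrow> \<Lambda> * \<rho> powr q * q * ((q - 1) / (p - 1) * 2 powr (p - q)) \<le> \<kappa> * \<rho> powr p * p" .
qed

lemma second_order_argmin:
  assumes "2 < s" and \<rho>: "0 < \<rho>"
  obtains t where "t \<in> {0..1/2}" "\<And>x. x \<in> {0..1/2} \<Longrightarrow> x \<noteq> t \<Longrightarrow> split_energy TYPE('n) s \<rho> t < split_energy TYPE('n) s \<rho> x"
    "\<rho> \<le> rho_c_min TYPE('n) s \<Longrightarrow> t = 1/2" "rho_c_max TYPE('n) s \<le> \<rho> \<Longrightarrow> t = 0"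
    "rho_c_min TYPE('n) s < \<rho> \<Longrightarrow> \<rho> < rho_c_max TYPE('n) s \<Longrightarrow> 0 < t \<and> t < 1/2"
proof -
  note cp = consts_pos and th = second_order_thresholds[OF assms]
  let ?P = "\<kappa> * \<rho> powr p" and ?Q = "\<Lambda> * \<rho> powr q"
  have PQ: "0 < ?P" "0 < ?Q" using cp \<rho> by auto
  have pq: "1 < p" "p < q" "q \<le> 2" using cp assms s by (auto simp: p_def q_def d_def[symmetric] divide_strict_right_mono)
  \<comment> \<open>The limiting gap ratio exceeds its value 1 at \<open>t = 0\<close>, so both
    conditions cannot hold together; in particular the regimes do not overlap.\<close>
  have excl: "\<not> (\<rho> \<le> rho_c_min TYPE('n) s \<and> rho_c_max TYPE('n) s \<le> \<rho>)"
  proof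
    assume h: "\<rho> \<le> rho_c_min TYPE('n) s \<and> rho_c_max TYPE('n) s \<le> \<rho>"
    have "powr_gap (q - 1) 0 / powr_gap (p - 1) 0 < (q - 1) / (p - 1) * 2 powr ((p - 1) - (q - 1))"
      using pq by (intro powr_gap_ratio_upper) auto
    then have "1 < (q - 1) / (p - 1) * 2 powr (p - q)" by (simp add: powr_gap_def)
    then have "?Q * q * 1 < ?Q * q * ((q - 1) / (p - 1) * 2 powr (p - q))"
      using PQ cp by (intro mult_strict_left_mono) auto
    then show False using h th by linarith
  qed
  have G: "split_energy TYPE('n) s \<rho> x = ?P * powr_sum p x - ?Q * powr_sum q x" if "x \<in> {0..1/2}" for x
    by (rule split_energy_eq[OF \<rho> that])
  consider "\<rho> \<le> rho_c_min TYPE('n) s" | "rho_c_max TYPE('n) s \<le> \<rho>" | "rho_c_min TYPE('n) s < \<rho>" "\<rho> < rho_c_max TYPE('n) s"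
    by linarith
  then show thesis
  proof cases
    case 1
    show thesis
    proof (rule that[of "1/2"])
      fix x :: real assume "x \<in> {0..1/2}" "x \<noteq> 1/2"
      then show "split_energy TYPE('n) s \<rho> (1/2) < split_energy TYPE('n) s \<rho> x"
        using powr_sum_diff_min_right[OF pq PQ(2), of ?P x] th(1) 1 by (simp add: G)
    qed (use 1 excl in auto)
  next
    case 2
    show thesis
    proof (rule that[of 0])
      fix x :: real assume "x \<in> {0..1/2}" "x \<noteq> 0"
      then show "split_energy TYPE('n) s \<rho> 0 < split_energy TYPE('n) s \<rho> x"
        using powr_sum_diff_min_left[OF pq PQ(1), of ?Q x] th(2) 2 by (simp add: G)
    qed (use 2 excl in auto)
  next
    case 3
    obtain t where t: "0 < t" "t < 1/2" "\<And>x. 0 \<le> x \<Longrightarrow> x \<le> 1/2 \<Longrightarrow> x \<noteq> t \<Longrightarrow> ?P * powr_sum p t - ?Q * powr_sum q t < ?P * powr_sum p x - ?Q * powr_sum q x"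
      using powr_sum_diff_min_middle[OF pq PQ(2), of ?P] th 3 by (metis not_le)
    show thesis
    proof (rule that[of t])
      fix x :: real assume "x \<in> {0..1/2}" "x \<noteq> t"
      then show "split_energy TYPE('n) s \<rho> t < split_energy TYPE('n) s \<rho> x" using t by (simp add: G)
    qed (use t 3 in auto)
  qed
qed

lemma second_order_phase:
  fixes w :: "real^'n \<Rightarrow> real"
  assumes "2 < s" and w: "w = riesz s"
  shows "0 < \<rho> \<Longrightarrow> \<rho> \<le> rho_c_min TYPE('n) s \<Longrightarrow> paramagnetic w \<rho>"
    and "rho_c_min TYPE('n) s < \<rho> \<Longrightarrow> \<rho> < rho_c_max TYPE('n) s \<Longrightarrow>
      \<exists>!t. 0 < t \<and> t < 1 / 2 \<and> (\<forall>\<gamma>. HF_minimiser w \<rho> \<gamma> \<longleftrightarrow> is_mixed t \<rho> \<gamma>)"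
    and "rho_c_max TYPE('n) s \<le> \<rho> \<Longrightarrow> pure_ferromagnetic w \<rho>"
    and "continuously_differentiable_on {0<..} (\<lambda>\<rho>. real_of_ereal (HF_minimum w \<rho>))"
proof -
  note cp = consts_pos
  let ?G = "split_energy TYPE('n) s" and ?a = "rho_c_min TYPE('n) s" and ?b = "rho_c_max TYPE('n) s"
  have ab: "0 < ?a" "0 < ?b" using cp s unfolding rho_c_min_def rho_c_max_def Let_def
    by (auto simp: \<kappa>_def[symmetric] \<Lambda>_def[symmetric])
  have "\<forall>\<rho>. \<exists>t. 0 < \<rho> \<longrightarrow> t \<in> {0..1/2} \<and> (\<forall>x\<in>{0..1/2}. x \<noteq> t \<longrightarrow> ?G \<rho> t < ?G \<rho> x) \<and>
      (\<rho> \<le> ?a \<longrightarrow> t = 1/2) \<and> (?b \<le> \<rho> \<longrightarrow> t = 0) \<and> (?a < \<rho> \<and> \<rho> < ?b \<longrightarrow> 0 < t \<and> t < 1/2)"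
    by (metis second_order_argmin[OF assms(1)])
  then obtain \<tau> where \<tau>: "\<And>\<rho>. 0 < \<rho> \<Longrightarrow> \<tau> \<rho> \<in> {0..1/2} \<and> (\<forall>x\<in>{0..1/2}. x \<noteq> \<tau> \<rho> \<longrightarrow> ?G \<rho> (\<tau> \<rho>) < ?G \<rho> x) \<and>
      (\<rho> \<le> ?a \<longrightarrow> \<tau> \<rho> = 1/2) \<and> (?b \<le> \<rho> \<longrightarrow> \<tau> \<rho> = 0) \<and> (?a < \<rho> \<and> \<rho> < ?b \<longrightarrow> 0 < \<tau> \<rho> \<and> \<tau> \<rho> < 1/2)"
    by metis
  have um: "HF_minimum w \<rho> = ereal (?G \<rho> (\<tau> \<rho>))" "HF_minimiser w \<rho> \<gamma> \<longleftrightarrow> is_mixed (\<tau> \<rho>) \<rho> \<gamma>" if "0 < \<rho>" for \<rho> \<gamma>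
    unfolding w using \<tau>[OF that] by (auto intro!: HF_unique_minimiser[OF s that])
  show "paramagnetic w \<rho>" if "0 < \<rho>" "\<rho> \<le> ?a"
    unfolding paramagnetic_def using um(2)[OF that(1)] \<tau>[OF that(1)] that by (simp add: is_para_iff)
  show "pure_ferromagnetic w \<rho>" if "?b \<le> \<rho>"
  proof -
    have r: "0 < \<rho>" using that ab by simp
    show ?thesis unfolding pure_ferromagnetic_def using um(2)[OF r] \<tau>[OF r] that r by (simp add: is_ferro_iff)
  qed
  show "\<exists>!t. 0 < t \<and> t < 1 / 2 \<and> (\<forall>\<gamma>. HF_minimiser w \<rho> \<gamma> \<longleftrightarrow> is_mixed t \<rho> \<gamma>)" if "?a < \<rho>" "\<rho> < ?b"
  proof -
    have r: "0 < \<rho>" using that ab by simp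
    show ?thesis
    proof (rule ex1I[of _ "\<tau> \<rho>"])
      show "0 < \<tau> \<rho> \<and> \<tau> \<rho> < 1 / 2 \<and> (\<forall>\<gamma>. HF_minimiser w \<rho> \<gamma> \<longleftrightarrow> is_mixed (\<tau> \<rho>) \<rho> \<gamma>)"
        using \<tau>[OF r] that um(2)[OF r] by simp
      fix t assume t: "0 < t \<and> t < 1 / 2 \<and> (\<forall>\<gamma>. HF_minimiser w \<rho> \<gamma> \<longleftrightarrow> is_mixed t \<rho> \<gamma>)"
      \<comment> \<open>A mixed state with another \<open>t\<close> would be a minimiser too, so
        \<open>t\<close> would minimise the split energy, whose minimiser is unique.\<close>
      obtain \<gamma> :: "real^'n \<Rightarrow> complex^2^2" where g: "is_mixed t \<rho> \<gamma>" using ex_is_mixed[of t \<rho>, where 'n='n] t r by auto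
      then have "HF_energy w \<gamma> = HF_minimum w \<rho>" using t by (auto simp: HF_minimiser_def)
      moreover have "HF_energy w \<gamma> = ereal (?G \<rho> t)" unfolding w using is_mixed_energy[OF s r _ g] t by auto
      ultimately have "?G \<rho> t = ?G \<rho> (\<tau> \<rho>)" using um(1)[OF r] by simp
      then show "t = \<tau> \<rho>" using \<tau>[OF r] t by (metis atLeastAtMost_iff less_imp_le less_irrefl)
    qed
  qed
  let ?E = "\<lambda>\<rho>. real_of_ereal (HF_minimum w \<rho>)"
  let ?E2 = "\<lambda>\<rho>. \<kappa> * \<rho> powr p * powr_sum p (\<tau> \<rho>) - \<Lambda> * \<rho> powr q * powr_sum q (\<tau> \<rho>)"
  \<comment> \<open>The derivative at frozen \<open>\<tau> \<rho>\<close>. By the envelope theorem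
    no derivative of \<tau> enters, and continuity of \<tau> makes the energy continuously
    differentiable across both thresholds.\<close>
  let ?D = "\<lambda>\<rho>. \<kappa> * (p * \<rho> powr (p - 1)) * powr_sum p (\<tau> \<rho>) - \<Lambda> * (q * \<rho> powr (q - 1)) * powr_sum q (\<tau> \<rho>)"
  have cu: "continuous_on {0..1/2} (powr_sum p)" "continuous_on {0..1/2} (powr_sum q)"
    using cp by (auto intro!: continuous_on_powr_sum)
  have A: "((\<lambda>\<rho>. \<kappa> * \<rho> powr p) has_real_derivative \<kappa> * (p * x powr (p - 1))) (at x)" if "x \<in> {0<..}" for x
    using that by (auto intro!: derivative_eq_intros)
  have B: "((\<lambda>\<rho>. \<Lambda> * \<rho> powr q) has_real_derivative \<Lambda> * (q * x powr (q - 1))) (at x)" if "x \<in> {0<..}" for x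
    using that by (auto intro!: derivative_eq_intros)
  have \<tau>T: "\<tau> x \<in> {0..1/2}" if "x \<in> {0<..}" for x using \<tau>[of x] that by auto
  have \<tau>min: "\<kappa> * x powr p * powr_sum p (\<tau> x) - \<Lambda> * x powr q * powr_sum q (\<tau> x) < \<kappa> * x powr p * powr_sum p t - \<Lambda> * x powr q * powr_sum q t"
    if "x \<in> {0<..}" "t \<in> {0..1/2}" "t \<noteq> \<tau> x" for x t
    using \<tau>[of x] that split_energy_eq[of x t] split_energy_eq[of x "\<tau> x"] by auto
  have c\<tau>: "continuous_on {0<..} \<tau>"
    by (rule envelope_argmin_continuous[OF open_greaterThan compact_Icc cu A B \<tau>T \<tau>min])
  have dE: "(?E2 has_real_derivative ?D x) (at x)" if "x \<in> {0<..}" for x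
    by (rule envelope_derivative[OF open_greaterThan compact_Icc cu A B \<tau>T \<tau>min that])
  have EE: "?E2 x = ?E x" if "x \<in> {0<..}" for x
    using that um(1)[of x] split_energy_eq[of x "\<tau> x"] \<tau>T[OF that] by simp
  have dE': "(?E has_real_derivative ?D x) (at x)" if "x \<in> {0<..}" for x
    by (rule has_field_derivative_transform_within_open[OF dE[OF that] open_greaterThan that EE])
  show "continuously_differentiable_on {0<..} ?E"
    unfolding continuously_differentiable_on_def
  proof (intro conjI ballI)
    show "?E differentiable (at x)" if "x \<in> {0<..}" for x using dE'[OF that] by (auto simp: real_differentiable_def)
    have "continuous_on {0<..} ?D"
      by (intro continuous_intros continuous_on_compose2[OF cu(1) c\<tau>] continuous_on_compose2[OF cu(2) c\<tau>]) (use \<tau>T in auto)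
    then show "continuous_on {0<..} (deriv ?E)"
      using dE' by (subst continuous_on_cong[OF refl, of _ _ ?D]) (auto simp: DERIV_imp_deriv)
  qed
qed

text \<open>For \<open>s = 2\<close> the exponents agree, so the split energy is
  \<open>(\<kappa> - \<Lambda>) * \<rho> powr p\<close> times \<open>powr_sum p\<close>, which is
  strictly decreasing up to \<open>1/2\<close>; the sign of the prefactor decides for every density
  at once.\<close>

lemma critical_phase:
  fixes w :: "real^'n \<Rightarrow> real"
  assumes s2: "s = 2" and w: "w = riesz s" and \<rho>: "0 < \<rho>"
  shows "\<Lambda> < \<kappa> \<Longrightarrow> paramagnetic w \<rho>" and "\<kappa> < \<Lambda> \<Longrightarrow> pure_ferromagnetic w \<rho>"
proof -
  note cp = consts_pos
  have pq: "q = p" using s2 by (simp add: p_def q_def)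
  have g: "powr_gap (p - 1) x > 0" if "0 < x" "x < 1/2" for x using that cp by (intro powr_gap_pos) auto
  have r: "\<rho> powr p > 0" using \<rho> by simp
  show "paramagnetic w \<rho>" if h: "\<Lambda> < \<kappa>"
  proof -
    let ?P = "(\<kappa> - \<Lambda>) * \<rho> powr p"
    have P: "?P * p > 0" using h r cp by simp
    have "split_energy TYPE('n) s \<rho> (1/2) < split_energy TYPE('n) s \<rho> x" if "x \<in> {0..1/2}" "x \<noteq> 1/2" for x
    proof -
      have "?P * powr_sum p (1/2) - 0 * powr_sum p (1/2) < ?P * powr_sum p x - 0 * powr_sum p x"
        using that cp P g by (intro powr_sum_diff_greater) auto
      then show ?thesis using that \<rho> by (simp add: split_energy_eq pq algebra_simps)
    qed
    then show ?thesis unfolding paramagnetic_def w using HF_unique_minimiser(2)[OF s \<rho>, of "1/2"] \<rho> by (simp add: is_para_iff)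
  qed
  show "pure_ferromagnetic w \<rho>" if h: "\<kappa> < \<Lambda>"
  proof -
    let ?Q = "(\<Lambda> - \<kappa>) * \<rho> powr p"
    have Q: "?Q * p > 0" using h r cp by simp
    have "split_energy TYPE('n) s \<rho> 0 < split_energy TYPE('n) s \<rho> x" if "x \<in> {0..1/2}" "x \<noteq> 0" for x
    proof -
      have "0 * powr_sum p 0 - ?Q * powr_sum p 0 < 0 * powr_sum p x - ?Q * powr_sum p x"
        using that cp Q g by (intro powr_sum_diff_less) auto
      then show ?thesis using that \<rho> by (simp add: split_energy_eq pq algebra_simps)
    qed
    then show ?thesis unfolding pure_ferromagnetic_def w using HF_unique_minimiser(2)[OF s \<rho>, of 0] \<rho> by (simp add: is_ferro_iff)
  qed
qed

end

theorem theorem13: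
  fixes s :: real and w :: "real^'n \<Rightarrow> real"
  assumes "0 < s" and "s < real CARD('n)"
    and "w = riesz s"
  shows
    "(s < min 2 (real CARD('n)) \<longrightarrow>
        (\<forall>\<rho>. 0 < \<rho> \<and> \<rho> < rho_c TYPE('n) s \<longrightarrow> pure_ferromagnetic w \<rho>) \<and>
        (\<forall>\<rho>. rho_c TYPE('n) s < \<rho> \<longrightarrow> paramagnetic w \<rho>) \<and>
        (\<forall>\<gamma>. HF_minimiser w (rho_c TYPE('n) s) \<gamma> \<longleftrightarrow>
               is_ferro (rho_c TYPE('n) s) \<gamma> \<or> is_para (rho_c TYPE('n) s) \<gamma>) \<and>
        derivative_jump (\<lambda>\<rho>. real_of_ereal (HF_minimum w \<rho>)) (rho_c TYPE('n) s))
   \<and> (CARD('n) \<ge> 3 \<and> min 2 (real CARD('n)) < s \<longrightarrow>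
        (\<forall>\<rho>. 0 < \<rho> \<and> \<rho> \<le> rho_c_min TYPE('n) s \<longrightarrow> paramagnetic w \<rho>) \<and>
        (\<forall>\<rho>. rho_c_min TYPE('n) s < \<rho> \<and> \<rho> < rho_c_max TYPE('n) s \<longrightarrow>
           (\<exists>!t. 0 < t \<and> t < 1 / 2 \<and> (\<forall>\<gamma>. HF_minimiser w \<rho> \<gamma> \<longleftrightarrow> is_mixed t \<rho> \<gamma>))) \<and>
        (\<forall>\<rho>. rho_c_max TYPE('n) s \<le> \<rho> \<longrightarrow> pure_ferromagnetic w \<rho>) \<and>
        continuously_differentiable_on {0<..} (\<lambda>\<rho>. real_of_ereal (HF_minimum w \<rho>)))
   \<and> (CARD('n) \<ge> 3 \<and> s = 2 \<longrightarrow>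
        (kappa CARD('n) - lambda_HF TYPE('n) 2 > 0 \<longrightarrow> (\<forall>\<rho>>0. paramagnetic w \<rho>)) \<and>
        (kappa CARD('n) - lambda_HF TYPE('n) 2 < 0 \<longrightarrow> (\<forall>\<rho>>0. pure_ferromagnetic w \<rho>)))"
proof (intro conjI impI)
  note h = assms(1,2)
  show "\<forall>\<rho>. 0 < \<rho> \<and> \<rho> < rho_c TYPE('n) s \<longrightarrow> pure_ferromagnetic w \<rho>"
    "\<forall>\<rho>. rho_c TYPE('n) s < \<rho> \<longrightarrow> paramagnetic w \<rho>"
    "\<forall>\<gamma>. HF_minimiser w (rho_c TYPE('n) s) \<gamma> \<longleftrightarrow> is_ferro (rho_c TYPE('n) s) \<gamma> \<or> is_para (rho_c TYPE('n) s) \<gamma>"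
    "derivative_jump (\<lambda>\<rho>. real_of_ereal (HF_minimum w \<rho>)) (rho_c TYPE('n) s)"
    if "s < min 2 (real CARD('n))"
    using first_order_phase[OF h _ assms(3)] that by auto
  show "\<forall>\<rho>. 0 < \<rho> \<and> \<rho> \<le> rho_c_min TYPE('n) s \<longrightarrow> paramagnetic w \<rho>"
    "\<forall>\<rho>. rho_c_min TYPE('n) s < \<rho> \<and> \<rho> < rho_c_max TYPE('n) s \<longrightarrow>
       (\<exists>!t. 0 < t \<and> t < 1 / 2 \<and> (\<forall>\<gamma>. HF_minimiser w \<rho> \<gamma> \<longleftrightarrow> is_mixed t \<rho> \<gamma>))"
    "\<forall>\<rho>. rho_c_max TYPE('n) s \<le> \<rho> \<longrightarrow> pure_ferromagnetic w \<rho>"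
    "continuously_differentiable_on {0<..} (\<lambda>\<rho>. real_of_ereal (HF_minimum w \<rho>))"
    if "3 \<le> CARD('n) \<and> min 2 (real CARD('n)) < s"
  proof -
    have "3 \<le> real CARD('n)" using that by simp
    then have "2 < s" using that by (auto simp: min_def split: if_splits)
    note p = second_order_phase[OF h this assms(3)]
    show "\<forall>\<rho>. 0 < \<rho> \<and> \<rho> \<le> rho_c_min TYPE('n) s \<longrightarrow> paramagnetic w \<rho>" using p(1) by blast
    show "\<forall>\<rho>. rho_c_min TYPE('n) s < \<rho> \<and> \<rho> < rho_c_max TYPE('n) s \<longrightarrow>
       (\<exists>!t. 0 < t \<and> t < 1 / 2 \<and> (\<forall>\<gamma>. HF_minimiser w \<rho> \<gamma> \<longleftrightarrow> is_mixed t \<rho> \<gamma>))" using p(2) by blast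
    show "\<forall>\<rho>. rho_c_max TYPE('n) s \<le> \<rho> \<longrightarrow> pure_ferromagnetic w \<rho>" using p(3) by blast
    show "continuously_differentiable_on {0<..} (\<lambda>\<rho>. real_of_ereal (HF_minimum w \<rho>))" by (rule p(4))
  qed
  show "\<forall>\<rho>>0. paramagnetic w \<rho>" if "3 \<le> CARD('n) \<and> s = 2" "0 < kappa CARD('n) - lambda_HF TYPE('n) 2"
    using critical_phase(1)[OF h _ assms(3)] that by simp
  show "\<forall>\<rho>>0. pure_ferromagnetic w \<rho>" if "3 \<le> CARD('n) \<and> s = 2" "kappa CARD('n) - lambda_HF TYPE('n) 2 < 0"
    using critical_phase(2)[OF h _ assms(3)] that by simp
qed

end
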